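(* Let $d\ge3$ and $l\ge1$ be fixed integers. Let $G\in\mathcal{G}_{n,d}$ be a uniformly random $d$-regular graph on $n$ vertices and let $u,v$ be vertices of $G$ chosen independently with uniform probability. Let $\gamma(n,d)=\frac12\log_{d-1}n-\left\lfloor\frac12\log_{d-1}n\right\rfloor$. Then the probability that $u$ and $v$ are joined by exactly $l$ distinct geodesics is asymptotic, as $n\to\infty$, to $$\sum_{k=-\infty}^{\infty}\frac{\big(d(d-1)^{2k-2\gamma(n,d)-2}\big)^l}{l!}\exp\left(-\frac{d(d-1)^{2k-2\gamma(n,d)-1}}{d-2}\right)\Big(1+(d-1)^l\exp\big(-d(d-1)^{2k-2\gamma(n,d)-1}\big)\Big).$$
   Context: $\mathcal{G}_{n,d}$ denotes the probability space of (simple, labelled) $d$-regular graphs on $n$ vertices with the uniform distribution. Asymptotics are for $n\to\infty$ with $d\ge3$ fixed, and $n$ restricted to even values if $d$ is odd. A geodesic between $u$ and $v$ is a shortest path in $G$ between $u$ and $v$. "Asymptotic" ($a_n\sim b_n$) means $a_n/b_n\to1$. *)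

theory Defs
  imports "HOL-Probability.Probability" "HOL-Library.Landau_Symbols"
begin

text \<open>A simple labelled graph on the vertex set \<open>{..<n}\<close> is given by its set of edges,
  each edge being a two-element set of vertices.\<close>

definition regular_graphs :: "nat \<Rightarrow> nat \<Rightarrow> nat set set set" where
  "regular_graphs n d =
    {E. E \<subseteq> {e. e \<subseteq> {..<n} \<and> card e = 2} \<and> (\<forall>v<n. card {e \<in> E. v \<in> e} = d)}"

text \<open>Paths are lists of vertices read from \<open>u\<close> to \<open>v\<close>, so that for given end vertices each path
  is represented by exactly one list; the path from a vertex to itself is \<open>[u]\<close>.\<close>

definition is_path :: "'a set set \<Rightarrow> 'a \<Rightarrow> 'a \<Rightarrow> 'a list \<Rightarrow> bool" where
  "is_path E u v p \<longleftrightarrow>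
    p \<noteq> [] \<and> hd p = u \<and> last p = v \<and> distinct p \<and> successively (\<lambda>x y. {x, y} \<in> E) p"

definition geodesics :: "'a set set \<Rightarrow> 'a \<Rightarrow> 'a \<Rightarrow> 'a list set" where
  "geodesics E u v = {p. is_path E u v p \<and> (\<forall>q. is_path E u v q \<longrightarrow> length p \<le> length q)}"

text \<open>A uniformly random \<open>d\<close>-regular graph on \<open>{..<n}\<close> with two independent, uniformly random
  vertices (possibly equal). This is only meaningful if \<open>n > d\<close> and \<open>n * d\<close> is even, as otherwise
  \<open>pmf_of_set\<close> may be applied to the empty set.\<close>

definition random_regular_graph :: "nat \<Rightarrow> nat \<Rightarrow> nat set set pmf" where
  "random_regular_graph n d = pmf_of_set (regular_graphs n d)"

definition random_graph_and_vertices :: "nat \<Rightarrow> nat \<Rightarrow> (nat set set \<times> nat \<times> nat) pmf" where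
  "random_graph_and_vertices n d =
    pair_pmf (random_regular_graph n d) (pair_pmf (pmf_of_set {..<n}) (pmf_of_set {..<n}))"

definition \<gamma> :: "nat \<Rightarrow> nat \<Rightarrow> real" where
  "\<gamma> n d = 1/2 * log (real d - 1) (real n) - of_int \<lfloor>1/2 * log (real d - 1) (real n)\<rfloor>"

text \<open>The filter for \<open>n \<rightarrow> \<infinity>\<close>, with \<open>n\<close> restricted to even values if \<open>d\<close> is odd.\<close>

definition admissible_at_top :: "nat \<Rightarrow> nat filter" where
  "admissible_at_top d = inf at_top (principal {n. odd d \<longrightarrow> even n})"

end

theory Submission
  imports Defs
begin

text \<open>
  Put \<open>b = d - 1\<close>, split \<open>r = i + j\<close> evenly, and consider triples \<open>(E, u, v)\<close> with
  \<open>dist u v > r\<close>, i.e. with disjoint balls of radius \<open>i\<close> around \<open>u\<close> and \<open>j\<close> around \<open>v\<close>. Paths of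
  length \<open>r + 1\<close> are then the edges between the two spheres. Replacing such an edge \<open>xy\<close> and an edge
  \<open>zw\<close> outside the balls by \<open>xz\<close> and \<open>yw\<close> leaves both balls intact and removes one of these edges.
  Counting such switchings from both sides, the probabilities \<open>p l\<close> of exactly \<open>l\<close> edges satisfy
  \<open>(l + 1) p (l + 1) = \<mu> p l + o(1)\<close> with \<open>\<mu> = d b ^ r / n\<close>; thus \<open>p l\<close> is asymptotically a Poisson
  weight times the probability \<open>q\<close> of \<open>dist u v > r\<close>, and \<open>q\<close> is multiplied by \<open>exp (- \<mu>)\<close> when \<open>r\<close>
  increases by one. The same switching shows that a ball of size \<open>O(sqrt n)\<close> is on average almost a
  tree, which makes the backward count asymptotically \<open>d b ^ i\<close> times \<open>d b ^ j\<close> and makes geodesics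
  that share their middle edge negligible. With \<open>r = 2 * \<lfloor>log b n / 2\<rfloor> + t\<close> the mean is
  \<open>d b powr (t - 2 \<gamma>)\<close>, and summing over the integers \<open>t\<close> in pairs gives the series.
\<close>

text \<open>No configuration model is used: bijective switchings compare sets of simple graphs
  directly, so only uniformity enters. The even split is what makes them work. If \<open>s\<close>
  of order \<open>sqrt n\<close> bounds \<open>b ^ i\<close> and \<open>b ^ j\<close>, a ball has on
  average O(1) excess edges against some \<open>sqrt n\<close> stubs, and the exceptional choices of
  a remote edge or of two stubs are a fraction of order \<open>1 / sqrt n\<close>; a single ball of
  radius \<open>r\<close> would hold a positive fraction of all vertices and be far from a tree. The
  obstacle in the limit is that the mean does not converge, since \<open>\<gamma>\<close> keeps
  oscillating. Every limit statement therefore says that a difference tends to 0, under bounds on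
  the mean that are uniform in \<open>n\<close>, and the final passage to a ratio needs a lower
  bound on the series that is uniform as well. Switchings yield only the ratios of consecutive
  \<open>p l\<close>; the normalisation comes from \<open>q\<close>, with Markov's inequality
  excluding an escape of mass to large \<open>l\<close>. For \<open>q\<close> itself, the recursion
  in \<open>r\<close> starts at a very negative \<open>t\<close>, where a union bound gives a value
  close to 1.\<close>

section \<open>Neighbourhoods and ordered edges of regular graphs\<close>

definition nbr :: "'a set set \<Rightarrow> 'a \<Rightarrow> 'a set" where
  "nbr E x = {y. {x, y} \<in> E}"

lemma nbr_sym: "y \<in> nbr E x \<longleftrightarrow> x \<in> nbr E y"
  by (simp add: nbr_def insert_commute)

lemma nbr_edge: "y \<in> nbr E x \<longleftrightarrow> {x, y} \<in> E"
  by (simp add: nbr_def)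

lemma card_incident_edges:
  assumes "\<forall>e\<in>E. card e = 2"
  shows "card {e \<in> E. v \<in> e} = card (nbr E v)"
proof -
  have "bij_betw (\<lambda>y. {v, y}) (nbr E v) {e \<in> E. v \<in> e}"
    unfolding bij_betw_def
  proof
    show "inj_on (\<lambda>y. {v, y}) (nbr E v)"
      by (auto simp: inj_on_def doubleton_eq_iff)
    show "(\<lambda>y. {v, y}) ` nbr E v = {e \<in> E. v \<in> e}"
    proof (intro equalityI subsetI)
      fix e assume "e \<in> {e \<in> E. v \<in> e}"
      then have e: "e \<in> E" "v \<in> e" by auto
      with assms have "card e = 2" by auto
      then obtain a b where "e = {a, b}" by (auto simp: card_2_iff)
      with e obtain y where "e = {v, y}" by (auto simp: insert_commute)
      with e show "e \<in> (\<lambda>y. {v, y}) ` nbr E v" by (auto simp: nbr_def)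
    qed (auto simp: nbr_def)
  qed
  then show ?thesis by (metis bij_betw_same_card)
qed

text \<open>A switching alters the neighbourhoods of four vertices and no others, so regularity is
  easiest to check vertex by vertex.\<close>

lemma regular_graphs_iff:
  "E \<in> regular_graphs n d \<longleftrightarrow>
     (\<forall>e\<in>E. card e = 2) \<and> (\<forall>x y. y \<in> nbr E x \<longrightarrow> x < n \<and> y < n) \<and> (\<forall>v<n. card (nbr E v) = d)"
proof
  assume E: "E \<in> regular_graphs n d"
  then have c: "\<forall>e\<in>E. card e = 2" by (auto simp: regular_graphs_def)
  moreover have "\<forall>x y. y \<in> nbr E x \<longrightarrow> x < n \<and> y < n"
    using E by (force simp: regular_graphs_def nbr_def)
  moreover have "\<forall>v<n. card (nbr E v) = d"
    using E card_incident_edges[OF c] by (simp add: regular_graphs_def)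
  ultimately show "(\<forall>e\<in>E. card e = 2) \<and> (\<forall>x y. y \<in> nbr E x \<longrightarrow> x < n \<and> y < n) \<and> (\<forall>v<n. card (nbr E v) = d)"
    by blast
next
  assume a: "(\<forall>e\<in>E. card e = 2) \<and> (\<forall>x y. y \<in> nbr E x \<longrightarrow> x < n \<and> y < n) \<and> (\<forall>v<n. card (nbr E v) = d)"
  have "e \<subseteq> {..<n} \<and> card e = 2" if "e \<in> E" for e
  proof -
    have c: "card e = 2" using a that by auto
    then obtain x y where "e = {x, y}" by (auto simp: card_2_iff)
    with a that c show ?thesis by (auto simp: nbr_def)
  qed
  with a card_incident_edges[of E] show "E \<in> regular_graphs n d"
    by (auto simp: regular_graphs_def)
qed

lemma finite_regular_graphs: "finite (regular_graphs n d)"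
  by (rule finite_subset[of _ "Pow (Pow {..<n})"]) (auto simp: regular_graphs_def)

lemma nbr_lt: "E \<in> regular_graphs n d \<Longrightarrow> y \<in> nbr E x \<Longrightarrow> x < n \<and> y < n"
  by (simp add: regular_graphs_iff)

lemma nbr_neq: "E \<in> regular_graphs n d \<Longrightarrow> y \<in> nbr E x \<Longrightarrow> x \<noteq> y"
  by (auto simp: regular_graphs_iff nbr_def)

lemma card_nbr: "E \<in> regular_graphs n d \<Longrightarrow> v < n \<Longrightarrow> card (nbr E v) = d"
  by (simp add: regular_graphs_iff)

lemma finite_nbr: "E \<in> regular_graphs n d \<Longrightarrow> finite (nbr E v)"
  by (rule finite_subset[of _ "{..<n}"]) (auto dest: nbr_lt)

lemma card_nbr_le: "E \<in> regular_graphs n d \<Longrightarrow> card (nbr E v) \<le> d"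
  by (cases "v < n") (auto simp: card_nbr, metis card.empty all_not_in_conv nbr_lt zero_le)

text \<open>Both orientations of an edge count, because the two ends of the remote edge play
  different roles in a switching; this is why the total is \<open>n * d\<close>.\<close>

definition ordered_edges :: "'a set set \<Rightarrow> ('a \<times> 'a) set" where
  "ordered_edges E = {(z, w). w \<in> nbr E z}"

lemma ordered_edges_Sigma:
  "E \<in> regular_graphs n d \<Longrightarrow> ordered_edges E = Sigma {..<n} (nbr E)"
  by (auto simp: ordered_edges_def dest: nbr_lt)

lemma finite_ordered_edges: "E \<in> regular_graphs n d \<Longrightarrow> finite (ordered_edges E)"
  by (simp add: ordered_edges_Sigma finite_nbr)

lemma card_ordered_edges: "E \<in> regular_graphs n d \<Longrightarrow> card (ordered_edges E) = n * d"
  by (simp add: ordered_edges_Sigma finite_nbr card_SigmaI card_nbr)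

lemma card_Sigma_le:
  assumes "finite A" "\<And>a. a \<in> A \<Longrightarrow> finite (B a)" "\<And>a. a \<in> A \<Longrightarrow> card (B a) \<le> k"
  shows "card (Sigma A B) \<le> card A * k"
  using assms sum_bounded_above[of A "\<lambda>a. card (B a)" k] by (simp add: card_SigmaI)

lemma card_ordered_edges_restrict:
  assumes E: "E \<in> regular_graphs n d" and A: "finite A"
  shows "card {(z, w). w \<in> nbr E z \<and> z \<in> A} \<le> card A * d"
    and "card {(z, w). w \<in> nbr E z \<and> w \<in> A} \<le> card A * d"
proof -
  have eq: "{(z, w). w \<in> nbr E z \<and> z \<in> A} = Sigma A (nbr E)" by auto
  show 1: "card {(z, w). w \<in> nbr E z \<and> z \<in> A} \<le> card A * d"
    unfolding eq by (rule card_Sigma_le) (use A E in \<open>auto simp: finite_nbr card_nbr_le\<close>)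
  have "{(z, w). w \<in> nbr E z \<and> w \<in> A} = prod.swap ` {(z, w). w \<in> nbr E z \<and> z \<in> A}"
    using nbr_sym by (force simp: image_iff)
  also have "card \<dots> = card {(z, w). w \<in> nbr E z \<and> z \<in> A}"
    by (rule card_image) auto
  finally show "card {(z, w). w \<in> nbr E z \<and> w \<in> A} \<le> card A * d" using 1 by simp
qed

text \<open>An excluded ordered edge has a prescribed end in \<open>B\<close>, in
  \<open>nbr E x\<close> or in \<open>nbr E y\<close>, and at most \<open>d * card A\<close> ordered
  edges have a prescribed end in a set \<open>A\<close>. The conditions on \<open>nbr E x\<close>
  and \<open>nbr E y\<close> prevent a switching from creating a double edge.\<close>

lemma card_switchable_edges_ge:
  assumes E: "E \<in> regular_graphs n d" and B: "finite B"
  shows "n * d \<le> card {(z, w). w \<in> nbr E z \<and> z \<notin> B \<and> w \<notin> B \<and> z \<notin> nbr E x \<and> w \<notin> nbr E y}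
           + 2 * d * card B + 2 * d * d"
    (is "_ \<le> card ?A + _ + _")
proof -
  let ?R = "\<lambda>A. {(z, w). w \<in> nbr E z \<and> z \<in> A}" and ?S = "\<lambda>A. {(z, w). w \<in> nbr E z \<and> w \<in> A}"
  have sub: "ordered_edges E \<subseteq> ?A \<union> (?R B \<union> (?S B \<union> (?R (nbr E x) \<union> ?S (nbr E y))))"
    by (auto simp: ordered_edges_def)
  have fin: "finite X" if "X \<subseteq> ordered_edges E" for X
    using that E finite_ordered_edges finite_subset by blast
  have f: "finite ?A" "finite (?R C)" "finite (?S C)" for C
    by (rule fin; auto simp: ordered_edges_def)+
  have "n * d = card (ordered_edges E)" using E by (simp add: card_ordered_edges)
  also have "\<dots> \<le> card (?A \<union> (?R B \<union> (?S B \<union> (?R (nbr E x) \<union> ?S (nbr E y)))))"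
    by (rule card_mono[OF _ sub]) (use f in auto)
  also have "\<dots> \<le> card ?A + (card (?R B) + (card (?S B) + (card (?R (nbr E x)) + card (?S (nbr E y)))))"
    by (meson card_Un_le order_trans add_left_mono)
  also have "card (?R B) \<le> card B * d" by (rule card_ordered_edges_restrict[OF E B])
  also have "card (?S B) \<le> card B * d" by (rule card_ordered_edges_restrict[OF E B])
  also have "card (?R (nbr E x)) \<le> d * d"
    using card_ordered_edges_restrict(1)[OF E finite_nbr[OF E]] card_nbr_le[OF E]
    by (meson mult_le_mono1 order_trans)
  also have "card (?S (nbr E y)) \<le> d * d"
    using card_ordered_edges_restrict(2)[OF E finite_nbr[OF E]] card_nbr_le[OF E]
    by (meson mult_le_mono1 order_trans)
  finally show ?thesis by (simp add: algebra_simps)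
qed

subsection \<open>Balls and spheres\<close>

text \<open>The ball of radius \<open>k\<close>. Distances enter only through membership in balls,
  so vertices in different components need no convention.\<close>

fun nbhd :: "'a set set \<Rightarrow> 'a \<Rightarrow> nat \<Rightarrow> 'a set" where
  "nbhd E u 0 = {u}"
| "nbhd E u (Suc k) = nbhd E u k \<union> (\<Union>x\<in>nbhd E u k. nbr E x)"

definition sphere_at :: "'a set set \<Rightarrow> 'a \<Rightarrow> nat \<Rightarrow> 'a set" where
  "sphere_at E u k = {x \<in> nbhd E u k. \<forall>j<k. x \<notin> nbhd E u j}"

lemma nbhd_mono: "j \<le> k \<Longrightarrow> nbhd E u j \<subseteq> nbhd E u k"
  by (rule lift_Suc_mono_le[of "nbhd E u"]) auto

lemma nbhd_trans: "y \<in> nbhd E u a \<Longrightarrow> z \<in> nbhd E y b \<Longrightarrow> z \<in> nbhd E u (a + b)"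
  by (induction b arbitrary: z) auto

lemma nbhd_split: "z \<in> nbhd E u (a + b) \<Longrightarrow> \<exists>y\<in>nbhd E u a. z \<in> nbhd E y b"
  by (induction b arbitrary: z) (auto, blast+)

lemma nbhd_sym1: "y \<in> nbhd E u k \<Longrightarrow> u \<in> nbhd E y k"
proof (induction k arbitrary: y)
  case (Suc k)
  then consider "y \<in> nbhd E u k" | x where "x \<in> nbhd E u k" "y \<in> nbr E x" by auto
  then show ?case
  proof cases
    case 1
    then show ?thesis using Suc.IH by auto
  next
    case 2
    then have "x \<in> nbhd E y 1" "u \<in> nbhd E x k"
      using Suc.IH by (auto simp: nbr_sym)
    from nbhd_trans[OF this] show ?thesis by simp
  qed
qed auto

lemma nbhd_sym: "y \<in> nbhd E u k \<longleftrightarrow> u \<in> nbhd E y k"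
  using nbhd_sym1 by metis

text \<open>A path of length at most \<open>i + j\<close> can be cut into pieces of lengths at most
  \<open>i\<close> and \<open>j\<close>, and the cut point lies in both balls. This turns the
  distance condition into one that a switching visibly preserves.\<close>

lemma nbhd_disjoint_iff: "v \<notin> nbhd E u (i + j) \<longleftrightarrow> nbhd E u i \<inter> nbhd E v j = {}"
  using nbhd_trans[of _ E u i v j] nbhd_split[of v E u i j] nbhd_sym[of v E _ j] by blast

lemma sphere_subset_nbhd: "sphere_at E u k \<subseteq> nbhd E u k"
  by (auto simp: sphere_at_def)

lemma sphere_at_0 [simp]: "sphere_at E u 0 = {u}"
  by (auto simp: sphere_at_def)

lemma sphere_at_Suc: "sphere_at E u (Suc k) = nbhd E u (Suc k) - nbhd E u k"
  using nbhd_mono[of _ k E u] by (auto simp: sphere_at_def less_Suc_eq_le)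

lemma sphere_at_diff: "j < k \<Longrightarrow> x \<in> sphere_at E u k \<Longrightarrow> x \<notin> nbhd E u j"
  by (auto simp: sphere_at_def)

lemma nbhd_sphere: "x \<in> nbhd E u k \<Longrightarrow> \<exists>j\<le>k. x \<in> sphere_at E u j"
proof -
  assume x: "x \<in> nbhd E u k"
  let ?j = "LEAST j. x \<in> nbhd E u j"
  have "x \<in> nbhd E u ?j" using x by (rule LeastI)
  moreover have "?j \<le> k" using x by (rule Least_le)
  moreover have "\<forall>j<?j. x \<notin> nbhd E u j" using not_less_Least by blast
  ultimately show ?thesis by (auto simp: sphere_at_def)
qed

lemma sphere_at_pred:
  assumes "x \<in> sphere_at E u (Suc k)"
  obtains p where "p \<in> sphere_at E u k" "p \<in> nbr E x"
proof -
  from assms have x: "x \<in> nbhd E u (Suc k)" "x \<notin> nbhd E u k"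
    by (auto simp: sphere_at_Suc)
  then obtain p where p: "p \<in> nbhd E u k" "x \<in> nbr E p" by auto
  have "p \<notin> nbhd E u j" if "j < k" for j
  proof
    assume "p \<in> nbhd E u j"
    then have "x \<in> nbhd E u (Suc j)" using p by auto
    with x nbhd_mono[of "Suc j" k E u] that show False by auto
  qed
  with p that show thesis by (auto simp: sphere_at_def nbr_sym)
qed

lemma nbr_nbhd: "x \<in> nbhd E u k \<Longrightarrow> y \<in> nbr E x \<Longrightarrow> y \<in> nbhd E u (Suc k)"
  by auto

lemma nbhd_lt: "E \<in> regular_graphs n d \<Longrightarrow> u < n \<Longrightarrow> nbhd E u k \<subseteq> {..<n}"
  by (induction k) (auto dest: nbr_lt)

lemma finite_nbhd: "E \<in> regular_graphs n d \<Longrightarrow> finite (nbhd E u k)"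
  by (induction k) (auto simp: finite_nbr)

lemma finite_sphere_at: "E \<in> regular_graphs n d \<Longrightarrow> finite (sphere_at E u k)"
  by (meson finite_nbhd finite_subset sphere_subset_nbhd)

text \<open>The neighbours of vertices on the outermost sphere are never consulted when the ball is
  grown; hence the strict \<open>j < k\<close>. Edges may thus be rewired at that sphere without
  changing the ball.\<close>

lemma nbhd_cong:
  assumes "\<And>j x. j < k \<Longrightarrow> x \<in> nbhd E u j \<Longrightarrow> nbr E' x = nbr E x" "j \<le> k"
  shows "nbhd E' u j = nbhd E u j"
  using assms(2)
proof (induction j)
  case (Suc j)
  then have "nbhd E' u j = nbhd E u j" by simp
  moreover have "nbr E' x = nbr E x" if "x \<in> nbhd E u j" for x
    using assms(1)[of j x] Suc.prems that by simp
  ultimately show ?case by simp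
qed simp

lemma sphere_at_cong:
  assumes "\<And>j x. j < k \<Longrightarrow> x \<in> nbhd E u j \<Longrightarrow> nbr E' x = nbr E x"
  shows "sphere_at E' u k = sphere_at E u k"
  using nbhd_cong[of k E u E'] assms by (auto simp: sphere_at_def)

subsection \<open>Growth of spheres\<close>

definition out_edges :: "'a set set \<Rightarrow> 'a \<Rightarrow> nat \<Rightarrow> ('a \<times> 'a) set" where
  "out_edges E u k = {(x, z). x \<in> sphere_at E u k \<and> z \<in> nbr E x \<and> z \<notin> nbhd E u k}"

definition parent :: "'a set set \<Rightarrow> 'a \<Rightarrow> nat \<Rightarrow> 'a \<Rightarrow> 'a" where
  "parent E u k x = (SOME p. p \<in> nbr E x \<and> p \<in> sphere_at E u (k - 1))"

text \<open>The edges that close a cycle in a breadth-first search: those inside the sphere, listed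
  from both ends, and those back to the previous sphere other than the chosen parent edge.\<close>

definition excess_edges :: "'a set set \<Rightarrow> 'a \<Rightarrow> nat \<Rightarrow> ('a \<times> 'a) set" where
  "excess_edges E u k = {(x, y). x \<in> sphere_at E u k \<and> y \<in> nbr E x \<and> y \<in> nbhd E u k \<and>
     y \<noteq> parent E u k x}"

lemma parent:
  assumes "x \<in> sphere_at E u (Suc k)"
  shows "parent E u (Suc k) x \<in> nbr E x" "parent E u (Suc k) x \<in> sphere_at E u k"
  unfolding parent_def using someI_ex[of "\<lambda>p. p \<in> nbr E x \<and> p \<in> sphere_at E u k"]
    sphere_at_pred[OF assms] by auto

lemma out_edges_sphere:
  assumes "(x, z) \<in> out_edges E u k" shows "z \<in> sphere_at E u (Suc k)"
proof -
  have "x \<in> nbhd E u k" "z \<in> nbr E x" "z \<notin> nbhd E u k"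
    using assms sphere_subset_nbhd[of E u k] by (auto simp: out_edges_def)
  then show ?thesis by (auto simp: sphere_at_Suc)
qed

lemma out_edges_0: "E \<in> regular_graphs n d \<Longrightarrow> out_edges E u 0 = {u} \<times> nbr E u"
  by (auto simp: out_edges_def dest: nbr_neq)

lemma finite_out_edges: "E \<in> regular_graphs n d \<Longrightarrow> finite (out_edges E u k)"
  by (rule finite_subset[OF _ finite_ordered_edges]) (auto simp: out_edges_def ordered_edges_def)

lemma finite_excess_edges: "E \<in> regular_graphs n d \<Longrightarrow> finite (excess_edges E u k)"
  by (rule finite_subset[OF _ finite_ordered_edges]) (auto simp: excess_edges_def ordered_edges_def)

lemma card_out_edges_Suc_le:
  assumes E: "E \<in> regular_graphs n d"
  shows "card (out_edges E u (Suc k)) \<le> (d - 1) * card (sphere_at E u (Suc k))"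
proof -
  let ?S = "sphere_at E u (Suc k)"
  have "out_edges E u (Suc k) \<subseteq> Sigma ?S (\<lambda>x. nbr E x - {parent E u (Suc k) x})"
  proof clarify
    fix x z assume "(x, z) \<in> out_edges E u (Suc k)"
    then have x: "x \<in> ?S" "z \<in> nbr E x" "z \<notin> nbhd E u (Suc k)" by (auto simp: out_edges_def)
    have "parent E u (Suc k) x \<in> nbhd E u (Suc k)"
      using parent(2)[OF x(1)] sphere_subset_nbhd[of E u k] by auto
    with x show "x \<in> ?S \<and> z \<in> nbr E x - {parent E u (Suc k) x}" by auto
  qed
  then have "card (out_edges E u (Suc k)) \<le> card (Sigma ?S (\<lambda>x. nbr E x - {parent E u (Suc k) x}))"
    by (rule card_mono[rotated]) (use E in \<open>auto simp: finite_nbr finite_sphere_at\<close>)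
  also have "\<dots> \<le> card ?S * (d - 1)"
  proof (rule card_Sigma_le)
    fix x assume x: "x \<in> ?S"
    show "card (nbr E x - {parent E u (Suc k) x}) \<le> d - 1"
      using card_nbr_le[OF E, of x] parent(1)[OF x] finite_nbr[OF E] by (simp add: diff_le_mono)
  qed (use E in \<open>auto simp: finite_nbr finite_sphere_at\<close>)
  finally show ?thesis by (simp add: mult.commute)
qed

lemma card_sphere_Suc_le:
  assumes E: "E \<in> regular_graphs n d"
  shows "card (sphere_at E u (Suc k)) \<le> card (out_edges E u k)"
proof (rule surj_card_le[where f = snd])
  show "finite (out_edges E u k)" using E by (rule finite_out_edges)
  show "sphere_at E u (Suc k) \<subseteq> snd ` out_edges E u k"
  proof
    fix x assume x: "x \<in> sphere_at E u (Suc k)"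
    have "(parent E u (Suc k) x, x) \<in> out_edges E u k"
      using parent[OF x] sphere_at_diff[OF _ x, of k] by (auto simp: out_edges_def nbr_sym)
    then show "x \<in> snd ` out_edges E u k" by force
  qed
qed

lemma card_out_edges_le:
  assumes E: "E \<in> regular_graphs n d"
  shows "card (out_edges E u k) \<le> d * (d - 1) ^ k"
proof (induction k)
  case 0
  show ?case using E by (simp add: out_edges_0 card_cartesian_product card_nbr_le)
next
  case (Suc k)
  have "card (out_edges E u (Suc k)) \<le> (d - 1) * card (out_edges E u k)"
    using card_out_edges_Suc_le[OF E] card_sphere_Suc_le[OF E] by (meson le_trans mult_le_mono2)
  also have "\<dots> \<le> (d - 1) * (d * (d - 1) ^ k)" using Suc.IH by (rule mult_le_mono2)
  finally show ?case by (simp add: mult_ac)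
qed

lemma card_sphere_le:
  assumes E: "E \<in> regular_graphs n d"
  shows "card (sphere_at E u (Suc k)) \<le> d * (d - 1) ^ k"
  using card_sphere_Suc_le[OF E] card_out_edges_le[OF E] le_trans by blast

lemma card_nbhd_le:
  assumes E: "E \<in> regular_graphs n d" and d: "d \<ge> 3"
  shows "card (nbhd E u k) \<le> 2 * d * (d - 1) ^ k"
proof (induction k)
  case 0
  then show ?case using d by simp
next
  case (Suc k)
  have "nbhd E u (Suc k) = nbhd E u k \<union> sphere_at E u (Suc k)"
    by (auto simp: sphere_at_Suc)
  then have "card (nbhd E u (Suc k)) \<le> card (nbhd E u k) + card (sphere_at E u (Suc k))"
    by (metis card_Un_le)
  also have "\<dots> \<le> 2 * d * (d - 1) ^ k + d * (d - 1) ^ k"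
    using Suc.IH card_sphere_le[OF E] by (rule add_mono)
  \<comment> \<open>From 3 to 4, and then \<open>4 <= 2 * (d - 1)\<close>: the factor 2 in the claim
    reproduces itself because \<open>d - 1 >= 2\<close>.\<close>
  also have "\<dots> \<le> 4 * (d * (d - 1) ^ k)" by simp
  also have "\<dots> \<le> 2 * (d - 1) * (d * (d - 1) ^ k)"
    using d by (intro mult_right_mono) auto
  finally show ?case by (simp add: mult_ac)
qed

text \<open>An excess edge does harm twice. It uses up one of the \<open>d - 1\<close> exits of its
  vertex, and, read backwards, it may be an out edge hitting a vertex that already has a parent,
  which costs a vertex of the sphere with its \<open>d - 1\<close> exits. The total is
  \<open>1 + (d - 1) = d\<close>.\<close>

lemma card_out_edges_Suc_ge:
  assumes E: "E \<in> regular_graphs n d" and d: "d \<ge> 3" and u: "u < n"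
  shows "(d - 1) * card (out_edges E u k) \<le> card (out_edges E u (Suc k)) + d * card (excess_edges E u (Suc k))"
proof -
  let ?S = "sphere_at E u (Suc k)" and ?X = "excess_edges E u (Suc k)"
  have "Sigma ?S (\<lambda>x. nbr E x - {parent E u (Suc k) x}) \<subseteq> out_edges E u (Suc k) \<union> ?X"
    by (auto simp: out_edges_def excess_edges_def)
  then have "card (Sigma ?S (\<lambda>x. nbr E x - {parent E u (Suc k) x})) \<le> card (out_edges E u (Suc k) \<union> ?X)"
    by (rule card_mono[rotated]) (use E in \<open>auto simp: finite_out_edges finite_excess_edges\<close>)
  also have "\<dots> \<le> card (out_edges E u (Suc k)) + card ?X" by (rule card_Un_le)
  also have "card (Sigma ?S (\<lambda>x. nbr E x - {parent E u (Suc k) x})) = (\<Sum>x\<in>?S. d - 1)"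
  proof (subst card_SigmaI)
    show "(\<Sum>x\<in>?S. card (nbr E x - {parent E u (Suc k) x})) = (\<Sum>x\<in>?S. d - 1)"
    proof (rule sum.cong)
      fix x assume x: "x \<in> ?S"
      have "x < n" using x nbhd_lt[OF E u, of "Suc k"] sphere_subset_nbhd[of E u "Suc k"] by blast
      then show "card (nbr E x - {parent E u (Suc k) x}) = d - 1"
        using card_nbr[OF E] parent(1)[OF x] finite_nbr[OF E] by simp
    qed simp
  qed (use E in \<open>auto simp: finite_nbr finite_sphere_at\<close>)
  finally have 1: "(d - 1) * card ?S \<le> card (out_edges E u (Suc k)) + card ?X"
    by (simp add: mult.commute)
  have "out_edges E u k \<subseteq> (\<lambda>x. (parent E u (Suc k) x, x)) ` ?S \<union> prod.swap ` ?X"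
  proof clarify
    fix x z assume xz: "(x, z) \<in> out_edges E u k" and nX: "(x, z) \<notin> prod.swap ` ?X"
    have z: "z \<in> ?S" using xz by (rule out_edges_sphere)
    have "(z, x) \<notin> ?X" using nX by force
    then have "x = parent E u (Suc k) z"
      using xz z sphere_subset_nbhd[of E u k] by (auto simp: excess_edges_def out_edges_def nbr_sym)
    with z show "(x, z) \<in> (\<lambda>x. (parent E u (Suc k) x, x)) ` ?S" by auto
  qed
  then have "card (out_edges E u k) \<le> card ((\<lambda>x. (parent E u (Suc k) x, x)) ` ?S \<union> prod.swap ` ?X)"
    by (rule card_mono[rotated]) (use E in \<open>auto simp: finite_sphere_at finite_excess_edges\<close>)
  also have "\<dots> \<le> card ?S + card ?X"
    using E by (meson add_mono card_Un_le card_image_le finite_sphere_at finite_excess_edges order_trans)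
  finally have "(d - 1) * card (out_edges E u k) \<le> (d - 1) * card ?S + (d - 1) * card ?X"
    by (metis add_mult_distrib2 mult_le_mono2)
  with 1 have "(d - 1) * card (out_edges E u k) \<le> card (out_edges E u (Suc k)) + (1 + (d - 1)) * card ?X"
    by (simp add: add_mult_distrib)
  then show ?thesis using d by simp
qed

text \<open>Every excess edge costs at most the subtrees of the \<open>(d - 1)\<close>-ary tree below its two ends.\<close>

lemma out_edges_deficit:
  assumes E: "E \<in> regular_graphs n d" and d: "d \<ge> 3" and u: "u < n"
  shows "real d * real (d - 1) ^ i - card (out_edges E u i)
    \<le> (\<Sum>k=1..i. real d * real (d - 1) ^ (i - k) * card (excess_edges E u k))"
proof (induction i)
  case 0
  show ?case using E u by (simp add: out_edges_0 card_cartesian_product card_nbr)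
next
  case (Suc i)
  let ?b = "real (d - 1)" and ?X = "\<lambda>k. real (card (excess_edges E u k))"
  have "real ((d - 1) * card (out_edges E u i)) \<le> real (card (out_edges E u (Suc i)) + d * card (excess_edges E u (Suc i)))"
    using card_out_edges_Suc_ge[OF assms] by (simp only: of_nat_le_iff)
  then have "d * ?b ^ Suc i - card (out_edges E u (Suc i)) \<le> ?b * (d * ?b ^ i - card (out_edges E u i)) + d * ?X (Suc i)"
    by (simp add: right_diff_distrib mult_ac)
  also have "\<dots> \<le> ?b * (\<Sum>k=1..i. d * ?b ^ (i - k) * ?X k) + d * ?X (Suc i)"
    using Suc.IH by (intro add_right_mono mult_left_mono) auto
  also have "?b * (\<Sum>k=1..i. d * ?b ^ (i - k) * ?X k) = (\<Sum>k=1..i. d * ?b ^ (Suc i - k) * ?X k)"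
    unfolding sum_distrib_left by (rule sum.cong) (auto simp: Suc_diff_le)
  finally show ?case by simp
qed

subsection \<open>Switchings\<close>

definition switch :: "'a set set \<Rightarrow> 'a \<Rightarrow> 'a \<Rightarrow> 'a \<Rightarrow> 'a \<Rightarrow> 'a set set" where
  "switch E x y z w = (E - {{x, y}, {z, w}}) \<union> {{x, z}, {y, w}}"

text \<open>The inequalities \<open>x \<noteq> w\<close> and \<open>y \<noteq> z\<close> follow:
  otherwise \<open>z\<close> would be a neighbour of \<open>x\<close>, or \<open>w\<close> one of
  \<open>y\<close>.\<close>

definition switchable :: "'a set set \<Rightarrow> 'a \<Rightarrow> 'a \<Rightarrow> 'a \<Rightarrow> 'a \<Rightarrow> bool" where
  "switchable E x y z w \<longleftrightarrow>
     y \<in> nbr E x \<and> w \<in> nbr E z \<and> z \<notin> nbr E x \<and> w \<notin> nbr E y \<and> x \<noteq> z \<and> y \<noteq> w"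

lemma switchable_facts:
  assumes "switchable E x y z w"
  shows "y \<in> nbr E x" "w \<in> nbr E z" "x \<in> nbr E y" "z \<in> nbr E w"
    "z \<notin> nbr E x" "w \<notin> nbr E y" "x \<notin> nbr E z" "y \<notin> nbr E w"
    "x \<noteq> z" "y \<noteq> w" "x \<noteq> w" "y \<noteq> z"
  using assms nbr_sym[of x E y] nbr_sym[of z E w] nbr_sym[of x E z] nbr_sym[of y E w]
  by (auto simp: switchable_def)

text \<open>The roles of \<open>xy, zw\<close> and \<open>xz, yw\<close> are symmetric, so undoing a
  switching is again a switching, with \<open>y\<close> and \<open>z\<close> exchanged. Forward and
  backward counts can therefore share all lemmas.\<close>

lemma switch_inverse:
  assumes "switchable E x y z w"
  shows "switch (switch E x y z w) x z y w = E"
  using assms by (auto simp: switch_def switchable_def nbr_def)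

lemma nbr_switch:
  assumes E: "E \<in> regular_graphs n d" and s: "switchable E x y z w"
  shows "nbr (switch E x y z w) a =
    (if a = x then insert z (nbr E x - {y}) else if a = y then insert w (nbr E y - {x})
     else if a = z then insert x (nbr E z - {w}) else if a = w then insert y (nbr E w - {z})
     else nbr E a)"
proof -
  have "x \<noteq> y" "z \<noteq> w" using s nbr_neq[OF E] by (auto simp: switchable_def)
  moreover have "x \<noteq> w" "y \<noteq> z" using switchable_facts[OF s] by auto
  ultimately show ?thesis
    using s unfolding nbr_def switch_def switchable_def
    by (auto simp: doubleton_eq_iff)
qed

lemma switch_regular:
  assumes E: "E \<in> regular_graphs n d" and s: "switchable E x y z w"
  shows "switch E x y z w \<in> regular_graphs n d"
  unfolding regular_graphs_iff
proof (intro conjI allI impI ballI)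
  have neq: "x \<noteq> y" "z \<noteq> w" "x \<noteq> z" "y \<noteq> w" using s nbr_neq[OF E] by (auto simp: switchable_def)
  fix e assume "e \<in> switch E x y z w"
  then show "card e = 2" using E neq by (auto simp: switch_def regular_graphs_iff)
next
  have lt: "x < n" "y < n" "z < n" "w < n" using s nbr_lt[OF E] by (auto simp: switchable_def)
  fix a b assume "b \<in> nbr (switch E x y z w) a"
  then show "a < n" "b < n" using lt nbr_lt[OF E] unfolding nbr_switch[OF E s]
    by (auto split: if_splits)
next
  have nb: "y \<in> nbr E x" "w \<in> nbr E z" "x \<in> nbr E y" "z \<in> nbr E w"
    "z \<notin> nbr E x" "w \<notin> nbr E y" "x \<notin> nbr E z" "y \<notin> nbr E w"
    using switchable_facts[OF s] by auto
  fix v assume v: "v < n"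
  have f: "card (insert p (nbr E v - {q})) = d" if "q \<in> nbr E v" "p \<notin> nbr E v" for p q
    using that finite_nbr[OF E] card_nbr[OF E v]
    by (metis DiffD1 card.remove card_insert_disjoint finite_Diff)
  consider "v = x" | "v = y" | "v = z" | "v = w" | "v \<notin> {x, y, z, w}" by auto
  then show "card (nbr (switch E x y z w) v) = d"
    unfolding nbr_switch[OF E s]
    by cases (use nb f[of y z] f[of x w] f[of w x] f[of z y] nbr_neq[OF E] card_nbr[OF E v]
      switchable_facts[OF s] in auto)
qed

lemma switch_inverse_switchable:
  assumes E: "E \<in> regular_graphs n d" and s: "switchable E x y z w"
  shows "switchable (switch E x y z w) x z y w"
proof -
  have neq: "x \<noteq> y" "z \<noteq> w" "x \<noteq> z" "y \<noteq> w" using s nbr_neq[OF E] by (auto simp: switchable_def)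
  have "x \<noteq> w" "y \<noteq> z" using switchable_facts[OF s] by auto
  with neq s show ?thesis
    by (auto simp: switchable_def nbr_def switch_def doubleton_eq_iff)
qed

lemma nbr_switch_outside:
  assumes "a \<notin> {x, y, z, w}"
  shows "nbr (switch E x y z w) a = nbr E a"
  using assms by (auto simp: nbr_def switch_def doubleton_eq_iff)

text \<open>No vertex of the ball is lost: \<open>x\<close> is still reached through its parent, and
  a vertex other than \<open>x\<close> is reached from a vertex nearer than \<open>x\<close>, hence
  not along \<open>xy\<close>. The ball may grow: if \<open>y\<close> lies one level lower, the new
  edge \<open>yw\<close> brings \<open>w\<close> into it.\<close>

lemma nbhd_switch_excess:
  assumes xy: "(x, y) \<in> excess_edges E u k" and k: "k \<ge> 1"
    and zw: "z \<notin> nbhd E u k" "w \<notin> nbhd E u k" and j: "j \<le> k"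
  shows "nbhd E u j \<subseteq> nbhd (switch E x y z w) u j"
  using j
proof (induction j)
  case (Suc j)
  let ?E' = "switch E x y z w"
  have x: "x \<in> sphere_at E u k" "y \<noteq> parent E u k x" using xy by (auto simp: excess_edges_def)
  have IH: "nbhd E u j \<subseteq> nbhd ?E' u j" using Suc by simp
  show ?case
  proof
    fix s assume s: "s \<in> nbhd E u (Suc j)"
    have nin: "s \<noteq> z" "s \<noteq> w" using s zw nbhd_mono[OF Suc.prems, of E u] by auto
    have "\<exists>r\<in>nbhd E u j. s \<in> nbr ?E' r" if sn: "s \<notin> nbhd E u j"
    proof (cases "s = x")
      case True
      then have "k = Suc j" using s x Suc.prems sphere_at_diff[of "Suc j" k x E u] by force
      then have p: "parent E u k x \<in> nbr E x" "parent E u k x \<in> nbhd E u j"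
        using parent[of x E u j] x sphere_subset_nbhd[of E u j] by auto
      then have "{parent E u k x, x} \<noteq> {z, w}" using nin True by auto
      moreover have "{parent E u k x, x} \<noteq> {x, y}" using x p by (auto simp: doubleton_eq_iff)
      ultimately have "s \<in> nbr ?E' (parent E u k x)"
        using True p by (auto simp: nbr_def switch_def insert_commute)
      with p show ?thesis by blast
    next
      case False
      from s sn obtain r where r: "r \<in> nbhd E u j" "s \<in> nbr E r" by auto
      have "r \<noteq> x" using sphere_at_diff[OF _ x(1), of j] r Suc.prems by auto
      with False have "{r, s} \<noteq> {x, y}" by (auto simp: doubleton_eq_iff)
      moreover have "{r, s} \<noteq> {z, w}" using nin by auto
      ultimately show ?thesis using r by (intro bexI[of _ r]) (simp_all add: nbr_def switch_def)
    qed
    then show "s \<in> nbhd ?E' u (Suc j)" using IH by auto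
  qed
qed simp

lemma sum_mono_prod:
  fixes f g :: "'a \<Rightarrow> 'b \<Rightarrow> real"
  assumes "\<And>a b. (a, b) \<in> A \<Longrightarrow> f a b \<le> g a b"
  shows "(\<Sum>(a, b)\<in>A. f a b) \<le> (\<Sum>(a, b)\<in>A. g a b)"
  using assms by (intro sum_mono) auto

lemma card_Sigma_prod:
  assumes "finite A" "\<And>a b. (a, b) \<in> A \<Longrightarrow> finite (B a b)"
  shows "card (SIGMA (a, b) : A. B a b) = (\<Sum>(a, b)\<in>A. card (B a b))"
  using assms by (subst card_SigmaI) (auto intro!: sum.cong)

text \<open>Switching away an excess edge together with a remote edge leaves its ends inside the ball, and
  the balls offer few pairs of ends: excess edges are therefore rare on average.\<close>

lemma sum_excess_edges_le:
  assumes d: "d \<ge> 3" and k: "k \<ge> 1" and large: "8 * d * (d - 1) ^ k + 4 * d \<le> n"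
  shows "(\<Sum>(E, u) \<in> regular_graphs n d \<times> {..<n}. real (card (excess_edges E u k)))
    \<le> card (regular_graphs n d) * (8 * real d ^ 3 * real (d - 1) ^ (2 * k))"
proof -
  let ?G = "regular_graphs n d"
  let ?Z = "\<lambda>E u x y. {(z, w). w \<in> nbr E z \<and> z \<notin> nbhd E u k \<and> w \<notin> nbhd E u k \<and>
    z \<notin> nbr E x \<and> w \<notin> nbr E y}"
  let ?T = "SIGMA (E, u) : ?G \<times> {..<n}. SIGMA (x, y) : excess_edges E u k. ?Z E u x y"
  \<comment> \<open>What remains visible after the switching: \<open>x\<close> and \<open>y\<close>
    in the ball, \<open>z\<close> adjacent to \<open>x\<close>, and \<open>w\<close> adjacent to
    \<open>y\<close>. These data determine the switching, and there are at most
    \<open>c * c * (d * d)\<close> of them per pair.\<close>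
  let ?W = "SIGMA (E, u) : ?G \<times> {..<n}. SIGMA (x, y) : nbhd E u k \<times> nbhd E u k. nbr E x \<times> nbr E y"
  let ?f = "\<lambda>((E, u), (x, y), (z, w)). ((switch E x y z w, u), (x, y), (z, w))"
  let ?g = "\<lambda>((E, u), (x, y), (z, w)). ((switch E x z y w, u), (x, y), (z, w))"
  define c where "c = 2 * d * (d - 1) ^ k"
  have finZ: "finite (?Z E u x y)" if "E \<in> ?G" for E u x y
    by (rule finite_subset[OF _ finite_ordered_edges[OF that]]) (auto simp: ordered_edges_def)
  have finT: "finite ?T"
    using finZ by (auto intro!: finite_SigmaI simp: finite_regular_graphs finite_excess_edges)
  have finW: "finite ?W"
    by (auto intro!: finite_SigmaI simp: finite_regular_graphs finite_nbhd finite_nbr)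
  have le: "card ?T \<le> card ?W"
  proof (rule card_inj_on_le[where f = ?f])
    have sw: "switchable E x y z w"
      if "E \<in> ?G" "(x, y) \<in> excess_edges E u k" "(z, w) \<in> ?Z E u x y" for E u x y z w
    proof -
      have "x \<in> nbhd E u k" using that sphere_subset_nbhd[of E u k] by (auto simp: excess_edges_def)
      then show ?thesis using that by (auto simp: switchable_def excess_edges_def)
    qed
    have cases_T: thesis
      if "p \<in> ?T" and "\<And>E u x y z w. p = ((E, u), (x, y), (z, w)) \<Longrightarrow> E \<in> ?G \<Longrightarrow> u < n \<Longrightarrow>
        (x, y) \<in> excess_edges E u k \<Longrightarrow> (z, w) \<in> ?Z E u x y \<Longrightarrow> thesis" for p thesis
    proof -
      obtain E u x y z w where "p = ((E, u), (x, y), (z, w))" by (metis surj_pair)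
      with that show ?thesis by simp
    qed
    show "inj_on ?f ?T"
    proof (rule inj_on_inverseI[where g = ?g])
      fix p assume "p \<in> ?T"
      then show "?g (?f p) = p"
        by (rule cases_T) (simp add: switch_inverse sw)
    qed
    show "?f ` ?T \<subseteq> ?W"
    proof (rule image_subsetI)
      fix p assume "p \<in> ?T"
      then obtain E u x y z w where p: "p = ((E, u), (x, y), (z, w))"
        and *: "E \<in> ?G" "u < n" "(x, y) \<in> excess_edges E u k" "(z, w) \<in> ?Z E u x y"
        by (rule cases_T)
      have s: "switchable E x y z w" using sw * by blast
      let ?E' = "switch E x y z w"
      have "nbhd E u k \<subseteq> nbhd ?E' u k"
        by (rule nbhd_switch_excess) (use * k in auto)
      moreover have "x \<in> nbhd E u k" "y \<in> nbhd E u k"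
        using * sphere_subset_nbhd[of E u k] by (auto simp: excess_edges_def)
      moreover have "z \<in> nbr ?E' x" "w \<in> nbr ?E' y" by (auto simp: nbr_def switch_def)
      ultimately show "?f p \<in> ?W"
        using * switch_regular[OF _ s] by (auto simp: p)
    qed
    show "finite ?W" by (rule finW)
  qed
  have "card ?W \<le> card (?G \<times> {..<n}) * (c * c * (d * d))"
  proof (rule card_Sigma_le)
    fix p assume p: "p \<in> ?G \<times> {..<n}"
    obtain E u where pe: "p = (E, u)" by (cases p)
    then have E: "E \<in> ?G" using p by auto
    have "card (SIGMA (x, y) : nbhd E u k \<times> nbhd E u k. nbr E x \<times> nbr E y)
       \<le> card (nbhd E u k \<times> nbhd E u k) * (d * d)"
      by (rule card_Sigma_le)
         (use E in \<open>auto simp: finite_nbhd[OF E] finite_nbr[OF E] card_cartesian_product intro!: mult_le_mono card_nbr_le[OF E]\<close>)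
    also have "\<dots> \<le> c * c * (d * d)"
      unfolding card_cartesian_product c_def
      by (intro mult_le_mono card_nbhd_le[OF E d] order_refl)
    finally show "card (case p of (E, u) \<Rightarrow> SIGMA (x, y) : nbhd E u k \<times> nbhd E u k. nbr E x \<times> nbr E y)
       \<le> c * c * (d * d)" by (simp add: pe)
  qed (auto simp: finite_regular_graphs finite_nbhd finite_nbr)
  with le have 1: "real (card ?T) \<le> real (card ?G) * n * (c * c * (d * d))"
    by (simp add: card_cartesian_product flip: of_nat_mult)
  \<comment> \<open>The hypothesis \<open>large\<close> reads \<open>4 * c + 4 * d <= n\<close>,
    chosen so that at most half of the \<open>n * d\<close> ordered edges are excluded.\<close>
  have half: "real n * d / 2 \<le> card (?Z E u x y)" if E: "E \<in> ?G" for E u x y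
  proof -
    have "n * d \<le> card (?Z E u x y) + 2 * d * card (nbhd E u k) + 2 * d * d"
      by (rule card_switchable_edges_ge[OF E finite_nbhd[OF E]])
    also have "2 * d * card (nbhd E u k) \<le> 2 * d * c"
      unfolding c_def by (intro mult_le_mono2 card_nbhd_le[OF E d])
    finally have "n * d \<le> card (?Z E u x y) + 2 * d * c + 2 * d * d" by simp
    moreover have "(4 * c + 4 * d) * d \<le> n * d"
      using large by (intro mult_right_mono) (auto simp: c_def)
    ultimately have "n * d \<le> 2 * card (?Z E u x y)" by (simp add: algebra_simps)
    then have "real (n * d) \<le> real (2 * card (?Z E u x y))" by (simp only: of_nat_le_iff)
    then show ?thesis by simp
  qed
  have "(\<Sum>(E, u)\<in>?G \<times> {..<n}. real (card (excess_edges E u k))) * (real n * d / 2)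
      = (\<Sum>(E, u)\<in>?G \<times> {..<n}. \<Sum>(x, y)\<in>excess_edges E u k. real n * d / 2)"
    by (simp add: sum_distrib_right case_prod_unfold)
  also have "\<dots> \<le> (\<Sum>(E, u)\<in>?G \<times> {..<n}. \<Sum>(x, y)\<in>excess_edges E u k. real (card (?Z E u x y)))"
    using half by (intro sum_mono_prod) auto
  also have "\<dots> = real (card ?T)"
  proof -
    have "card ?T = (\<Sum>(E, u)\<in>?G \<times> {..<n}. card (SIGMA (x, y) : excess_edges E u k. ?Z E u x y))"
      using finZ by (intro card_Sigma_prod) (auto simp: finite_regular_graphs finite_excess_edges intro!: finite_SigmaI)
    also have "\<dots> = (\<Sum>(E, u)\<in>?G \<times> {..<n}. \<Sum>(x, y)\<in>excess_edges E u k. card (?Z E u x y))"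
      using finZ by (intro sum.cong) (auto intro!: card_Sigma_prod simp: finite_excess_edges)
    finally show ?thesis by (simp add: case_prod_unfold)
  qed
  also note 1
  finally have "(\<Sum>(E, u)\<in>?G \<times> {..<n}. real (card (excess_edges E u k))) * (real n * d / 2)
    \<le> (card ?G * (2 * c * c * d)) * (real n * d / 2)" by (simp add: algebra_simps)
  moreover have "real n * d / 2 > 0" using large d by auto
  ultimately have "(\<Sum>(E, u)\<in>?G \<times> {..<n}. real (card (excess_edges E u k))) \<le> card ?G * (2 * c * c * d)"
    by (simp only: mult_le_cancel_right_pos of_nat_mult)
  then show ?thesis
    by (simp add: c_def power_mult power2_eq_square power3_eq_cube power_mult_distrib mult_ac)
qed

subsection \<open>Switching an edge in the middle of a geodesic\<close>

definition middle_edges :: "'a set set \<Rightarrow> 'a \<Rightarrow> 'a \<Rightarrow> nat \<Rightarrow> nat \<Rightarrow> ('a \<times> 'a) set" where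
  "middle_edges E u v i j = {(x, y). x \<in> sphere_at E u i \<and> y \<in> sphere_at E v j \<and> y \<in> nbr E x}"

definition triples :: "nat \<Rightarrow> nat \<Rightarrow> (nat set set \<times> nat \<times> nat) set" where
  "triples n d = regular_graphs n d \<times> {..<n} \<times> {..<n}"

definition far_triples :: "nat \<Rightarrow> nat \<Rightarrow> nat \<Rightarrow> (nat set set \<times> nat \<times> nat) set" where
  "far_triples n d r = {(E, u, v) \<in> triples n d. v \<notin> nbhd E u r}"

definition link_triples :: "nat \<Rightarrow> nat \<Rightarrow> nat \<Rightarrow> nat \<Rightarrow> nat \<Rightarrow> (nat set set \<times> nat \<times> nat) set" where
  "link_triples n d i j l = {(E, u, v) \<in> far_triples n d (i + j). card (middle_edges E u v i j) = l}"

definition remote_edges :: "'a set set \<Rightarrow> 'a \<Rightarrow> 'a \<Rightarrow> nat \<Rightarrow> nat \<Rightarrow> 'a \<Rightarrow> 'a \<Rightarrow> ('a \<times> 'a) set" where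
  "remote_edges E u v i j x y =
    {(z, w). w \<in> nbr E z \<and> z \<notin> nbhd E u i \<union> nbhd E v j \<and> w \<notin> nbhd E u i \<union> nbhd E v j \<and>
       z \<notin> nbr E x \<and> w \<notin> nbr E y}"

text \<open>The pairs of stubs that the reverse switching may exchange for \<open>xy\<close> and
  \<open>zw\<close>: both outer ends must avoid both balls, and neither new edge may be present
  already or be a loop.\<close>

definition remote_stubs :: "'a set set \<Rightarrow> 'a \<Rightarrow> 'a \<Rightarrow> nat \<Rightarrow> nat \<Rightarrow> (('a \<times> 'a) \<times> ('a \<times> 'a)) set" where
  "remote_stubs E u v i j =
    {((x, z), (y, w)). (x, z) \<in> out_edges E u i \<and> (y, w) \<in> out_edges E v j \<and>
       z \<notin> nbhd E v j \<and> w \<notin> nbhd E u i \<and> y \<notin> nbr E x \<and> w \<notin> nbr E z \<and> z \<noteq> w}"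

lemma finite_triples: "finite (triples n d)"
  by (simp add: triples_def finite_regular_graphs)

lemma finite_far_triples: "finite (far_triples n d r)"
  by (rule finite_subset[OF _ finite_triples]) (auto simp: far_triples_def)

lemma finite_link_triples: "finite (link_triples n d i j l)"
  by (rule finite_subset[OF _ finite_far_triples]) (auto simp: link_triples_def)

lemma finite_middle_edges: "E \<in> regular_graphs n d \<Longrightarrow> finite (middle_edges E u v i j)"
  by (rule finite_subset[OF _ finite_ordered_edges]) (auto simp: middle_edges_def ordered_edges_def)

lemma finite_remote_edges: "E \<in> regular_graphs n d \<Longrightarrow> finite (remote_edges E u v i j x y)"
  by (rule finite_subset[OF _ finite_ordered_edges]) (auto simp: remote_edges_def ordered_edges_def)

lemma remote_stubs_subset: "remote_stubs E u v i j \<subseteq> out_edges E u i \<times> out_edges E v j"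
  by (auto simp: remote_stubs_def)

lemma finite_remote_stubs: "E \<in> regular_graphs n d \<Longrightarrow> finite (remote_stubs E u v i j)"
  by (rule finite_subset[OF remote_stubs_subset]) (simp add: finite_out_edges)

text \<open>\<open>x\<close> and \<open>y\<close> lie on the outermost spheres, and \<open>z\<close>
  and \<open>w\<close> outside both balls, so none of the four neighbourhoods is consulted in
  growing the balls.\<close>

lemma balls_cong:
  assumes same: "\<forall>a. a \<notin> {x, y, z, w} \<longrightarrow> nbr E' a = nbr E a"
    and disj: "nbhd E u i \<inter> nbhd E v j = {}"
    and x: "x \<in> sphere_at E u i" and y: "y \<in> sphere_at E v j"
    and z: "z \<notin> nbhd E u i \<union> nbhd E v j" and w: "w \<notin> nbhd E u i \<union> nbhd E v j"
  shows "nbhd E' u i = nbhd E u i" "nbhd E' v j = nbhd E v j"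
    "sphere_at E' u i = sphere_at E u i" "sphere_at E' v j = sphere_at E v j"
proof -
  have xy: "x \<notin> nbhd E v j" "y \<notin> nbhd E u i"
    using disj x y sphere_subset_nbhd[of E u i] sphere_subset_nbhd[of E v j] by auto
  have u: "nbr E' a = nbr E a" if "t < i" "a \<in> nbhd E u t" for t a
  proof (rule same[rule_format])
    have "a \<in> nbhd E u i" using that nbhd_mono[of t i E u] by auto
    with sphere_at_diff[OF that(1) x] that(2) xy z w show "a \<notin> {x, y, z, w}" by auto
  qed
  have v: "nbr E' a = nbr E a" if "t < j" "a \<in> nbhd E v t" for t a
  proof (rule same[rule_format])
    have "a \<in> nbhd E v j" using that nbhd_mono[of t j E v] by auto
    with sphere_at_diff[OF that(1) y] that(2) xy z w show "a \<notin> {x, y, z, w}" by auto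
  qed
  show "nbhd E' u i = nbhd E u i" "nbhd E' v j = nbhd E v j"
    using nbhd_cong[of i E u E' i] nbhd_cong[of j E v E' j] u v by auto
  show "sphere_at E' u i = sphere_at E u i" "sphere_at E' v j = sphere_at E v j"
    using sphere_at_cong[of i E u E'] sphere_at_cong[of j E v E'] u v by auto
qed

text \<open>Both balls survive and stay disjoint, which keeps the distance above
  \<open>i + j\<close>. The added edges \<open>xz\<close> and \<open>yw\<close> have an end outside
  both balls, so no middle edge is created in place of \<open>xy\<close>.\<close>

lemma switch_middle_edge:
  assumes E: "(E, u, v) \<in> link_triples n d i j (Suc l)"
    and xy: "(x, y) \<in> middle_edges E u v i j" and zw: "(z, w) \<in> remote_edges E u v i j x y"
  defines "E' \<equiv> switch E x y z w"
  shows "switchable E x y z w" "(E', u, v) \<in> link_triples n d i j l"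
    "((x, z), (y, w)) \<in> remote_stubs E' u v i j"
proof -
  have reg: "E \<in> regular_graphs n d" and far: "v \<notin> nbhd E u (i + j)" and uv: "u < n" "v < n"
    and card: "card (middle_edges E u v i j) = Suc l"
    using E by (auto simp: link_triples_def far_triples_def triples_def)
  have disj: "nbhd E u i \<inter> nbhd E v j = {}" using far by (simp add: nbhd_disjoint_iff)
  have x: "x \<in> sphere_at E u i" and y: "y \<in> sphere_at E v j" and e: "y \<in> nbr E x"
    using xy by (auto simp: middle_edges_def)
  have z: "z \<notin> nbhd E u i \<union> nbhd E v j" and w: "w \<notin> nbhd E u i \<union> nbhd E v j"
    using zw by (auto simp: remote_edges_def)
  have neq: "x \<noteq> z" "y \<noteq> w" "x \<noteq> y"
    using z w x y disj sphere_subset_nbhd[of E u i] sphere_subset_nbhd[of E v j] by auto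
  show s: "switchable E x y z w"
    using e zw neq by (auto simp: switchable_def remote_edges_def)
  note f = switchable_facts[OF s]
  have same: "\<forall>a. a \<notin> {x, y, z, w} \<longrightarrow> nbr E' a = nbr E a"
    unfolding E'_def by (simp add: nbr_switch_outside)
  note b = balls_cong[OF same disj x y z w]
  have in_ball: "sphere_at E u i \<subseteq> nbhd E u i" "sphere_at E v j \<subseteq> nbhd E v j"
    by (rule sphere_subset_nbhd)+
  have "middle_edges E' u v i j = middle_edges E u v i j - {(x, y)}"
  proof -
    have "q \<in> nbr E' p \<longleftrightarrow> q \<in> nbr E p \<and> (p, q) \<noteq> (x, y)"
      if "p \<in> sphere_at E u i" "q \<in> sphere_at E v j" for p q
      using that z w in_ball disj x y f unfolding E'_def nbr_def switch_def
      by (auto simp: doubleton_eq_iff)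
    then show ?thesis unfolding middle_edges_def b by auto
  qed
  then have "card (middle_edges E' u v i j) = l"
    using card xy finite_middle_edges[OF reg] by simp
  moreover have "v \<notin> nbhd E' u (i + j)" using disj by (simp add: nbhd_disjoint_iff b)
  ultimately show "(E', u, v) \<in> link_triples n d i j l"
    using switch_regular[OF reg s] uv by (simp add: link_triples_def far_triples_def triples_def E'_def)
  have s': "switchable E' x z y w" unfolding E'_def by (rule switch_inverse_switchable[OF reg s])
  from switchable_facts[OF this] x y z w show "((x, z), (y, w)) \<in> remote_stubs E' u v i j"
    by (auto simp: remote_stubs_def out_edges_def b)
qed

text \<open>The converse move: \<open>xz\<close> and \<open>yw\<close> leave the balls and are thus
  no middle edges, and of the two new edges only \<open>xy\<close> joins the spheres.\<close>

lemma switch_remote_stubs: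
  assumes E: "(E, u, v) \<in> link_triples n d i j l"
    and st: "((x, z), (y, w)) \<in> remote_stubs E u v i j"
  defines "E' \<equiv> switch E x z y w"
  shows "switchable E x z y w" "(E', u, v) \<in> link_triples n d i j (Suc l)"
    "(x, y) \<in> middle_edges E' u v i j" "(z, w) \<in> remote_edges E' u v i j x y"
proof -
  have reg: "E \<in> regular_graphs n d" and far: "v \<notin> nbhd E u (i + j)" and uv: "u < n" "v < n"
    and card: "card (middle_edges E u v i j) = l"
    using E by (auto simp: link_triples_def far_triples_def triples_def)
  have disj: "nbhd E u i \<inter> nbhd E v j = {}" using far by (simp add: nbhd_disjoint_iff)
  have x: "x \<in> sphere_at E u i" and y: "y \<in> sphere_at E v j"
    and z: "z \<notin> nbhd E u i \<union> nbhd E v j" and w: "w \<notin> nbhd E u i \<union> nbhd E v j"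
    using st by (auto simp: remote_stubs_def out_edges_def)
  have neq: "x \<noteq> y"
    using x y disj sphere_subset_nbhd[of E u i] sphere_subset_nbhd[of E v j] by auto
  show s: "switchable E x z y w"
    using st neq by (auto simp: switchable_def remote_stubs_def out_edges_def)
  note f = switchable_facts[OF s]
  have same: "\<forall>a. a \<notin> {x, y, z, w} \<longrightarrow> nbr E' a = nbr E a"
    unfolding E'_def by (simp add: nbr_switch_outside)
  note b = balls_cong[OF same disj x y z w]
  have in_ball: "sphere_at E u i \<subseteq> nbhd E u i" "sphere_at E v j \<subseteq> nbhd E v j"
    by (rule sphere_subset_nbhd)+
  have mid: "middle_edges E' u v i j = insert (x, y) (middle_edges E u v i j)"
  proof -
    have "q \<in> nbr E' p \<longleftrightarrow> q \<in> nbr E p \<or> (p, q) = (x, y)"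
      if "p \<in> sphere_at E u i" "q \<in> sphere_at E v j" for p q
      using that z w in_ball disj x y f unfolding E'_def nbr_def switch_def
      by (auto simp: doubleton_eq_iff)
    then show ?thesis using x y unfolding middle_edges_def b by auto
  qed
  have "(x, y) \<notin> middle_edges E u v i j" using f by (auto simp: middle_edges_def)
  with mid card have "card (middle_edges E' u v i j) = Suc l"
    using finite_middle_edges[OF reg] by simp
  moreover have "v \<notin> nbhd E' u (i + j)" using disj by (simp add: nbhd_disjoint_iff b)
  ultimately show "(E', u, v) \<in> link_triples n d i j (Suc l)"
    using switch_regular[OF reg s] uv by (simp add: link_triples_def far_triples_def triples_def E'_def)
  show "(x, y) \<in> middle_edges E' u v i j" using mid by simp
  have s': "switchable E' x y z w" unfolding E'_def by (rule switch_inverse_switchable[OF reg s])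
  from switchable_facts[OF this] z w show "(z, w) \<in> remote_edges E' u v i j x y"
    by (auto simp: remote_edges_def b)
qed

section \<open>Counting the switchings from both sides\<close>

text \<open>The one exact identity of the argument: switchings are in bijection with their
  reversals. Both recursion inequalities merely estimate its two sides.\<close>

lemma card_middle_switchings:
  "card (SIGMA (E, u, v) : link_triples n d i j (Suc l). SIGMA (x, y) : middle_edges E u v i j.
      remote_edges E u v i j x y)
   = card (SIGMA (E, u, v) : link_triples n d i j l. remote_stubs E u v i j)" (is "card ?F = card ?B")
proof (rule bij_betw_same_card)
  let ?f = "\<lambda>((E, u, v), (x, y), (z, w)). ((switch E x y z w, u, v), (x, z), (y, w))"
  let ?g = "\<lambda>((E, u, v), (x, z), (y, w)). ((switch E x z y w, u, v), (x, y), (z, w))"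
  have F: thesis if "p \<in> ?F" and "\<And>E u v x y z w. p = ((E, u, v), (x, y), (z, w)) \<Longrightarrow>
      (E, u, v) \<in> link_triples n d i j (Suc l) \<Longrightarrow> (x, y) \<in> middle_edges E u v i j \<Longrightarrow>
      (z, w) \<in> remote_edges E u v i j x y \<Longrightarrow> thesis" for p thesis
  proof -
    obtain E u v x y z w where "p = ((E, u, v), (x, y), (z, w))" by (metis surj_pair)
    with that show ?thesis by simp
  qed
  have B: thesis if "p \<in> ?B" and "\<And>E u v x y z w. p = ((E, u, v), (x, z), (y, w)) \<Longrightarrow>
      (E, u, v) \<in> link_triples n d i j l \<Longrightarrow> ((x, z), (y, w)) \<in> remote_stubs E u v i j \<Longrightarrow>
      thesis" for p thesis
  proof -
    obtain E u v x y z w where "p = ((E, u, v), (x, z), (y, w))" by (metis surj_pair)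
    with that show ?thesis by simp
  qed
  show "bij_betw ?f ?F ?B"
  proof (rule bij_betw_byWitness[where f' = ?g])
    show "\<forall>p\<in>?F. ?g (?f p) = p"
    proof
      fix p assume "p \<in> ?F"
      then show "?g (?f p) = p" by (rule F) (simp add: switch_inverse switch_middle_edge(1))
    qed
    show "\<forall>p\<in>?B. ?f (?g p) = p"
    proof
      fix p assume "p \<in> ?B"
      then show "?f (?g p) = p" by (rule B) (simp add: switch_inverse switch_remote_stubs(1))
    qed
    show "?f ` ?F \<subseteq> ?B"
    proof (rule image_subsetI)
      fix p assume "p \<in> ?F"
      then show "?f p \<in> ?B" by (rule F) (simp add: switch_middle_edge(2,3))
    qed
    show "?g ` ?B \<subseteq> ?F"
    proof (rule image_subsetI)
      fix p assume "p \<in> ?B"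
      then show "?g p \<in> ?F" by (rule B) (simp add: switch_remote_stubs(2,3,4))
    qed
  qed
qed

lemma card_remote_edges:
  assumes E: "E \<in> regular_graphs n d" and d: "d \<ge> 3"
  shows "card (remote_edges E u v i j x y) \<le> n * d"
    "n * d \<le> card (remote_edges E u v i j x y) + (4 * d * d * ((d - 1) ^ i + (d - 1) ^ j) + 2 * d * d)"
proof -
  show "card (remote_edges E u v i j x y) \<le> n * d"
    unfolding card_ordered_edges[OF E, symmetric]
    by (rule card_mono[OF finite_ordered_edges[OF E]]) (auto simp: ordered_edges_def remote_edges_def)
  let ?B = "nbhd E u i \<union> nbhd E v j"
  have "card ?B \<le> 2 * d * (d - 1) ^ i + 2 * d * (d - 1) ^ j"
    using card_Un_le[of "nbhd E u i" "nbhd E v j"] card_nbhd_le[OF E d, of u i] card_nbhd_le[OF E d, of v j]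
    by linarith
  then have "2 * d * card ?B \<le> 2 * d * (2 * d * (d - 1) ^ i + 2 * d * (d - 1) ^ j)"
    by (rule mult_le_mono2)
  also have "\<dots> = 4 * d * d * ((d - 1) ^ i + (d - 1) ^ j)" by (simp add: algebra_simps)
  finally have b: "2 * d * card ?B \<le> 4 * d * d * ((d - 1) ^ i + (d - 1) ^ j)" .
  have fin: "finite ?B" using finite_nbhd[OF E] by simp
  show "n * d \<le> card (remote_edges E u v i j x y) + (4 * d * d * ((d - 1) ^ i + (d - 1) ^ j) + 2 * d * d)"
    using b card_switchable_edges_ge[OF E fin, of x y] unfolding remote_edges_def by linarith
qed

lemma card_remote_stubs_le:
  assumes E: "E \<in> regular_graphs n d"
  shows "card (remote_stubs E u v i j) \<le> d * (d - 1) ^ i * (d * (d - 1) ^ j)"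
proof -
  have "card (remote_stubs E u v i j) \<le> card (out_edges E u i \<times> out_edges E v j)"
    by (rule card_mono[OF _ remote_stubs_subset]) (simp add: finite_out_edges[OF E])
  also have "\<dots> \<le> d * (d - 1) ^ i * (d * (d - 1) ^ j)"
    unfolding card_cartesian_product by (intro mult_le_mono card_out_edges_le[OF E])
  finally show ?thesis .
qed

text \<open>A pair of stubs fails in four ways. If \<open>z\<close> or \<open>w\<close> lies in the
  other ball, a stub is itself one of the \<open>l\<close> middle edges; if \<open>xy\<close> is an
  edge, it is a middle edge and the stubs start at its ends; and if \<open>w\<close> equals or
  neighbours \<open>z\<close>, there are at most \<open>(d + 1) * d\<close> choices of
  \<open>(y, w)\<close> for given \<open>z\<close>.\<close>

lemma card_remote_stubs_ge:
  assumes E: "E \<in> regular_graphs n d" and far: "v \<notin> nbhd E u (i + j)"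
    and card: "card (middle_edges E u v i j) = l"
  shows "card (out_edges E u i) * card (out_edges E v j) \<le> card (remote_stubs E u v i j)
    + l * (card (out_edges E u i) + card (out_edges E v j)) + l * d * d + card (out_edges E u i) * (d + 1) * d"
proof -
  let ?U = "out_edges E u i" and ?V = "out_edges E v j" and ?M = "middle_edges E u v i j"
  have disj: "nbhd E u i \<inter> nbhd E v j = {}" using far by (simp add: nbhd_disjoint_iff)
  \<comment> \<open>A vertex of a ball with a neighbour outside must lie on the outermost
    sphere.\<close>
  have sub: "a \<in> sphere_at E t k" if "a \<in> nbhd E t k" "c \<in> nbr E a" "c \<notin> nbhd E t k" for a c t k
  proof (cases k)
    case (Suc m)
    then have "a \<notin> nbhd E t m" using that nbr_nbhd[of a E t m c] by auto
    then show ?thesis using that Suc by (auto simp: sphere_at_Suc)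
  qed (use that in auto)
  let ?B1 = "?M \<times> ?V"
  let ?B2 = "?U \<times> prod.swap ` ?M"
  let ?B3 = "(\<lambda>((x, y), (z, w)). ((x, z), (y, w))) ` (SIGMA (x, y) : ?M. nbr E x \<times> nbr E y)"
  let ?B4 = "(\<lambda>(p, w, y). (p, (y, w))) ` (SIGMA (x, z) : ?U. SIGMA w : insert z (nbr E z). nbr E w)"
  have "?U \<times> ?V \<subseteq> remote_stubs E u v i j \<union> (?B1 \<union> (?B2 \<union> (?B3 \<union> ?B4)))"
  proof (rule subsetI)
    fix p assume p: "p \<in> ?U \<times> ?V"
    obtain x z y w where pe: "p = ((x, z), (y, w))" by (metis surj_pair)
    have x: "x \<in> sphere_at E u i" "x \<in> nbhd E u i" "z \<in> nbr E x" "z \<notin> nbhd E u i"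
      and y: "y \<in> sphere_at E v j" "y \<in> nbhd E v j" "w \<in> nbr E y" "w \<notin> nbhd E v j"
      using p pe sphere_subset_nbhd[of E u i] sphere_subset_nbhd[of E v j] by (auto simp: out_edges_def)
    show "p \<in> remote_stubs E u v i j \<union> (?B1 \<union> (?B2 \<union> (?B3 \<union> ?B4)))"
    proof (rule ccontr)
      assume n: "\<not> ?thesis"
      have "z \<notin> nbhd E v j"
      proof
        assume "z \<in> nbhd E v j"
        then have "z \<in> sphere_at E v j" using x disj nbr_sym[of z E x] by (intro sub[of _ _ _ x]) auto
        then have "p \<in> ?B1" using x p pe by (auto simp: middle_edges_def)
        with n show False by blast
      qed
      moreover have "w \<notin> nbhd E u i"
      proof
        assume "w \<in> nbhd E u i"
        then have "w \<in> sphere_at E u i" using y disj nbr_sym[of w E y] by (intro sub[of _ _ _ y]) auto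
        then have "(w, y) \<in> ?M" using y nbr_sym[of w E y] by (auto simp: middle_edges_def)
        then have "(y, w) \<in> prod.swap ` ?M" by force
        then have "p \<in> ?B2" using p pe by auto
        with n show False by blast
      qed
      moreover have "y \<notin> nbr E x"
      proof
        assume "y \<in> nbr E x"
        then have "((x, y), (z, w)) \<in> (SIGMA (x, y) : ?M. nbr E x \<times> nbr E y)"
          using x y by (auto simp: middle_edges_def)
        then have "p \<in> ?B3" unfolding pe by (rule rev_image_eqI) simp
        with n show False by blast
      qed
      moreover have "w \<notin> nbr E z \<and> z \<noteq> w"
      proof (rule ccontr)
        assume "\<not> ?thesis"
        then have "((x, z), (w, y)) \<in> (SIGMA (x, z) : ?U. SIGMA w : insert z (nbr E z). nbr E w)"
          using x y p pe nbr_sym[of w E y] by auto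
        then have "p \<in> ?B4" unfolding pe by (rule rev_image_eqI) simp
        with n show False by blast
      qed
      ultimately have "p \<in> remote_stubs E u v i j" using p pe by (auto simp: remote_stubs_def)
      with n show False by blast
    qed
  qed
  moreover have fin: "finite ?U" "finite ?V" "finite ?M" "\<And>a. finite (nbr E a)"
    using E by (auto simp: finite_out_edges finite_middle_edges finite_nbr)
  have fS3: "finite (SIGMA (x, y) : ?M. nbr E x \<times> nbr E y)"
    using fin by (intro finite_SigmaI) auto
  have fS4: "finite (SIGMA (x, z) : ?U. SIGMA w : insert z (nbr E z). nbr E w)"
    using fin by (intro finite_SigmaI) (auto intro!: finite_SigmaI)
  ultimately have "card (?U \<times> ?V) \<le> card (remote_stubs E u v i j \<union> (?B1 \<union> (?B2 \<union> (?B3 \<union> ?B4))))"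
    using fin fS3 fS4 by (intro card_mono) (simp_all add: finite_remote_stubs[OF E])
  also have "\<dots> \<le> card (remote_stubs E u v i j) + (card ?B1 + (card ?B2 + (card ?B3 + card ?B4)))"
    by (meson card_Un_le order_trans add_left_mono)
  also have "card ?B1 = l * card ?V" by (simp add: card_cartesian_product card)
  also have "card ?B2 = l * card ?U"
    using card by (simp add: card_cartesian_product card_image)
  also have "card ?B3 \<le> card (SIGMA (x, y) : ?M. nbr E x \<times> nbr E y)"
    by (rule card_image_le[OF fS3])
  also have "\<dots> \<le> l * (d * d)"
    unfolding card[symmetric]
    by (rule card_Sigma_le) (use fin in \<open>auto simp: card_cartesian_product intro!: mult_le_mono card_nbr_le[OF E]\<close>)
  also have "card ?B4 \<le> card (SIGMA (x, z) : ?U. SIGMA w : insert z (nbr E z). nbr E w)"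
    by (rule card_image_le[OF fS4])
  also have "\<dots> \<le> card ?U * ((d + 1) * d)"
  proof (rule card_Sigma_le)
    fix p assume "p \<in> ?U"
    obtain x z where p: "p = (x, z)" by (cases p)
    have "card (SIGMA w : insert z (nbr E z). nbr E w) \<le> card (insert z (nbr E z)) * d"
      by (rule card_Sigma_le) (use fin card_nbr_le[OF E] in auto)
    also have "\<dots> \<le> (d + 1) * d"
      using card_nbr_le[OF E, of z] card_insert_le_m1[of "d + 1" "nbr E z" z] by (intro mult_right_mono) auto
    finally show "card (case p of (x, z) \<Rightarrow> SIGMA w : insert z (nbr E z). nbr E w) \<le> (d + 1) * d"
      by (simp add: p)
  qed (use fin in \<open>auto intro!: finite_SigmaI\<close>)
  finally show ?thesis by (simp add: card_cartesian_product algebra_simps)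
qed

section \<open>Average deficit of a ball and the recursion in the number of middle edges\<close>

lemma card_triples: "card (triples n d) = card (regular_graphs n d) * n * n"
  by (simp add: triples_def card_cartesian_product)

lemma sum_triples_fst:
  fixes f :: "nat set set \<Rightarrow> nat \<Rightarrow> real"
  shows "(\<Sum>(E, u, v)\<in>triples n d. f E u) = n * (\<Sum>(E, u)\<in>regular_graphs n d \<times> {..<n}. f E u)"
  by (simp add: triples_def sum.cartesian_product[symmetric] sum_distrib_left)

lemma sum_triples_snd:
  fixes f :: "nat set set \<Rightarrow> nat \<Rightarrow> real"
  shows "(\<Sum>(E, u, v)\<in>triples n d. f E v) = n * (\<Sum>(E, u)\<in>regular_graphs n d \<times> {..<n}. f E u)"
  by (simp add: triples_def sum.cartesian_product[symmetric] sum_distrib_left)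

text \<open>The shortfall of the outgoing stubs against the \<open>d\<close>-regular tree.\<close>

definition deficit :: "'a set set \<Rightarrow> nat \<Rightarrow> 'a \<Rightarrow> nat \<Rightarrow> real" where
  "deficit E d u i = real d * real (d - 1) ^ i - real (card (out_edges E u i))"

lemma deficit_nonneg: "E \<in> regular_graphs n d \<Longrightarrow> deficit E d u i \<ge> 0"
  using card_out_edges_le[of E n d u i] unfolding deficit_def
  by (simp flip: of_nat_power of_nat_mult)

lemma geometric_sum_le:
  fixes b :: real assumes "b \<ge> 2" shows "(\<Sum>k=1..i. b ^ k) \<le> 2 * b ^ i"
proof (induction i)
  case (Suc i)
  have "2 * b ^ i \<le> b * b ^ i" using assms by (intro mult_right_mono) auto
  with Suc show ?case by simp
qed simp

text \<open>Level \<open>k\<close> has on average O(\<open>b ^ (2 * k) / n\<close>) excess edges,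
  each costing \<open>d * b ^ (i - k)\<close>. The product grows like \<open>b ^ (i + k)\<close>, so
  the outermost levels dominate a geometric sum.\<close>

lemma sum_deficit_le:
  assumes d: "d \<ge> 3" and large: "8 * d * (d - 1) ^ i + 4 * d \<le> n"
  shows "(\<Sum>(E, u)\<in>regular_graphs n d \<times> {..<n}. deficit E d u i)
    \<le> card (regular_graphs n d) * (16 * real d ^ 4 * real (d - 1) ^ (2 * i))"
proof -
  let ?G = "regular_graphs n d" and ?b = "real (d - 1)"
  have b: "?b \<ge> 2" using d by simp
  have "(\<Sum>(E, u)\<in>?G \<times> {..<n}. deficit E d u i)
    \<le> (\<Sum>(E, u)\<in>?G \<times> {..<n}. \<Sum>k=1..i. d * ?b ^ (i - k) * card (excess_edges E u k))"
    by (rule sum_mono_prod) (use d out_edges_deficit in \<open>auto simp: deficit_def\<close>)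
  also have "\<dots> = (\<Sum>k=1..i. d * ?b ^ (i - k) * (\<Sum>(E, u)\<in>?G \<times> {..<n}. real (card (excess_edges E u k))))"
    unfolding case_prod_unfold by (subst sum.swap) (simp add: sum_distrib_left)
  also have "\<dots> \<le> (\<Sum>k=1..i. d * ?b ^ (i - k) * (card ?G * (8 * real d ^ 3 * ?b ^ (2 * k))))"
  proof (intro sum_mono mult_left_mono sum_excess_edges_le)
    fix k assume k: "k \<in> {1..i}"
    then have "(d - 1) ^ k \<le> (d - 1) ^ i" using d by (intro power_increasing) auto
    then have "8 * d * (d - 1) ^ k \<le> 8 * d * (d - 1) ^ i" by (rule mult_le_mono2)
    then show "8 * d * (d - 1) ^ k + 4 * d \<le> n" using large by linarith
  qed (use d in auto)
  also have "\<dots> = (\<Sum>k=1..i. (8 * real d ^ 4 * card ?G * ?b ^ i) * ?b ^ k)"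
  proof (rule sum.cong)
    fix k assume k: "k \<in> {1..i}"
    have "?b ^ (i - k) * ?b ^ (2 * k) = ?b ^ i * ?b ^ k"
      using k by (simp add: add.commute flip: power_add)
    then show "d * ?b ^ (i - k) * (card ?G * (8 * real d ^ 3 * ?b ^ (2 * k)))
      = (8 * real d ^ 4 * card ?G * ?b ^ i) * ?b ^ k"
      by (simp add: power3_eq_cube power4_eq_xxxx mult_ac)
  qed simp
  also have "\<dots> = (8 * real d ^ 4 * card ?G * ?b ^ i) * (\<Sum>k=1..i. ?b ^ k)"
    by (simp add: sum_distrib_left)
  also have "\<dots> \<le> (8 * real d ^ 4 * card ?G * ?b ^ i) * (2 * ?b ^ i)"
    by (rule mult_left_mono[OF geometric_sum_le[OF b]]) simp
  also have "\<dots> = card ?G * (16 * real d ^ 4 * ?b ^ (2 * i))"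
    by (simp add: power_even_eq power2_eq_square)
  finally show ?thesis .
qed

lemma link_triples_subset: "link_triples n d i j l \<subseteq> triples n d"
  by (auto simp: link_triples_def far_triples_def)

lemma link_triplesD:
  assumes "(E, u, v) \<in> link_triples n d i j l"
  shows "E \<in> regular_graphs n d" "u < n" "v < n" "v \<notin> nbhd E u (i + j)" "card (middle_edges E u v i j) = l"
  using assms by (auto simp: link_triples_def far_triples_def triples_def)

text \<open>Each of the \<open>l + 1\<close> middle edges has almost \<open>n * d\<close> remote
  partners, while the reverse switching has at most the number of stub pairs of two trees. The
  missing partners are added on the right, which avoids subtraction in \<open>nat\<close>.\<close>

lemma link_recursion_upper:
  assumes d: "d \<ge> 3"
  shows "(l + 1) * (n * d) * card (link_triples n d i j (Suc l))
    \<le> d * (d - 1) ^ i * (d * (d - 1) ^ j) * card (link_triples n d i j l)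
      + (l + 1) * (4 * d * d * ((d - 1) ^ i + (d - 1) ^ j) + 2 * d * d) * card (triples n d)"
proof -
  let ?C = "link_triples n d i j" and ?R = "4 * d * d * ((d - 1) ^ i + (d - 1) ^ j) + 2 * d * d"
  let ?F = "SIGMA (E, u, v) : ?C (Suc l). SIGMA (x, y) : middle_edges E u v i j. remote_edges E u v i j x y"
  let ?B = "SIGMA (E, u, v) : ?C l. remote_stubs E u v i j"
  have "(l + 1) * (n * d) * card (?C (Suc l)) = (\<Sum>p\<in>?C (Suc l). (l + 1) * (n * d))"
    by simp
  also have "\<dots> \<le> (\<Sum>p\<in>?C (Suc l). card (case p of (E, u, v) \<Rightarrow>
      SIGMA (x, y) : middle_edges E u v i j. remote_edges E u v i j x y) + (l + 1) * ?R)"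
  proof (rule sum_mono)
    fix p assume p: "p \<in> ?C (Suc l)"
    obtain E u v where pe: "p = (E, u, v)" by (metis surj_pair)
    note D = link_triplesD[OF p[unfolded pe]]
    have "(l + 1) * (n * d) = (\<Sum>(x, y)\<in>middle_edges E u v i j. n * d)"
      using D by simp
    also have "\<dots> \<le> (\<Sum>(x, y)\<in>middle_edges E u v i j. card (remote_edges E u v i j x y) + ?R)"
      using card_remote_edges(2)[OF D(1) d] by (intro sum_mono) auto
    also have "\<dots> = (\<Sum>(x, y)\<in>middle_edges E u v i j. card (remote_edges E u v i j x y)) + (l + 1) * ?R"
      using D by (simp add: case_prod_unfold sum.distrib)
    also have "(\<Sum>(x, y)\<in>middle_edges E u v i j. card (remote_edges E u v i j x y))
      = card (SIGMA (x, y) : middle_edges E u v i j. remote_edges E u v i j x y)"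
      by (rule card_Sigma_prod[symmetric]) (use D in \<open>auto simp: finite_middle_edges finite_remote_edges\<close>)
    finally show "(l + 1) * (n * d) \<le> card (case p of (E, u, v) \<Rightarrow>
      SIGMA (x, y) : middle_edges E u v i j. remote_edges E u v i j x y) + (l + 1) * ?R"
      by (simp add: pe)
  qed
  also have "\<dots> = card ?F + card (?C (Suc l)) * ((l + 1) * ?R)"
  proof (subst card_SigmaI)
    show "\<forall>p\<in>?C (Suc l). finite (case p of (E, u, v) \<Rightarrow>
      SIGMA (x, y) : middle_edges E u v i j. remote_edges E u v i j x y)"
      by (auto intro!: finite_SigmaI simp: finite_middle_edges finite_remote_edges dest: link_triplesD)
  qed (simp_all add: finite_link_triples sum.distrib)
  also have "card ?F = card ?B" by (rule card_middle_switchings)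
  also have "card ?B \<le> card (?C l) * (d * (d - 1) ^ i * (d * (d - 1) ^ j))"
  proof (rule card_Sigma_le)
    fix p assume p: "p \<in> ?C l"
    obtain E u v where pe: "p = (E, u, v)" by (metis surj_pair)
    note D = link_triplesD[OF p[unfolded pe]]
    show "finite (case p of (E, u, v) \<Rightarrow> remote_stubs E u v i j)"
      using D by (simp add: pe finite_remote_stubs)
    show "card (case p of (E, u, v) \<Rightarrow> remote_stubs E u v i j) \<le> d * (d - 1) ^ i * (d * (d - 1) ^ j)"
      using card_remote_stubs_le[OF D(1)] by (simp add: pe)
  qed (rule finite_link_triples)
  also have "card (?C (Suc l)) * ((l + 1) * ?R) \<le> card (triples n d) * ((l + 1) * ?R)"
    by (intro mult_le_mono1 card_mono finite_triples link_triples_subset)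
  finally show ?thesis by (simp add: mult_ac)
qed

text \<open>With deficits \<open>p\<close> and \<open>q\<close>, the stub pairs number
  \<open>(\<alpha> - p) * (\<beta> - q) \<ge> \<alpha> * \<beta> - \<alpha> * q - \<beta> *
  p\<close>, up to the failures listed in \<open>card_remote_stubs_ge\<close>. A deficit can be
  large for a particular graph, so it is controlled only after summation.\<close>

lemma link_recursion_lower:
  fixes \<alpha> \<beta> :: real
  assumes d: "d \<ge> 3"
    and large: "8 * d * (d - 1) ^ i + 4 * d \<le> n" "8 * d * (d - 1) ^ j + 4 * d \<le> n"
  defines "\<alpha> \<equiv> real d * real (d - 1) ^ i" and "\<beta> \<equiv> real d * real (d - 1) ^ j"
  shows "\<alpha> * \<beta> * card (link_triples n d i j l)
    \<le> (l + 1) * (real n * d) * card (link_triples n d i j (Suc l))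
      + (l * (\<alpha> + \<beta>) + l * real d * d + \<alpha> * (d + 1) * d) * card (triples n d)
      + n * card (regular_graphs n d) * (16 * real d ^ 4 * (\<alpha> * real (d - 1) ^ (2 * j) + \<beta> * real (d - 1) ^ (2 * i)))"
proof -
  let ?C = "link_triples n d i j" and ?\<delta> = "\<lambda>E. deficit E d"
  let ?K = "l * (\<alpha> + \<beta>) + l * real d * d + \<alpha> * (d + 1) * d"
  let ?F = "SIGMA (E, u, v) : ?C (Suc l). SIGMA (x, y) : middle_edges E u v i j. remote_edges E u v i j x y"
  let ?B = "SIGMA (E, u, v) : ?C l. remote_stubs E u v i j"
  have ab: "\<alpha> \<ge> 0" "\<beta> \<ge> 0" by (auto simp: \<alpha>_def \<beta>_def)
  have "\<alpha> * \<beta> * card (?C l) = (\<Sum>p\<in>?C l. \<alpha> * \<beta>)" by simp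
  also have "\<dots> \<le> (\<Sum>p\<in>?C l. real (card (case p of (E, u, v) \<Rightarrow> remote_stubs E u v i j)) + ?K
      + (case p of (E, u, v) \<Rightarrow> \<alpha> * ?\<delta> E v j + \<beta> * ?\<delta> E u i))"
  proof (rule sum_mono)
    fix p assume p: "p \<in> ?C l"
    obtain E u v where pe: "p = (E, u, v)" by (metis surj_pair)
    note D = link_triplesD[OF p[unfolded pe]]
    let ?U = "real (card (out_edges E u i))" and ?V = "real (card (out_edges E v j))"
    have U: "?U = \<alpha> - ?\<delta> E u i" and V: "?V = \<beta> - ?\<delta> E v j"
      by (simp_all add: deficit_def \<alpha>_def \<beta>_def)
    have dn: "?\<delta> E u i \<ge> 0" "?\<delta> E v j \<ge> 0" using deficit_nonneg[OF D(1)] by auto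
    have UV: "?U \<le> \<alpha>" "?V \<le> \<beta>" using U V dn by auto
    have "\<alpha> * \<beta> \<le> ?U * ?V + \<alpha> * ?\<delta> E v j + \<beta> * ?\<delta> E u i"
      unfolding U V using dn by (simp add: algebra_simps)
    also have "?U * ?V \<le> card (remote_stubs E u v i j) + (l * (?U + ?V) + l * real d * d + ?U * (d + 1) * d)"
    proof -
      have "real (card (out_edges E u i) * card (out_edges E v j)) \<le> real (card (remote_stubs E u v i j)
        + l * (card (out_edges E u i) + card (out_edges E v j)) + l * d * d + card (out_edges E u i) * (d + 1) * d)"
        using card_remote_stubs_ge[OF D(1,4,5)] by (simp only: of_nat_le_iff)
      then show ?thesis by (simp add: algebra_simps)
    qed
    also have "l * (?U + ?V) + l * real d * d + ?U * (d + 1) * d \<le> ?K"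
      using UV by (intro add_mono mult_left_mono mult_right_mono) auto
    finally show "\<alpha> * \<beta> \<le> real (card (case p of (E, u, v) \<Rightarrow> remote_stubs E u v i j)) + ?K
      + (case p of (E, u, v) \<Rightarrow> \<alpha> * ?\<delta> E v j + \<beta> * ?\<delta> E u i)" by (simp add: pe)
  qed
  also have "\<dots> = card ?B + ?K * card (?C l) + (\<Sum>(E, u, v)\<in>?C l. \<alpha> * ?\<delta> E v j + \<beta> * ?\<delta> E u i)"
  proof (subst card_SigmaI)
    show "\<forall>p\<in>?C l. finite (case p of (E, u, v) \<Rightarrow> remote_stubs E u v i j)"
      by (auto simp: finite_remote_stubs dest: link_triplesD)
  qed (simp_all add: finite_link_triples sum.distrib)
  also have "card ?B = card ?F" by (rule card_middle_switchings[symmetric])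
  also have "real (card ?F) \<le> (l + 1) * (real n * d) * card (?C (Suc l))"
  proof -
    have "card ?F \<le> card (?C (Suc l)) * ((l + 1) * (n * d))"
    proof (rule card_Sigma_le)
      fix p assume p: "p \<in> ?C (Suc l)"
      obtain E u v where pe: "p = (E, u, v)" by (metis surj_pair)
      note D = link_triplesD[OF p[unfolded pe]]
      show "finite (case p of (E, u, v) \<Rightarrow> SIGMA (x, y) : middle_edges E u v i j. remote_edges E u v i j x y)"
        using D by (auto simp: pe finite_middle_edges finite_remote_edges)
      have "card (SIGMA (x, y) : middle_edges E u v i j. remote_edges E u v i j x y)
        \<le> card (middle_edges E u v i j) * (n * d)"
        by (rule card_Sigma_le) (use D d card_remote_edges(1) in \<open>auto simp: finite_middle_edges finite_remote_edges\<close>)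
      then show "card (case p of (E, u, v) \<Rightarrow> SIGMA (x, y) : middle_edges E u v i j. remote_edges E u v i j x y)
        \<le> (l + 1) * (n * d)" using D by (simp add: pe)
    qed (rule finite_link_triples)
    then have "real (card ?F) \<le> real (card (?C (Suc l)) * ((l + 1) * (n * d)))" by (simp only: of_nat_le_iff)
    then show ?thesis by (simp add: algebra_simps)
  qed
  also have "?K * card (?C l) \<le> ?K * card (triples n d)"
    using ab by (intro mult_left_mono of_nat_mono card_mono finite_triples link_triples_subset) auto
  \<comment> \<open>Deficits are nonnegative, so the sum may be extended to all triples; only there
    is their average known.\<close>
  also have "(\<Sum>(E, u, v)\<in>?C l. \<alpha> * ?\<delta> E v j + \<beta> * ?\<delta> E u i)
      \<le> (\<Sum>(E, u, v)\<in>triples n d. \<alpha> * ?\<delta> E v j + \<beta> * ?\<delta> E u i)"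
  proof (rule sum_mono2[OF finite_triples link_triples_subset])
    fix p assume "p \<in> triples n d - ?C l"
    then show "0 \<le> (case p of (E, u, v) \<Rightarrow> \<alpha> * ?\<delta> E v j + \<beta> * ?\<delta> E u i)"
      using ab by (auto simp: triples_def intro!: add_nonneg_nonneg mult_nonneg_nonneg deficit_nonneg)
  qed
  also have "(\<Sum>(E, u, v)\<in>triples n d. \<alpha> * ?\<delta> E v j + \<beta> * ?\<delta> E u i)
     = \<alpha> * (\<Sum>(E, u, v)\<in>triples n d. ?\<delta> E v j) + \<beta> * (\<Sum>(E, u, v)\<in>triples n d. ?\<delta> E u i)"
    by (simp add: sum.distrib sum_distrib_left case_prod_unfold)
  also have "\<dots> = \<alpha> * (n * (\<Sum>(E, u)\<in>regular_graphs n d \<times> {..<n}. ?\<delta> E u j))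
      + \<beta> * (n * (\<Sum>(E, u)\<in>regular_graphs n d \<times> {..<n}. ?\<delta> E u i))"
    by (simp only: sum_triples_fst sum_triples_snd)
  also have "\<dots> \<le> \<alpha> * (n * (card (regular_graphs n d) * (16 * real d ^ 4 * real (d - 1) ^ (2 * j))))
      + \<beta> * (n * (card (regular_graphs n d) * (16 * real d ^ 4 * real (d - 1) ^ (2 * i))))"
    using ab by (intro add_mono mult_left_mono sum_deficit_le d large) auto
  also have "\<dots> = n * card (regular_graphs n d) * (16 * real d ^ 4 * (\<alpha> * real (d - 1) ^ (2 * j) + \<beta> * real (d - 1) ^ (2 * i)))"
    by (simp add: algebra_simps)
  finally show ?thesis by (simp add: add.commute)
qed

text \<open>Both inequalities divided by \<open>n * d\<close>. The term \<open>s / n\<close>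
  collects the failing choices of edges and stubs, and \<open>s ^ 3 / n ^ 2\<close> the deficits:
  one ball's average deficit of order \<open>s ^ 2 / n\<close> times the \<open>s\<close> stubs of
  the other, divided by \<open>n\<close>.\<close>

lemma link_recursion:
  assumes d: "d \<ge> 3"
    and large: "8 * d * (d - 1) ^ i + 4 * d \<le> n" "8 * d * (d - 1) ^ j + 4 * d \<le> n"
    and s: "real (d - 1) ^ i \<le> s" "real (d - 1) ^ j \<le> s"
  shows "\<bar>(l + 1) * real (card (link_triples n d i j (Suc l)))
      - (d * real (d - 1) ^ (i + j) / n) * card (link_triples n d i j l)\<bar>
    \<le> (32 * real d ^ 4 + 10 * real d * (l + 1) + 2 * real l + real l * d + real d * (d + 1))
       * (s / n + s ^ 3 / n ^ 2) * card (triples n d)"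
proof -
  let ?b = "real (d - 1)" and ?N = "real (card (triples n d))"
  define X where "X = (l + 1) * real (card (link_triples n d i j (Suc l)))"
  define Y where "Y = real (card (link_triples n d i j l))"
  define K where "K = 32 * real d ^ 4 + 10 * real d * (l + 1) + 2 * real l + real l * d + real d * (d + 1)"
  have b: "?b \<ge> 2" and n: "n > 0" using d large by auto
  \<comment> \<open>Allows terms without a power of \<open>d - 1\<close> to be absorbed into
    multiples of \<open>s\<close>.\<close>
  have s1: "s \<ge> 1" using s(1) b one_le_power[of ?b i] by linarith
  have N: "?N = real n * real n * card (regular_graphs n d)" by (simp add: card_triples)
  have nd: "real n * d > 0" using n d by simp
  \<comment> \<open>The tree count of stub pairs, relative to the \<open>n * d\<close> choices of a
    remote edge, is the Poisson mean.\<close>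
  have bij: "d * ?b ^ i * (d * ?b ^ j) = (real n * d) * (d * ?b ^ (i + j) / n)"
    using n by (simp add: power_add)
  have upper: "X - (d * ?b ^ (i + j) / n) * Y \<le> K * (s / n + s ^ 3 / n ^ 2) * ?N"
  proof -
    have "real ((l + 1) * (n * d) * card (link_triples n d i j (Suc l)))
    \<le> real (d * (d - 1) ^ i * (d * (d - 1) ^ j) * card (link_triples n d i j l)
      + (l + 1) * (4 * d * d * ((d - 1) ^ i + (d - 1) ^ j) + 2 * d * d) * card (triples n d))"
      using link_recursion_upper[OF d] by (simp only: of_nat_le_iff)
    then have "(real n * d) * X \<le> d * ?b ^ i * (d * ?b ^ j) * Y
      + (l + 1) * (4 * real d * d * (?b ^ i + ?b ^ j) + 2 * real d * d) * ?N"
      by (simp add: X_def Y_def algebra_simps)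
    also have "\<dots> \<le> d * ?b ^ i * (d * ?b ^ j) * Y
      + (l + 1) * (4 * real d * d * (s + s) + 2 * real d * d * s) * ?N"
    proof -
      have "4 * real d * d * (?b ^ i + ?b ^ j) \<le> 4 * real d * d * (s + s)"
        using s by (intro mult_left_mono add_mono) auto
      moreover have "2 * real d * d \<le> 2 * real d * d * s"
        using mult_left_mono[OF s1, of "2 * real d * d"] by simp
      ultimately have "4 * real d * d * (?b ^ i + ?b ^ j) + 2 * real d * d
        \<le> 4 * real d * d * (s + s) + 2 * real d * d * s" by (rule add_mono)
      then show ?thesis by (intro add_left_mono mult_right_mono mult_left_mono) simp_all
    qed
    also have "\<dots> = (real n * d) * ((d * ?b ^ (i + j) / n) * Y + 10 * real d * (l + 1) * (s / n) * ?N)"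
      unfolding bij using n by (simp add: field_simps)
    finally have "X \<le> (d * ?b ^ (i + j) / n) * Y + 10 * real d * (l + 1) * (s / n) * ?N"
      using nd by (simp only: mult_le_cancel_left_pos)
    also have "10 * real d * (l + 1) * (s / n) * ?N \<le> K * (s / n + s ^ 3 / n ^ 2) * ?N"
      using s1 by (intro mult_right_mono mult_mono) (auto simp: K_def)
    finally show ?thesis by simp
  qed
  have lower: "(d * ?b ^ (i + j) / n) * Y - X \<le> K * (s / n + s ^ 3 / n ^ 2) * ?N"
  proof -
    define L where "L = 2 * real l + real l * d + real d * (d + 1)"
    let ?T = "l * (d * ?b ^ i + d * ?b ^ j) + l * real d * d + d * ?b ^ i * (d + 1) * d"
    let ?D = "n * card (regular_graphs n d) * (16 * real d ^ 4 * (d * ?b ^ i * ?b ^ (2 * j) + d * ?b ^ j * ?b ^ (2 * i)))"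
    have 1: "d * ?b ^ i * (d * ?b ^ j) * Y \<le> (real n * d) * X + ?T * ?N + ?D"
      using link_recursion_lower[OF d large, of l] by (simp add: X_def Y_def mult_ac add.commute)
    have "?T \<le> l * (d * s + d * s) + l * real d * d * s + d * s * (d + 1) * d"
    proof -
      have "l * real d * d \<le> l * real d * d * s"
        using mult_left_mono[OF s1, of "l * real d * d"] by simp
      moreover have "l * (d * ?b ^ i + d * ?b ^ j) \<le> l * (d * s + d * s)"
        using s by (intro mult_left_mono add_mono) simp_all
      moreover have "d * ?b ^ i * (d + 1) * d \<le> d * s * (d + 1) * d"
        using s by (intro mult_right_mono mult_left_mono) simp_all
      ultimately show ?thesis by linarith
    qed
    also have "\<dots> = (real n * d) * (L * (s / n))" using n by (simp add: L_def field_simps)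
    finally have 2: "?T * ?N \<le> (real n * d) * (L * (s / n)) * ?N" by (rule mult_right_mono) simp
    have "d * ?b ^ i * ?b ^ (2 * j) + d * ?b ^ j * ?b ^ (2 * i) \<le> d * s * s ^ 2 + d * s * s ^ 2"
      using s s1 b unfolding power_mult mult.commute[of 2]
      by (intro add_mono mult_mono mult_left_mono power_mono) auto
    then have "?D \<le> n * card (regular_graphs n d) * (16 * real d ^ 4 * (d * s * s ^ 2 + d * s * s ^ 2))"
      by (intro mult_left_mono) simp_all
    also have "\<dots> = (real n * d) * (32 * real d ^ 4 * (s ^ 3 / n ^ 2) * ?N)"
      using n unfolding N by (simp add: field_simps power2_eq_square power3_eq_cube)
    finally have 3: "?D \<le> (real n * d) * (32 * real d ^ 4 * (s ^ 3 / n ^ 2) * ?N)" .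
    have "(real n * d) * ((d * ?b ^ (i + j) / n) * Y) = d * ?b ^ i * (d * ?b ^ j) * Y"
      unfolding bij by (simp only: mult.assoc)
    also have "\<dots> \<le> (real n * d) * X + (real n * d) * (L * (s / n)) * ?N
        + (real n * d) * (32 * real d ^ 4 * (s ^ 3 / n ^ 2) * ?N)"
      using 1 2 3 by linarith
    also have "\<dots> = (real n * d) * (X + L * (s / n) * ?N + 32 * real d ^ 4 * (s ^ 3 / n ^ 2) * ?N)"
      by (simp only: distrib_left mult.assoc)
    finally have "(real n * d) * ((d * ?b ^ (i + j) / n) * Y)
      \<le> (real n * d) * (X + L * (s / n) * ?N + 32 * real d ^ 4 * (s ^ 3 / n ^ 2) * ?N)" .
    then have "(d * ?b ^ (i + j) / n) * Y \<le> X + L * (s / n) * ?N + 32 * real d ^ 4 * (s ^ 3 / n ^ 2) * ?N"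
      using nd by (simp only: mult_le_cancel_left_pos)
    moreover have "L * (s / n) * ?N + 32 * real d ^ 4 * (s ^ 3 / n ^ 2) * ?N \<le> K * (s / n) * ?N + K * (s ^ 3 / n ^ 2) * ?N"
      using s1 by (intro add_mono mult_right_mono) (auto simp: K_def L_def)
    ultimately show ?thesis by (simp add: algebra_simps)
  qed
  show ?thesis using upper lower unfolding X_def Y_def K_def of_nat_add of_nat_1 of_nat_power by linarith
qed

subsection \<open>Counting geodesics\<close>

text \<open>Indexed by the number of edges, hence lists of length \<open>Suc k\<close>. Vertices may
  repeat, so that walks can be cut and joined freely.\<close>

definition walks :: "'a set set \<Rightarrow> 'a \<Rightarrow> 'a \<Rightarrow> nat \<Rightarrow> 'a list set" where
  "walks E u v k = {p. length p = Suc k \<and> hd p = u \<and> last p = v \<and> successively (\<lambda>x y. {x, y} \<in> E) p}"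

lemma walks_0: "walks E u v 0 = (if u = v then {[u]} else {})"
  by (auto simp: walks_def length_Suc_conv)

lemma walks_append:
  assumes "p \<in> walks E u x i" "q \<in> walks E y v j" "y \<in> nbr E x"
  shows "p @ q \<in> walks E u v (Suc (i + j))"
proof -
  have "p \<noteq> []" "q \<noteq> []" using assms by (auto simp: walks_def)
  then show ?thesis using assms by (auto simp: walks_def successively_append_iff nbr_def)
qed

lemma walks_split:
  assumes p: "p \<in> walks E u v (Suc (i + j))"
  obtains x y q r where "p = q @ r" "q \<in> walks E u x i" "r \<in> walks E y v j" "y \<in> nbr E x"
proof
  let ?q = "take (Suc i) p" and ?r = "drop (Suc i) p"
  have len: "length p = Suc (Suc (i + j))" using p by (simp add: walks_def)
  have ne: "?q \<noteq> []" "?r \<noteq> []" using len by auto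
  have "successively (\<lambda>x y. {x, y} \<in> E) (?q @ ?r)" "hd (?q @ ?r) = u" "last (?q @ ?r) = v"
    using p by (simp_all add: walks_def)
  with ne have s: "successively (\<lambda>x y. {x, y} \<in> E) ?q" "successively (\<lambda>x y. {x, y} \<in> E) ?r"
    "{last ?q, hd ?r} \<in> E" "hd ?q = u" "last ?r = v"
    unfolding successively_append_iff by (simp_all del: append_take_drop_id)
  show "p = ?q @ ?r" by simp
  show "?q \<in> walks E u (last ?q) i" using s len by (simp add: walks_def)
  show "?r \<in> walks E (hd ?r) v j" using s len by (simp add: walks_def)
  show "hd ?r \<in> nbr E (last ?q)" using s by (simp add: nbr_def)
qed

lemma walks_single: "[v] \<in> walks E v v 0"
  by (simp add: walks_def)

lemma walks_Suc_cases:
  assumes "p \<in> walks E u v (Suc k)"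
  obtains x q where "p = q @ [v]" "q \<in> walks E u x k" "v \<in> nbr E x"
proof -
  from assms have "p \<in> walks E u v (Suc (k + 0))" by simp
  then obtain x y q r where *: "p = q @ r" "q \<in> walks E u x k" "r \<in> walks E y v 0" "y \<in> nbr E x"
    by (rule walks_split)
  then have "y = v" "r = [v]" by (auto simp: walks_0 split: if_splits)
  with * that show thesis by simp
qed

lemma walks_nbhd: "p \<in> walks E u v k \<Longrightarrow> v \<in> nbhd E u k"
proof (induction k arbitrary: p v)
  case (Suc k)
  then show ?case by (elim walks_Suc_cases) auto
qed (auto simp: walks_0 split: if_splits)

lemma nbhd_walks: "v \<in> nbhd E u k \<Longrightarrow> \<exists>j\<le>k. walks E u v j \<noteq> {}"
proof (induction k arbitrary: v)
  case (Suc k)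
  show ?case
  proof (cases "v \<in> nbhd E u k")
    case True
    then show ?thesis using Suc.IH[of v] le_Suc_eq by blast
  next
    case False
    then obtain x where x: "x \<in> nbhd E u k" "v \<in> nbr E x" using Suc.prems by auto
    then obtain j p where "j \<le> k" "p \<in> walks E u x j" using Suc.IH by blast
    then have "p @ [v] \<in> walks E u v (Suc j)"
      using walks_append[OF _ walks_single x(2), of p u j] by simp
    with \<open>j \<le> k\<close> show ?thesis by (intro exI[of _ "Suc j"]) auto
  qed
qed (auto simp: walks_0)

lemma sphere_walks_nonempty: "v \<in> sphere_at E u k \<Longrightarrow> walks E u v k \<noteq> {}"
proof -
  assume v: "v \<in> sphere_at E u k"
  then obtain j where "j \<le> k" "walks E u v j \<noteq> {}"
    using nbhd_walks[of v E u k] sphere_subset_nbhd[of E u k] by blast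
  moreover have "\<not> j < k" using walks_nbhd[of _ E u v j] sphere_at_diff[OF _ v] calculation by blast
  ultimately show ?thesis by simp
qed

text \<open>Had the last but one vertex been reached in fewer than \<open>k\<close> steps,
  \<open>v\<close> would lie inside the sphere. A shortest walk thus climbs exactly one sphere per
  step.\<close>

lemma sphere_walk_last_step:
  assumes "v \<in> sphere_at E u (Suc k)" "p \<in> walks E u v (Suc k)"
  obtains x q where "p = q @ [v]" "q \<in> walks E u x k" "x \<in> sphere_at E u k" "(x, v) \<in> out_edges E u k"
proof -
  obtain x q where *: "p = q @ [v]" "q \<in> walks E u x k" "v \<in> nbr E x"
    using assms(2) by (rule walks_Suc_cases)
  have "x \<notin> nbhd E u s" if "s < k" for s
  proof
    assume "x \<in> nbhd E u s"
    then have "v \<in> nbhd E u (Suc s)" using *(3) by auto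
    then show False using sphere_at_diff[OF _ assms(1), of "Suc s"] that by auto
  qed
  then have "x \<in> sphere_at E u k" using walks_nbhd[OF *(2)] by (auto simp: sphere_at_def)
  moreover have "v \<notin> nbhd E u k" using assms(1) by (auto simp: sphere_at_Suc)
  ultimately show thesis using * that by (auto simp: out_edges_def)
qed

lemma sphere_walk_distinct:
  "v \<in> sphere_at E u k \<Longrightarrow> p \<in> walks E u v k \<Longrightarrow> distinct p \<and> set p \<subseteq> nbhd E u k"
proof (induction k arbitrary: v p)
  case (Suc k)
  then obtain x q where *: "p = q @ [v]" "q \<in> walks E u x k" "x \<in> sphere_at E u k"
    by (elim sphere_walk_last_step)
  then have "distinct q" "set q \<subseteq> nbhd E u k" using Suc.IH by auto
  moreover have "v \<in> nbhd E u (Suc k)" "v \<notin> nbhd E u k" using Suc.prems by (auto simp: sphere_at_Suc)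
  ultimately show ?case using * nbhd_mono[of k "Suc k" E u] by auto
qed (auto simp: walks_0)

lemma is_path_walk: "is_path E u v p \<Longrightarrow> p \<in> walks E u v (length p - 1)"
  by (simp add: is_path_def walks_def)

text \<open>Each step of a walk of length \<open>k\<close> to the sphere leaves the ball containing
  all earlier vertices, so such a walk is a path; no path is shorter. From here on geodesics are
  counted as walks, with no distinctness to check.\<close>

lemma geodesics_eq_walks:
  assumes v: "v \<in> sphere_at E u k"
  shows "geodesics E u v = walks E u v k"
proof -
  have path: "is_path E u v p \<and> length p = Suc k" if "p \<in> walks E u v k" for p
    using sphere_walk_distinct[OF v that] that by (auto simp: walks_def is_path_def)
  have long: "Suc k \<le> length p" if "is_path E u v p" for p
  proof -
    have "v \<in> nbhd E u (length p - 1)" using walks_nbhd[OF is_path_walk[OF that]] .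
    then have "\<not> length p - 1 < k" using sphere_at_diff[OF _ v] by blast
    moreover have "length p \<noteq> 0" using that by (simp add: is_path_def)
    ultimately show ?thesis by linarith
  qed
  obtain p0 where p0: "p0 \<in> walks E u v k" using sphere_walks_nonempty[OF v] by blast
  show ?thesis
  proof (intro equalityI subsetI)
    fix p assume "p \<in> geodesics E u v"
    then have p: "is_path E u v p" "length p \<le> length p0" using path[OF p0] by (auto simp: geodesics_def)
    then have "length p = Suc k" using long path[OF p0] by force
    then show "p \<in> walks E u v k" using is_path_walk[OF p(1)] by simp
  next
    fix p assume "p \<in> walks E u v k"
    with path long show "p \<in> geodesics E u v" by (auto simp: geodesics_def)
  qed
qed

definition shortest_walks :: "'a set set \<Rightarrow> 'a \<Rightarrow> nat \<Rightarrow> 'a list set" where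
  "shortest_walks E u k = (\<Union>x\<in>sphere_at E u k. walks E u x k)"

lemma shortest_walks_Suc:
  "shortest_walks E u (Suc k) \<subseteq>
     (\<lambda>(q, z). q @ [z]) ` (SIGMA q : shortest_walks E u k. {z. (last q, z) \<in> out_edges E u k})"
proof
  fix p assume "p \<in> shortest_walks E u (Suc k)"
  then obtain v where v: "v \<in> sphere_at E u (Suc k)" "p \<in> walks E u v (Suc k)"
    by (auto simp: shortest_walks_def)
  then obtain x q where *: "p = q @ [v]" "q \<in> walks E u x k" "x \<in> sphere_at E u k" "(x, v) \<in> out_edges E u k"
    by (rule sphere_walk_last_step)
  then have "last q = x" by (simp add: walks_def)
  with * have "(q, v) \<in> (SIGMA q : shortest_walks E u k. {z. (last q, z) \<in> out_edges E u k})"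
    by (auto simp: shortest_walks_def)
  then show "p \<in> (\<lambda>(q, z). q @ [z]) ` (SIGMA q : shortest_walks E u k. {z. (last q, z) \<in> out_edges E u k})"
    by (rule rev_image_eqI) (simp add: *)
qed

text \<open>From the second step on, one neighbour is the parent and leads back; this gives
  \<open>d - 1\<close> instead of \<open>d\<close>.\<close>

lemma card_out_fibre:
  assumes E: "E \<in> regular_graphs n d"
  shows "finite {z. (x, z) \<in> out_edges E u k}" "card {z. (x, z) \<in> out_edges E u k} \<le> d"
    "k > 0 \<Longrightarrow> card {z. (x, z) \<in> out_edges E u k} \<le> d - 1"
proof -
  have sub: "{z. (x, z) \<in> out_edges E u k} \<subseteq> nbr E x" by (auto simp: out_edges_def)
  show "finite {z. (x, z) \<in> out_edges E u k}" by (rule finite_subset[OF sub finite_nbr[OF E]])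
  show "card {z. (x, z) \<in> out_edges E u k} \<le> d"
    using card_mono[OF finite_nbr[OF E] sub] card_nbr_le[OF E, of x] by linarith
  assume "k > 0"
  then obtain m where k: "k = Suc m" by (cases k) auto
  show "card {z. (x, z) \<in> out_edges E u k} \<le> d - 1"
  proof (cases "x \<in> sphere_at E u k")
    case True
    note p = parent[OF True[unfolded k]]
    have "{z. (x, z) \<in> out_edges E u k} \<subseteq> nbr E x - {parent E u k x}"
      using p sphere_subset_nbhd[of E u m] nbhd_mono[of m k E u] by (auto simp: out_edges_def k)
    then have "card {z. (x, z) \<in> out_edges E u k} \<le> card (nbr E x - {parent E u k x})"
      using finite_nbr[OF E] by (intro card_mono) auto
    then show ?thesis
      using card_nbr_le[OF E, of x] p finite_nbr[OF E, of x] by (simp add: k)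
  qed (simp add: out_edges_def)
qed

lemma finite_shortest_walks:
  assumes E: "E \<in> regular_graphs n d"
  shows "finite (shortest_walks E u k)"
proof (induction k)
  case (Suc k)
  show ?case
    by (rule finite_subset[OF shortest_walks_Suc])
      (use Suc card_out_fibre(1)[OF E] in \<open>auto intro!: finite_SigmaI\<close>)
qed (simp add: shortest_walks_def walks_0)

lemma card_shortest_walks_Suc_le:
  assumes E: "E \<in> regular_graphs n d" and c: "\<And>x. card {z. (x, z) \<in> out_edges E u k} \<le> c"
  shows "card (shortest_walks E u (Suc k)) \<le> card (shortest_walks E u k) * c"
proof -
  let ?S = "SIGMA q : shortest_walks E u k. {z. (last q, z) \<in> out_edges E u k}"
  have fin: "finite ?S"
    using finite_shortest_walks[OF E] card_out_fibre(1)[OF E] by (intro finite_SigmaI) auto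
  have "card (shortest_walks E u (Suc k)) \<le> card ((\<lambda>(q, z). q @ [z]) ` ?S)"
    by (rule card_mono[OF _ shortest_walks_Suc]) (use fin in simp)
  also have "\<dots> \<le> card ?S" by (rule card_image_le[OF fin])
  also have "\<dots> \<le> card (shortest_walks E u k) * c"
    by (rule card_Sigma_le) (use finite_shortest_walks[OF E] card_out_fibre(1)[OF E] c in auto)
  finally show ?thesis .
qed

lemma card_shortest_walks_le:
  assumes E: "E \<in> regular_graphs n d"
  shows "card (shortest_walks E u (Suc k)) \<le> d * (d - 1) ^ k"
proof (induction k)
  case 0
  show ?case
    using card_shortest_walks_Suc_le[OF E card_out_fibre(2)[OF E], of u 0]
    by (simp add: shortest_walks_def walks_0)
next
  case (Suc k)
  have "card (shortest_walks E u (Suc (Suc k))) \<le> card (shortest_walks E u (Suc k)) * (d - 1)"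
    by (rule card_shortest_walks_Suc_le[OF E card_out_fibre(3)[OF E]]) simp
  also have "\<dots> \<le> d * (d - 1) ^ k * (d - 1)" using Suc by (rule mult_le_mono1)
  finally show ?case by (simp add: mult_ac)
qed

lemma walks_subset_shortest: "x \<in> sphere_at E u k \<Longrightarrow> walks E u x k \<subseteq> shortest_walks E u k"
  by (auto simp: shortest_walks_def)

section \<open>Vertices reached by several shortest walks\<close>

text \<open>On the sphere at least one walk exists, so \<open>\<noteq> 1\<close> means two or
  more.\<close>

definition multi_sphere :: "'a set set \<Rightarrow> 'a \<Rightarrow> nat \<Rightarrow> 'a set" where
  "multi_sphere E u k = {x \<in> sphere_at E u k. card (walks E u x k) \<noteq> 1}"

text \<open>The tree bound on shortest walks leaves room for only few vertices reached twice.\<close>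

lemma multi_sphere_le_deficit:
  assumes E: "E \<in> regular_graphs n d" and d: "d \<ge> 3"
  shows "real (card (multi_sphere E u k)) \<le> deficit E d u k"
proof (cases k)
  case 0
  then have "multi_sphere E u k = {}" by (auto simp: multi_sphere_def walks_0)
  then show ?thesis using deficit_nonneg[OF E] by simp
next
  case (Suc m)
  let ?S = "sphere_at E u k"
  have fin: "finite ?S" by (rule finite_sphere_at[OF E])
  have finw: "finite (walks E u x k)" if "x \<in> ?S" for x
    using finite_subset[OF walks_subset_shortest[OF that] finite_shortest_walks[OF E]] .
  have "card (multi_sphere E u k) = (\<Sum>x\<in>?S. if card (walks E u x k) \<noteq> 1 then 1 else 0)"
    unfolding multi_sphere_def card_eq_sum by (rule sum.inter_filter[OF fin])
  \<comment> \<open>A multiply reached vertex counts twice on the left and carries at least two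
    shortest walks.\<close>
  then have "card ?S + card (multi_sphere E u k) = (\<Sum>x\<in>?S. 1 + (if card (walks E u x k) \<noteq> 1 then 1 else 0))"
    by (simp only: sum.distrib card_eq_sum[of ?S])
  also have "\<dots> \<le> (\<Sum>x\<in>?S. card (walks E u x k))"
  proof (rule sum_mono)
    fix x assume x: "x \<in> ?S"
    have "card (walks E u x k) > 0" using sphere_walks_nonempty[OF x] finw[OF x] by (simp add: card_gt_0_iff)
    then show "1 + (if card (walks E u x k) \<noteq> 1 then 1 else 0) \<le> card (walks E u x k)" by auto
  qed
  also have "\<dots> = card (shortest_walks E u k)"
    unfolding shortest_walks_def
    by (rule card_UN_disjoint[symmetric]) (use fin finw in \<open>auto simp: walks_def\<close>)
  also have "\<dots> \<le> d * (d - 1) ^ m" unfolding Suc by (rule card_shortest_walks_le[OF E])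
  finally have 1: "card ?S + card (multi_sphere E u k) \<le> d * (d - 1) ^ m" .
  \<comment> \<open>Passes from vertices to stubs, in which the deficit is measured: a sphere vertex
    emits at most \<open>d - 1\<close>.\<close>
  have "card (out_edges E u k) + (d - 1) * card (multi_sphere E u k)
     \<le> (d - 1) * card ?S + (d - 1) * card (multi_sphere E u k)"
    using card_out_edges_Suc_le[OF E, of u m] by (simp add: Suc)
  also have "\<dots> \<le> (d - 1) * (d * (d - 1) ^ m)"
    using mult_le_mono2[OF 1, of "d - 1"] by (simp add: distrib_left)
  finally have "card (out_edges E u k) + (d - 1) * card (multi_sphere E u k) \<le> d * (d - 1) ^ k"
    by (simp add: Suc mult_ac)
  moreover have "1 * card (multi_sphere E u k) \<le> (d - 1) * card (multi_sphere E u k)"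
    using d by (intro mult_le_mono1) linarith
  ultimately have "card (out_edges E u k) + card (multi_sphere E u k) \<le> d * (d - 1) ^ k" by linarith
  then have "real (card (out_edges E u k) + card (multi_sphere E u k)) \<le> real (d * (d - 1) ^ k)"
    by (simp only: of_nat_le_iff)
  then show ?thesis by (simp add: deficit_def)
qed

lemma walks_rev: "rev p \<in> walks E u v k \<longleftrightarrow> p \<in> walks E v u k"
  by (auto simp: walks_def successively_rev hd_rev last_rev insert_commute)

text \<open>The step from position \<open>i\<close> to \<open>i + 1\<close> is a middle edge: if its
  start were nearer than \<open>i\<close> to \<open>u\<close>, or its end nearer than
  \<open>j\<close> to \<open>v\<close>, the distance would be at most \<open>i + j\<close>. What
  precedes and what follows can be chosen independently.\<close>

lemma card_walks_middle:
  assumes E: "E \<in> regular_graphs n d" and far: "v \<notin> nbhd E u (i + j)"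
  shows "card (walks E u v (Suc (i + j))) =
    (\<Sum>(x, y)\<in>middle_edges E u v i j. card (walks E u x i) * card (walks E v y j))"
proof -
  let ?M = "middle_edges E u v i j"
  let ?S = "SIGMA (x, y) : ?M. walks E u x i \<times> walks E v y j"
  \<comment> \<open>The second half is recorded from \<open>v\<close> outwards, so that both halves
    start at the centre of a ball.\<close>
  let ?f = "\<lambda>((x, y), (q, r)). q @ rev r"
  have fin: "finite (walks E u x i \<times> walks E v y j)" if "(x, y) \<in> ?M" for x y
    using that finite_subset[OF walks_subset_shortest finite_shortest_walks[OF E]]
    by (auto simp: middle_edges_def)
  have "bij_betw ?f ?S (walks E u v (Suc (i + j)))"
    unfolding bij_betw_def
  proof
    show "inj_on ?f ?S"
    proof (rule inj_onI)
      fix a b assume a: "a \<in> ?S" and b: "b \<in> ?S" and eq: "?f a = ?f b"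
      obtain x y q r where ae: "a = ((x, y), (q, r))" by (metis surj_pair)
      obtain x' y' q' r' where be: "b = ((x', y'), (q', r'))" by (metis surj_pair)
      have "length q = length q'" using a b ae be by (auto simp: walks_def)
      then have "q = q'" "r = r'" using eq ae be by auto
      moreover have "last q = x" "last q' = x'" "last r = y" "last r' = y'"
        using a b ae be by (auto simp: walks_def)
      ultimately show "a = b" using ae be by auto
    qed
    show "?f ` ?S = walks E u v (Suc (i + j))"
    proof (intro equalityI image_subsetI subsetI)
      fix a assume a: "a \<in> ?S"
      obtain x y q r where ae: "a = ((x, y), (q, r))" by (metis surj_pair)
      have "rev r \<in> walks E y v j" using a ae by (simp add: walks_rev)
      then show "?f a \<in> walks E u v (Suc (i + j))"
        using a ae walks_append[of q E u x i "rev r" y v j] by (auto simp: middle_edges_def)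
    next
      fix p assume "p \<in> walks E u v (Suc (i + j))"
      then obtain x y q r where p: "p = q @ r" "q \<in> walks E u x i" "r \<in> walks E y v j" "y \<in> nbr E x"
        by (rule walks_split)
      have r: "rev r \<in> walks E v y j" using p by (simp add: walks_rev)
      have x: "x \<in> nbhd E u i" and y: "y \<in> nbhd E v j" using p r walks_nbhd by metis+
      have "x \<notin> nbhd E u s" if "s < i" for s
      proof
        assume "x \<in> nbhd E u s"
        then have "y \<in> nbhd E u (Suc s)" using p by auto
        moreover have "v \<in> nbhd E y j" using y nbhd_sym by metis
        ultimately have "v \<in> nbhd E u (Suc s + j)" by (rule nbhd_trans)
        then show False using far nbhd_mono[of "Suc s + j" "i + j" E u] that by auto
      qed
      moreover have "y \<notin> nbhd E v s" if "s < j" for s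
      proof
        assume "y \<in> nbhd E v s"
        then have "v \<in> nbhd E y s" using nbhd_sym by metis
        moreover have "y \<in> nbhd E u (Suc i)" using x p by auto
        ultimately have "v \<in> nbhd E u (Suc i + s)" using nbhd_trans by metis
        then show False using far nbhd_mono[of "Suc i + s" "i + j" E u] that by auto
      qed
      ultimately have "(x, y) \<in> ?M" using x y p by (auto simp: middle_edges_def sphere_at_def)
      then have "((x, y), (q, rev r)) \<in> ?S" using p r by auto
      then show "p \<in> ?f ` ?S" by (rule rev_image_eqI) (simp add: p)
    qed
  qed
  then have "card (walks E u v (Suc (i + j))) = card ?S" by (metis bij_betw_same_card)
  also have "\<dots> = (\<Sum>(x, y)\<in>?M. card (walks E u x i \<times> walks E v y j))"
    using fin by (intro card_Sigma_prod finite_middle_edges[OF E]) auto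
  finally show ?thesis by (simp add: card_cartesian_product)
qed

lemma middle_edges_empty_iff:
  assumes E: "E \<in> regular_graphs n d" and far: "v \<notin> nbhd E u (i + j)"
  shows "middle_edges E u v i j = {} \<longleftrightarrow> v \<notin> nbhd E u (Suc (i + j))"
proof
  assume M: "middle_edges E u v i j = {}"
  show "v \<notin> nbhd E u (Suc (i + j))"
  proof
    assume "v \<in> nbhd E u (Suc (i + j))"
    with far have v: "v \<in> sphere_at E u (Suc (i + j))" by (auto simp: sphere_at_Suc)
    have "card (walks E u v (Suc (i + j))) \<noteq> 0"
      using sphere_walks_nonempty[OF v] finite_subset[OF walks_subset_shortest[OF v] finite_shortest_walks[OF E]]
      by simp
    then show False using card_walks_middle[OF E far] M by simp
  qed
next
  assume v: "v \<notin> nbhd E u (Suc (i + j))"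
  show "middle_edges E u v i j = {}"
  proof (rule ccontr)
    assume "middle_edges E u v i j \<noteq> {}"
    then obtain x y where xy: "x \<in> sphere_at E u i" "y \<in> sphere_at E v j" "y \<in> nbr E x"
      by (auto simp: middle_edges_def)
    then have "y \<in> nbhd E u (Suc i)" "v \<in> nbhd E y j"
      using sphere_subset_nbhd[of E u i] sphere_subset_nbhd[of E v j] nbhd_sym[of y E v j] by auto
    then show False using nbhd_trans[of y E u "Suc i" v j] v by simp
  qed
qed

text \<open>This closes the recursion in the distance: the case of 0 middle edges at
  \<open>i + j\<close> is the far event at the next radius.\<close>

lemma far_triples_Suc: "far_triples n d (Suc (i + j)) = link_triples n d i j 0"
proof -
  have "v \<notin> nbhd E u (Suc (i + j)) \<longleftrightarrow> v \<notin> nbhd E u (i + j) \<and> card (middle_edges E u v i j) = 0"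
    if E: "E \<in> regular_graphs n d" for E u v
    using middle_edges_empty_iff[OF E, of v u i j] finite_middle_edges[OF E, of u v i j]
      nbhd_mono[of "i + j" "Suc (i + j)" E u] by auto
  then show ?thesis by (auto simp: far_triples_def link_triples_def triples_def)
qed

text \<open>Indexed by one less than the distance, because the middle edge takes one step and leaves
  \<open>r\<close> to be split between the balls.\<close>

definition geo_triples :: "nat \<Rightarrow> nat \<Rightarrow> nat \<Rightarrow> nat \<Rightarrow> (nat set set \<times> nat \<times> nat) set" where
  "geo_triples n d l r = {(E, u, v) \<in> far_triples n d r. v \<in> nbhd E u (Suc r) \<and> card (geodesics E u v) = l}"

text \<open>The event that a multiply reached vertex could lie on the near half of a geodesic. It is
  stated without the far condition so that, for given \<open>E\<close> and \<open>u\<close>, the bad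
  \<open>v\<close> are covered by few balls.\<close>

definition multi_triples :: "nat \<Rightarrow> nat \<Rightarrow> nat \<Rightarrow> nat \<Rightarrow> (nat set set \<times> nat \<times> nat) set" where
  "multi_triples n d i j =
     {(E, u, v) \<in> triples n d. \<exists>x\<in>multi_sphere E u i. \<exists>y\<in>nbr E x. v \<in> nbhd E y j}"

text \<open>Outside the exceptional sets both ends of every middle edge are reached by a single
  shortest walk, so each middle edge lies on exactly one geodesic. At \<open>l = 0\<close> the two
  sides differ: no middle edge means a larger distance.\<close>

lemma geo_link_triples:
  assumes l: "l \<ge> 1" and T: "(E, u, v) \<notin> multi_triples n d i j" "(E, v, u) \<notin> multi_triples n d j i"
  shows "(E, u, v) \<in> geo_triples n d l (i + j) \<longleftrightarrow> (E, u, v) \<in> link_triples n d i j l"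
proof (cases "(E, u, v) \<in> far_triples n d (i + j)")
  case True
  then have E: "E \<in> regular_graphs n d" and far: "v \<notin> nbhd E u (i + j)" and uv: "u < n" "v < n"
    by (auto simp: far_triples_def triples_def)
  have "card (walks E u v (Suc (i + j))) = (\<Sum>(x, y)\<in>middle_edges E u v i j. card (walks E u x i) * card (walks E v y j))"
    by (rule card_walks_middle[OF E far])
  also have "\<dots> = (\<Sum>(x, y)\<in>middle_edges E u v i j. 1)"
  proof (rule sum.cong[OF refl])
    fix p assume "p \<in> middle_edges E u v i j"
    then obtain x y where p: "p = (x, y)" and x: "x \<in> sphere_at E u i" "x \<in> nbhd E u i"
      and y: "y \<in> sphere_at E v j" "y \<in> nbhd E v j" and e: "y \<in> nbr E x"
      using sphere_subset_nbhd[of E u i] sphere_subset_nbhd[of E v j] by (auto simp: middle_edges_def)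
    have "v \<in> nbhd E y j" "u \<in> nbhd E x i" "x \<in> nbr E y" using x y e nbhd_sym nbr_sym by metis+
    then have "x \<notin> multi_sphere E u i" "y \<notin> multi_sphere E v j"
      using T E uv e by (auto simp: multi_triples_def triples_def)
    then show "(case p of (x, y) \<Rightarrow> card (walks E u x i) * card (walks E v y j)) = (case p of (x, y) \<Rightarrow> 1)"
      using x y p by (simp add: multi_sphere_def)
  qed
  finally have c: "card (walks E u v (Suc (i + j))) = card (middle_edges E u v i j)" by (simp add: case_prod_unfold)
  show ?thesis
  proof (cases "v \<in> nbhd E u (Suc (i + j))")
    case v: True
    then have "v \<in> sphere_at E u (Suc (i + j))" using far by (simp add: sphere_at_Suc)
    then have "card (geodesics E u v) = card (middle_edges E u v i j)"
      using c by (simp add: geodesics_eq_walks)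
    then show ?thesis using v True by (simp add: geo_triples_def link_triples_def)
  next
    case v: False
    then have "middle_edges E u v i j = {}" using middle_edges_empty_iff[OF E far] by simp
    then show ?thesis using l v by (simp add: geo_triples_def link_triples_def)
  qed
qed (auto simp: geo_triples_def link_triples_def)

text \<open>The number of multiply reached vertices is at most the deficit, on average of order
  \<open>s ^ 2 / n\<close>; each of them endangers O(\<open>s\<close>) of the \<open>n\<close>
  choices of \<open>v\<close>.\<close>

lemma card_multi_triples_le:
  assumes d: "d \<ge> 3" and large: "8 * d * (d - 1) ^ i + 4 * d \<le> n"
    and s: "real (d - 1) ^ i \<le> s" "real (d - 1) ^ j \<le> s"
  shows "card (multi_triples n d i j) \<le> 32 * real d ^ 6 * (s ^ 3 / real n ^ 2) * card (triples n d)"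
proof -
  let ?G = "regular_graphs n d" and ?b = "real (d - 1)"
  let ?V = "\<lambda>E u. \<Union>x\<in>multi_sphere E u i. \<Union>y\<in>nbr E x. nbhd E y j"
  have n: "n > 0" using large d by auto
  have s0: "s \<ge> 0" using s(1) zero_le_power[of ?b i] by linarith
  have finm: "finite (multi_sphere E u i)" if "E \<in> ?G" for E u
    by (rule finite_subset[OF _ finite_sphere_at[OF that]]) (auto simp: multi_sphere_def)
  have finV: "finite (?V E u)" if "E \<in> ?G" for E u
    using that by (auto simp: finm finite_nbr finite_nbhd)
  have V: "card (?V E u) \<le> deficit E d u i * (2 * d ^ 2 * s)" if E: "E \<in> ?G" for E u
  proof -
    have y: "card (\<Union>y\<in>nbr E x. nbhd E y j) \<le> d * (2 * d * (d - 1) ^ j)" for x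
    proof -
      have "card (\<Union>y\<in>nbr E x. nbhd E y j) \<le> (\<Sum>y\<in>nbr E x. card (nbhd E y j))"
        by (rule card_UN_le[OF finite_nbr[OF E]])
      also have "\<dots> \<le> card (nbr E x) * (2 * d * (d - 1) ^ j)"
        by (rule sum_bounded_above[where 'a=nat, simplified]) (rule card_nbhd_le[OF E d])
      also have "\<dots> \<le> d * (2 * d * (d - 1) ^ j)" by (rule mult_le_mono1[OF card_nbr_le[OF E]])
      finally show ?thesis .
    qed
    have "card (?V E u) \<le> (\<Sum>x\<in>multi_sphere E u i. card (\<Union>y\<in>nbr E x. nbhd E y j))"
      by (rule card_UN_le[OF finm[OF E]])
    also have "\<dots> \<le> card (multi_sphere E u i) * (d * (2 * d * (d - 1) ^ j))"
      by (rule sum_bounded_above[where 'a=nat, simplified]) (rule y)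
    finally have "real (card (?V E u)) \<le> real (card (multi_sphere E u i) * (d * (2 * d * (d - 1) ^ j)))"
      by (simp only: of_nat_le_iff)
    also have "\<dots> = real (card (multi_sphere E u i)) * (2 * d ^ 2 * ?b ^ j)" by (simp add: power2_eq_square)
    also have "\<dots> \<le> deficit E d u i * (2 * d ^ 2 * s)"
      using multi_sphere_le_deficit[OF E d] deficit_nonneg[OF E] s by (intro mult_mono) auto
    finally show ?thesis .
  qed
  let ?S = "SIGMA (E, u) : ?G \<times> {..<n}. ?V E u"
  have "card (multi_triples n d i j) \<le> card ((\<lambda>((E, u), v). (E, u, v)) ` ?S)"
  proof (rule card_mono)
    show "finite ((\<lambda>((E, u), v). (E, u, v)) ` ?S)"
      using finV by (auto intro!: finite_imageI finite_SigmaI simp: finite_regular_graphs)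
    show "multi_triples n d i j \<subseteq> (\<lambda>((E, u), v). (E, u, v)) ` ?S"
    proof
      fix p assume p: "p \<in> multi_triples n d i j"
      obtain E u v where pe: "p = (E, u, v)" by (metis surj_pair)
      have "((E, u), v) \<in> ?S" using p pe by (auto simp: multi_triples_def triples_def)
      then show "p \<in> (\<lambda>((E, u), v). (E, u, v)) ` ?S" by (rule rev_image_eqI) (simp add: pe)
    qed
  qed
  also have "\<dots> \<le> card ?S"
    by (rule card_image_le) (use finV in \<open>auto intro!: finite_SigmaI simp: finite_regular_graphs\<close>)
  also have "\<dots> = (\<Sum>(E, u)\<in>?G \<times> {..<n}. card (?V E u))"
    by (rule card_Sigma_prod) (use finV in \<open>auto simp: finite_regular_graphs\<close>)
  finally have "real (card (multi_triples n d i j)) \<le> real (\<Sum>(E, u)\<in>?G \<times> {..<n}. card (?V E u))"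
    by (simp only: of_nat_le_iff)
  also have "\<dots> = (\<Sum>(E, u)\<in>?G \<times> {..<n}. real (card (?V E u)))" by (simp add: case_prod_unfold)
  also have "\<dots> \<le> (\<Sum>(E, u)\<in>?G \<times> {..<n}. deficit E d u i * (2 * d ^ 2 * s))"
    by (rule sum_mono_prod) (use V in auto)
  also have "\<dots> = (\<Sum>(E, u)\<in>?G \<times> {..<n}. deficit E d u i) * (2 * d ^ 2 * s)"
    by (simp add: sum_distrib_right case_prod_unfold)
  also have "\<dots> \<le> (card ?G * (16 * real d ^ 4 * ?b ^ (2 * i))) * (2 * d ^ 2 * s)"
    using s0 by (intro mult_right_mono sum_deficit_le[OF d large]) auto
  also have "\<dots> \<le> (card ?G * (16 * real d ^ 4 * s ^ 2)) * (2 * d ^ 2 * s)"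
    using s s0 unfolding power_mult mult.commute[of 2] by (intro mult_right_mono mult_left_mono power_mono) auto
  also have "\<dots> = 32 * real d ^ 6 * (s ^ 3 / real n ^ 2) * card (triples n d)"
    using n by (simp add: card_triples field_simps power2_eq_square power3_eq_cube flip: power_add)
      (simp add: eval_nat_numeral)
  finally show ?thesis .
qed

lemma geo_link_triples_diff:
  assumes d: "d \<ge> 3" and l: "l \<ge> 1"
    and large: "8 * d * (d - 1) ^ i + 4 * d \<le> n" "8 * d * (d - 1) ^ j + 4 * d \<le> n"
    and s: "real (d - 1) ^ i \<le> s" "real (d - 1) ^ j \<le> s"
  shows "\<bar>real (card (geo_triples n d l (i + j))) - card (link_triples n d i j l)\<bar>
    \<le> 64 * real d ^ 6 * (s ^ 3 / real n ^ 2) * card (triples n d)"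
proof -
  let ?A = "geo_triples n d l (i + j)" and ?B = "link_triples n d i j l"
  let ?swap = "\<lambda>(E, u, v). (E, v, u)"
  \<comment> \<open>\<open>multi_triples\<close> looks from its first vertex; the exchanged copy
    covers repetitions on the side of \<open>v\<close>.\<close>
  let ?X = "multi_triples n d i j \<union> ?swap ` multi_triples n d j i"
  have finm: "finite (multi_triples n d i j)" for i j
    by (rule finite_subset[OF _ finite_triples]) (auto simp: multi_triples_def)
  have finA: "finite ?A"
    by (rule finite_subset[OF _ finite_far_triples]) (auto simp: geo_triples_def)
  have iff: "p \<in> ?A \<longleftrightarrow> p \<in> ?B" if "p \<notin> ?X" for p
  proof -
    obtain E u v where p: "p = (E, u, v)" by (metis surj_pair)
    have "(E, v, u) \<notin> multi_triples n d j i"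
    proof
      assume "(E, v, u) \<in> multi_triples n d j i"
      then have "p \<in> ?X" unfolding p by (intro UnI2 rev_image_eqI[of "(E, v, u)"]) auto
      with that show False by simp
    qed
    with that p geo_link_triples[OF l] show ?thesis by blast
  qed
  have "card ?X \<le> card (multi_triples n d i j) + card (multi_triples n d j i)"
    using card_Un_le card_image_le[OF finm] by (meson add_left_mono order_trans)
  then have "real (card ?X) \<le> real (card (multi_triples n d i j)) + real (card (multi_triples n d j i))"
    by (simp flip: of_nat_add)
  also have "\<dots> \<le> 64 * real d ^ 6 * (s ^ 3 / real n ^ 2) * card (triples n d)"
    using card_multi_triples_le[OF d large(1) s] card_multi_triples_le[OF d large(2) s(2,1)] by linarith
  finally have X: "real (card ?X) \<le> 64 * real d ^ 6 * (s ^ 3 / real n ^ 2) * card (triples n d)" .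
  have "card ?A \<le> card (?B \<union> ?X)" "card ?B \<le> card (?A \<union> ?X)"
    by (rule card_mono; use iff finm finA finite_link_triples in blast)+
  then have "card ?A \<le> card ?B + card ?X" "card ?B \<le> card ?A + card ?X"
    using card_Un_le order_trans by blast+
  then show ?thesis using X by linarith
qed

section \<open>Total mass of the far event\<close>

lemma far_triples_link_sum_le:
  "(\<Sum>l<L. card (link_triples n d i j l)) \<le> card (far_triples n d (i + j))"
proof -
  have "(\<Sum>l<L. card (link_triples n d i j l)) = card (\<Union>l<L. link_triples n d i j l)"
    by (rule card_UN_disjoint[symmetric]) (simp_all add: finite_link_triples, auto simp: link_triples_def)
  also have "\<dots> \<le> card (far_triples n d (i + j))"
    by (rule card_mono[OF finite_far_triples]) (auto simp: link_triples_def)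
  finally show ?thesis .
qed

text \<open>Markov's inequality for the number of middle edges.\<close>

lemma far_triples_le_link_sum:
  assumes d: "d \<ge> 3" and n: "n > 0" and L: "L > 0"
  shows "card (far_triples n d (i + j)) \<le> (\<Sum>l<L. real (card (link_triples n d i j l)))
    + 2 * real d ^ 2 * real (d - 1) ^ (i + j) / (real n * L) * card (triples n d)"
proof -
  let ?F = "far_triples n d (i + j)" and ?G = "regular_graphs n d"
  let ?M = "\<lambda>(E, u, v). card (middle_edges E u v i j)"
  let ?H = "{p \<in> ?F. ?M p \<ge> L}"
  let ?c = "d * (d - 1) ^ i * (2 * d * (d - 1) ^ j)"
  have finH: "finite ?H" using finite_far_triples by simp
  have "?F \<subseteq> (\<Union>l<L. link_triples n d i j l) \<union> ?H" by (auto simp: link_triples_def)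
  then have "card ?F \<le> card ((\<Union>l<L. link_triples n d i j l) \<union> ?H)"
    using finH by (intro card_mono) (auto simp: finite_link_triples)
  also have "\<dots> \<le> card (\<Union>l<L. link_triples n d i j l) + card ?H" by (rule card_Un_le)
  also have "card (\<Union>l<L. link_triples n d i j l) \<le> (\<Sum>l<L. card (link_triples n d i j l))"
    by (rule card_UN_le) simp
  finally have 1: "card ?F \<le> (\<Sum>l<L. card (link_triples n d i j l)) + card ?H" by simp
  let ?S = "SIGMA (E, u, v) : ?F. middle_edges E u v i j"
  \<comment> \<open>A crude first moment: an edge leaving the first ball, then \<open>v\<close>
    within \<open>j\<close> of its outer end. A constant factor too much is harmless, since the
    bound is divided by \<open>L\<close>.\<close>
  let ?T = "SIGMA (E, u) : ?G \<times> {..<n}. SIGMA (x, y) : out_edges E u i. nbhd E y j"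
  have finT: "finite ?T"
    by (auto intro!: finite_SigmaI simp: finite_regular_graphs finite_out_edges finite_nbhd)
  have "L * card ?H = (\<Sum>p\<in>?H. L)" by simp
  also have "\<dots> \<le> (\<Sum>p\<in>?H. ?M p)" by (rule sum_mono) auto
  also have "\<dots> \<le> (\<Sum>p\<in>?F. ?M p)" by (rule sum_mono2[OF finite_far_triples]) auto
  also have "\<dots> = card ?S"
  proof (subst card_SigmaI[OF finite_far_triples])
    show "\<forall>p\<in>?F. finite (case p of (E, u, v) \<Rightarrow> middle_edges E u v i j)"
      by (auto simp: far_triples_def triples_def finite_middle_edges)
  qed (auto intro!: sum.cong)
  also have "\<dots> \<le> card ?T"
  proof (rule card_inj_on_le[OF _ _ finT])
    let ?f = "\<lambda>((E, u, v), (x, y)). ((E, u), ((x, y), v))"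
    show "inj_on ?f ?S" by (rule inj_onI) auto
    show "?f ` ?S \<subseteq> ?T"
    proof (rule image_subsetI)
      fix p assume p: "p \<in> ?S"
      obtain E u v x y where pe: "p = ((E, u, v), (x, y))" by (metis surj_pair)
      have far: "nbhd E u i \<inter> nbhd E v j = {}"
        using p pe by (auto simp: far_triples_def simp flip: nbhd_disjoint_iff)
      have "y \<in> nbhd E v j" using p pe sphere_subset_nbhd[of E v j] by (auto simp: middle_edges_def)
      then have "(x, y) \<in> out_edges E u i" "v \<in> nbhd E y j"
        using p pe far nbhd_sym[of y E v j] by (auto simp: middle_edges_def out_edges_def)
      then show "?f p \<in> ?T" using p pe by (auto simp: far_triples_def triples_def)
    qed
  qed
  also have "\<dots> \<le> card (?G \<times> {..<n}) * ?c"
  proof (rule card_Sigma_le)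
    fix p assume p: "p \<in> ?G \<times> {..<n}"
    obtain E u where pe: "p = (E, u)" by (cases p)
    have E: "E \<in> ?G" using p pe by simp
    show "finite (case p of (E, u) \<Rightarrow> SIGMA (x, y) : out_edges E u i. nbhd E y j)"
      using E by (auto simp: pe finite_out_edges finite_nbhd)
    have "card (SIGMA (x, y) : out_edges E u i. nbhd E y j) \<le> card (out_edges E u i) * (2 * d * (d - 1) ^ j)"
      by (rule card_Sigma_le) (use E d card_nbhd_le in \<open>auto simp: finite_out_edges finite_nbhd\<close>)
    also have "\<dots> \<le> ?c" by (rule mult_le_mono1[OF card_out_edges_le[OF E]])
    finally show "card (case p of (E, u) \<Rightarrow> SIGMA (x, y) : out_edges E u i. nbhd E y j) \<le> ?c"
      by (simp add: pe)
  qed (simp add: finite_regular_graphs)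
  finally have "real (L * card ?H) \<le> real (card (?G \<times> {..<n}) * ?c)" by (simp only: of_nat_le_iff)
  then have "real L * card ?H \<le> real (card ?G) * n * (2 * real d ^ 2 * real (d - 1) ^ (i + j))"
    by (simp add: card_cartesian_product power2_eq_square power_add mult_ac)
  also have "\<dots> = L * (2 * real d ^ 2 * real (d - 1) ^ (i + j) / (real n * L) * card (triples n d))"
    using n L by (simp add: card_triples)
  finally have "card ?H \<le> 2 * real d ^ 2 * real (d - 1) ^ (i + j) / (real n * L) * card (triples n d)"
    using L by (simp only: mult_le_cancel_left_pos of_nat_0_less_iff)
  moreover have "real (card ?F) \<le> (\<Sum>l<L. real (card (link_triples n d i j l))) + card ?H"
    using 1 by (simp flip: of_nat_sum of_nat_add)
  ultimately show ?thesis by linarith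
qed

text \<open>For given \<open>E\<close> and \<open>u\<close>, at most
  \<open>2 * d * (d - 1) ^ r\<close> choices of \<open>v\<close> are near. This is informative where
  the mean is small, and starts the recursion there.\<close>

lemma far_triples_ge:
  assumes d: "d \<ge> 3" and n: "n > 0"
  shows "card (triples n d) - 2 * real d * real (d - 1) ^ r / n * card (triples n d) \<le> card (far_triples n d r)"
proof -
  let ?G = "regular_graphs n d"
  let ?S = "SIGMA (E, u) : ?G \<times> {..<n}. nbhd E u r"
  have finS: "finite ?S" by (auto intro!: finite_SigmaI simp: finite_regular_graphs finite_nbhd)
  have "triples n d \<subseteq> far_triples n d r \<union> (\<lambda>((E, u), v). (E, u, v)) ` ?S"
  proof
    fix p assume p: "p \<in> triples n d"
    obtain E u v where pe: "p = (E, u, v)" by (metis surj_pair)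
    show "p \<in> far_triples n d r \<union> (\<lambda>((E, u), v). (E, u, v)) ` ?S"
    proof (cases "v \<in> nbhd E u r")
      case True
      then have "((E, u), v) \<in> ?S" using p pe by (auto simp: triples_def)
      then show ?thesis unfolding pe by (intro UnI2 rev_image_eqI) auto
    qed (use p pe in \<open>auto simp: far_triples_def\<close>)
  qed
  then have "card (triples n d) \<le> card (far_triples n d r \<union> (\<lambda>((E, u), v). (E, u, v)) ` ?S)"
    by (rule card_mono[rotated]) (use finS finite_far_triples in auto)
  also have "\<dots> \<le> card (far_triples n d r) + card ?S"
    by (intro order_trans[OF card_Un_le] add_left_mono card_image_le[OF finS])
  also have "card ?S \<le> card (?G \<times> {..<n}) * (2 * d * (d - 1) ^ r)"
    by (rule card_Sigma_le) (use d card_nbhd_le in \<open>auto simp: finite_regular_graphs finite_nbhd\<close>)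
  finally have "real (card (triples n d)) \<le> real (card (far_triples n d r) + card (?G \<times> {..<n}) * (2 * d * (d - 1) ^ r))"
    by (simp only: of_nat_le_iff add_left_mono)
  also have "\<dots> = card (far_triples n d r) + 2 * real d * real (d - 1) ^ r / n * card (triples n d)"
    using n by (simp add: card_cartesian_product card_triples)
  finally show ?thesis by linarith
qed

subsection \<open>Existence of regular graphs\<close>

text \<open>The Cayley graph of the integers modulo \<open>n\<close> with connection set
  \<open>A\<close>. Closure under \<open>n - a\<close> ensures that an edge read from its other end
  is again a shift by an element of \<open>A\<close>.\<close>

lemma circulant_regular:
  assumes A: "A \<subseteq> {1..<n}" and sym: "\<And>a. a \<in> A \<Longrightarrow> n - a \<in> A"
  shows "(\<lambda>(x, a). {x, (x + a) mod n}) ` ({..<n} \<times> A) \<in> regular_graphs n (card A)"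
proof -
  let ?E = "(\<lambda>(x, a). {x, (x + a) mod n}) ` ({..<n} \<times> A)"
  have md: "(x + a) mod n = (if x + a < n then x + a else x + a - n)" "1 \<le> a" "a < n"
    if "x < n" "a \<in> A" for x a
    using that A by (auto simp: le_mod_geq)
  have E: "e \<in> ?E \<longleftrightarrow> (\<exists>x a. x < n \<and> a \<in> A \<and> e = {x, (x + a) mod n})" for e
    by (auto simp: image_iff)
  have nbr: "y \<in> nbr ?E v \<longleftrightarrow> v < n \<and> y \<in> (\<lambda>a. (v + a) mod n) ` A" for y v
  proof
    assume "y \<in> nbr ?E v"
    then obtain x a where xa: "x < n" "a \<in> A" "{v, y} = {x, (x + a) mod n}"
      by (auto simp only: nbr_edge E)
    from xa(3) consider "v = x" "y = (x + a) mod n" | "y = x" "v = (x + a) mod n"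
      by (metis doubleton_eq_iff)
    then show "v < n \<and> y \<in> (\<lambda>a. (v + a) mod n) ` A"
    proof cases
      case 2
      have v: "v < n" using 2 xa by simp
      have "y = (v + (n - a)) mod n"
      proof (cases "x + a < n")
        case True
        then show ?thesis using 2 xa md[OF xa(1,2)] by simp
      next
        case False
        then have "v = x + a - n" using 2 md[OF xa(1,2)] by simp
        then show ?thesis using 2 False xa md[OF xa(1,2)] by simp
      qed
      then show ?thesis using sym[OF xa(2)] v by blast
    qed (use xa in auto)
  next
    assume "v < n \<and> y \<in> (\<lambda>a. (v + a) mod n) ` A"
    then show "y \<in> nbr ?E v" by (auto simp only: nbr_edge E)
  qed
  show ?thesis
    unfolding regular_graphs_iff
  proof (intro conjI ballI allI impI)
    fix e assume "e \<in> ?E"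
    then obtain x a where xa: "x < n" "a \<in> A" "e = {x, (x + a) mod n}" by (auto simp only: E)
    have "x \<noteq> (x + a) mod n" using md[OF xa(1,2)] xa by (simp split: if_splits)
    then show "card e = 2" using xa by simp
  next
    fix x y assume "y \<in> nbr ?E x"
    then show "x < n" "y < n" by (auto simp only: nbr mod_less_divisor)
  next
    fix v assume v: "v < n"
    then have "nbr ?E v = (\<lambda>a. (v + a) mod n) ` A" using nbr by blast
    moreover have "inj_on (\<lambda>a. (v + a) mod n) A"
    proof (rule inj_onI)
      fix a a' assume a: "a \<in> A" "a' \<in> A" "(v + a) mod n = (v + a') mod n"
      then show "a = a'" using md[OF v a(1)] md[OF v a(2)] v by (simp split: if_splits)
    qed
    ultimately show "card (nbr ?E v) = card A" by (simp add: card_image)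
  qed
qed

lemma regular_graphs_nonempty:
  assumes "d < n" "odd d \<Longrightarrow> even n"
  shows "regular_graphs n d \<noteq> {}"
proof -
  define h where "h = d div 2"
  \<comment> \<open>The shifts by 1 to \<open>h\<close> in both directions and, for odd
    \<open>d\<close>, the self-inverse shift \<open>n div 2\<close>, which exists as
    \<open>n\<close> is even.\<close>
  define A where "A = {1..h} \<union> {n - h..<n} \<union> {a. odd d \<and> 2 * a = n}"
  have d: "d = 2 * h + (if odd d then 1 else 0)" by (simp add: h_def)
  have n: "2 * h < n" "odd d \<Longrightarrow> 2 * h + 1 < n" using assms d by (auto split: if_splits)
  have "A \<subseteq> {1..<n}" using n by (auto simp: A_def)
  moreover have "n - a \<in> A" if "a \<in> A" for a
    using that n by (auto simp: A_def)
  moreover have "card A = d"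
  proof -
    have "{a. odd d \<and> 2 * a = n} = (if odd d then {n div 2} else {})"
      using assms(2) by auto
    then have m: "card {a. odd d \<and> 2 * a = n} = (if odd d then 1 else 0)"
      "finite {a. odd d \<and> 2 * a = n}" by auto
    have "card A = card ({1..h} \<union> {n - h..<n}) + card {a. odd d \<and> 2 * a = n}"
      unfolding A_def by (rule card_Un_disjoint) (use m n in auto)
    also have "card ({1..h} \<union> {n - h..<n}) = card {1..h} + card {n - h..<n}"
      by (rule card_Un_disjoint) (use n in auto)
    finally show ?thesis using n m d by auto
  qed
  ultimately show ?thesis using circulant_regular[of A n] by blast
qed

subsection \<open>The Poisson limit\<close>

text \<open>Every term of the tail is monotone in the argument, so truncating the series at
  \<open>L\<close> is uniform over all means up to \<open>K\<close>.\<close>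

lemma exp_partial_sum:
  fixes x :: real
  assumes "0 \<le> x" "x \<le> K"
  shows "(\<Sum>l<L. x ^ l / fact l) \<le> exp x"
    "exp x - (\<Sum>l<L. x ^ l / fact l) \<le> exp K - (\<Sum>l<L. K ^ l / fact l)"
proof -
  have s: "summable (\<lambda>l. y ^ l / fact l)" "exp y = (\<Sum>l. y ^ l / fact l)" for y :: real
    using exp_converges[of y] by (auto simp: sums_iff divide_inverse mult.commute)
  have tail: "exp y - (\<Sum>l<L. y ^ l / fact l) = (\<Sum>l. y ^ (l + L) / fact (l + L))" for y :: real
    using suminf_minus_initial_segment[OF s(1), of y L] s(2) by simp
  have st: "summable (\<lambda>l. y ^ (l + L) / fact (l + L))" for y :: real
    using s(1) by (subst summable_iff_shift)
  have "0 \<le> (\<Sum>l. x ^ (l + L) / fact (l + L))" using assms by (intro suminf_nonneg st) auto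
  then show "(\<Sum>l<L. x ^ l / fact l) \<le> exp x" using tail[of x] by linarith
  show "exp x - (\<Sum>l<L. x ^ l / fact l) \<le> exp K - (\<Sum>l<L. K ^ l / fact l)"
    unfolding tail using assms by (intro suminf_le st divide_right_mono power_mono) auto
qed

lemma tendsto_bounded_mult_zero:
  fixes f g :: "'a \<Rightarrow> real"
  assumes "eventually (\<lambda>x. \<bar>f x\<bar> \<le> C) F" "(g \<longlongrightarrow> 0) F"
  shows "((\<lambda>x. f x * g x) \<longlongrightarrow> 0) F"
proof (rule tendsto_0_le[OF assms(2), of _ C])
  show "eventually (\<lambda>x. norm (f x * g x) \<le> norm (g x) * C) F"
    using assms(1) by eventually_elim (simp add: abs_mult mult.commute[of "\<bar>g _\<bar>"] mult_right_mono)
qed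

text \<open>The recursion expresses each \<open>P l\<close> through \<open>P 0\<close> up to o(1).
  Summing over \<open>l < L\<close>, where both the exponential series and the mass beyond
  \<open>L\<close> have uniformly small tails, gives \<open>q = exp \<mu> * P 0 + o(1)\<close>. The
  mean may vary with \<open>x\<close>, so only differences are said to converge.\<close>

lemma poisson_limit:
  fixes P :: "nat \<Rightarrow> 'a \<Rightarrow> real" and q \<mu> :: "'a \<Rightarrow> real"
  assumes rec: "\<And>l. ((\<lambda>x. real (Suc l) * P (Suc l) x - \<mu> x * P l x) \<longlongrightarrow> 0) F"
    and \<mu>: "eventually (\<lambda>x. 0 \<le> \<mu> x \<and> \<mu> x \<le> K) F"
    and nonneg: "\<And>l x. 0 \<le> P l x"
    and q: "eventually (\<lambda>x. q x \<le> 1) F"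
    and lower: "\<And>L. eventually (\<lambda>x. (\<Sum>l<L. P l x) \<le> q x) F"
    and upper: "\<And>L. L > 0 \<Longrightarrow> eventually (\<lambda>x. q x \<le> (\<Sum>l<L. P l x) + C / real L) F"
  shows "((\<lambda>x. P l x - exp (- \<mu> x) * \<mu> x ^ l / fact l * q x) \<longlongrightarrow> 0) F"
proof -
  have 1: "((\<lambda>x. P l x - \<mu> x ^ l / fact l * P 0 x) \<longlongrightarrow> 0) F" for l
  proof (induction l)
    case (Suc l)
    have "((\<lambda>x. \<mu> x * (P l x - \<mu> x ^ l / fact l * P 0 x)) \<longlongrightarrow> 0) F"
      by (rule tendsto_bounded_mult_zero[OF _ Suc.IH, of _ K]) (use \<mu> in eventually_elim, auto)
    from tendsto_divide[OF tendsto_add[OF rec this] tendsto_const, of "real (Suc l)"]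
    have "((\<lambda>x. (real (Suc l) * P (Suc l) x - \<mu> x * P l x + \<mu> x * (P l x - \<mu> x ^ l / fact l * P 0 x)) / real (Suc l))
       \<longlongrightarrow> 0) F" by simp
    also have "(\<lambda>x. (real (Suc l) * P (Suc l) x - \<mu> x * P l x + \<mu> x * (P l x - \<mu> x ^ l / fact l * P 0 x)) / real (Suc l))
       = (\<lambda>x. P (Suc l) x - \<mu> x ^ Suc l / fact (Suc l) * P 0 x)"
      by (rule ext) (simp add: field_simps del: of_nat_Suc)
    finally show ?case .
  qed simp
  have P0: "eventually (\<lambda>x. P 0 x \<le> 1) F"
    using lower[of 1] q by eventually_elim simp
  have 2: "((\<lambda>x. q x - exp (\<mu> x) * P 0 x) \<longlongrightarrow> 0) F"
  proof (rule tendstoI)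
    fix \<epsilon> :: real assume \<epsilon>: "\<epsilon> > 0"
    \<comment> \<open>\<open>L\<close> must be fixed before passing to the limit along
      \<open>F\<close>, since the recursion controls only finitely many \<open>l\<close> at a
      time.\<close>
    have "(\<lambda>L. exp K - (\<Sum>l<L. K ^ l / fact l)) \<longlonglongrightarrow> exp K - exp K"
      using exp_converges[of K] by (intro tendsto_diff tendsto_const) (simp add: sums_def divide_inverse mult.commute)
    then have "eventually (\<lambda>L. exp K - (\<Sum>l<L. K ^ l / fact l) < \<epsilon> / 4) sequentially"
      using \<epsilon> by (intro order_tendstoD) auto
    moreover have "(\<lambda>L. C / real L) \<longlonglongrightarrow> 0" by (rule lim_const_over_n)
    then have "eventually (\<lambda>L. C / real L < \<epsilon> / 4) sequentially"
      using \<epsilon> by (intro order_tendstoD) auto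
    moreover have "eventually (\<lambda>L::nat. L > 0) sequentially" by (rule eventually_gt_at_top)
    ultimately have "eventually (\<lambda>L. exp K - (\<Sum>l<L. K ^ l / fact l) < \<epsilon> / 4 \<and> C / real L < \<epsilon> / 4 \<and> L > 0) sequentially"
      by eventually_elim simp
    then obtain L where L: "exp K - (\<Sum>l<L. K ^ l / fact l) < \<epsilon> / 4" "C / real L < \<epsilon> / 4" "L > 0"
      using eventually_happens'[OF sequentially_bot] by blast
    have "((\<lambda>x. \<Sum>l<L. P l x - \<mu> x ^ l / fact l * P 0 x) \<longlongrightarrow> (\<Sum>l<L. 0)) F"
      by (intro tendsto_sum 1)
    then have "eventually (\<lambda>x. \<bar>\<Sum>l<L. P l x - \<mu> x ^ l / fact l * P 0 x\<bar> < \<epsilon> / 4) F"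
      using \<epsilon> by (auto dest!: tendstoD[where e = "\<epsilon> / 4"])
    then show "eventually (\<lambda>x. dist (q x - exp (\<mu> x) * P 0 x) 0 < \<epsilon>) F"
      using lower[of L] upper[OF L(3)] \<mu> P0
    proof eventually_elim
      case (elim x)
      let ?S = "\<Sum>l<L. \<mu> x ^ l / fact l"
      have S: "?S \<le> exp (\<mu> x)" "exp (\<mu> x) - ?S < \<epsilon> / 4"
        using exp_partial_sum[of "\<mu> x" K L] elim L(1) by auto
      have "\<bar>(exp (\<mu> x) - ?S) * P 0 x\<bar> \<le> (\<epsilon> / 4) * 1"
        unfolding abs_mult using S nonneg[of 0 x] elim by (intro mult_mono) auto
      moreover have "(\<Sum>l<L. P l x - \<mu> x ^ l / fact l * P 0 x) = (\<Sum>l<L. P l x) - ?S * P 0 x"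
        by (simp add: sum_subtractf sum_distrib_right)
      ultimately have "\<bar>q x - exp (\<mu> x) * P 0 x\<bar> < \<epsilon>"
        using elim L(2) unfolding left_diff_distrib by linarith
      then show ?case by simp
    qed
  qed
  have "((\<lambda>x. exp (- \<mu> x) * \<mu> x ^ l / fact l * (q x - exp (\<mu> x) * P 0 x)) \<longlongrightarrow> 0) F"
  proof (rule tendsto_bounded_mult_zero[OF _ 2, of _ "K ^ l / fact l"])
    show "eventually (\<lambda>x. \<bar>exp (- \<mu> x) * \<mu> x ^ l / fact l\<bar> \<le> K ^ l / fact l) F"
      using \<mu>
    proof eventually_elim
      case (elim x)
      have "exp (- \<mu> x) * \<mu> x ^ l \<le> 1 * K ^ l"
        using elim by (intro mult_mono power_mono) auto
      then show ?case using elim by (simp add: divide_right_mono)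
    qed
  qed
  from tendsto_diff[OF 1[of l] this]
  have "((\<lambda>x. P l x - \<mu> x ^ l / fact l * P 0 x
     - exp (- \<mu> x) * \<mu> x ^ l / fact l * (q x - exp (\<mu> x) * P 0 x)) \<longlongrightarrow> 0) F" by simp
  also have "(\<lambda>x. P l x - \<mu> x ^ l / fact l * P 0 x
     - exp (- \<mu> x) * \<mu> x ^ l / fact l * (q x - exp (\<mu> x) * P 0 x))
     = (\<lambda>x. P l x - exp (- \<mu> x) * \<mu> x ^ l / fact l * q x)"
    by (rule ext) (simp add: exp_minus field_simps)
  finally show ?thesis .
qed

text \<open>The terms of index 0 and \<open>l\<close> of the exponential series sum to at most
  \<open>exp x\<close>. In probabilistic terms, a Poisson variable equal to \<open>l >= 1\<close> is
  nonzero.\<close>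

lemma poisson_term_le:
  fixes x :: real assumes "x \<ge> 0" "l \<ge> 1"
  shows "x ^ l / fact l * exp (- x) \<le> 1 - exp (- x)"
proof -
  have s: "summable (\<lambda>l. x ^ l / fact l)" "exp x = (\<Sum>l. x ^ l / fact l)"
    using exp_converges[of x] by (auto simp: sums_iff divide_inverse mult.commute)
  have "(\<Sum>k\<in>{0, l}. x ^ k / fact k) \<le> exp x"
    unfolding s(2) by (rule sum_le_suminf[OF s(1)]) (use assms in auto)
  then have "x ^ l / fact l \<le> exp x - 1" using assms by simp
  then have "x ^ l / fact l * exp (- x) \<le> (exp x - 1) * exp (- x)" by (rule mult_right_mono) simp
  then show ?thesis by (simp add: left_diff_distrib exp_minus)
qed

text \<open>Dominating \<open>f\<close> by the decrements of a function with values between 0 and 1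
  gives summability and bounds both tails by \<open>1 - h a\<close> and \<open>h c\<close>; applied
  below for every \<open>n\<close>, it truncates the series uniformly.\<close>

lemma infsum_telescoping:
  fixes f h :: "int \<Rightarrow> real"
  assumes f: "\<And>k. 0 \<le> f k" "\<And>k. f k \<le> h k - h (k + 1)" and h: "\<And>k. 0 \<le> h k" "\<And>k. h k \<le> 1"
    and ac: "a \<le> c"
  shows "sum f {a..<c} \<le> infsum f UNIV" "infsum f UNIV \<le> sum f {a..<c} + (1 - h a) + h c"
proof -
  have tel: "sum f {x..<y} \<le> h x - h y" if "x \<le> y" for x y
    using that
  proof (induction y rule: int_ge_induct)
    case (step y)
    have "{x..<y + 1} = insert y {x..<y}" using step by auto
    then show ?case using step f(2)[of y] by simp
  qed simp
  have bd: "sum f S \<le> sum f {a..<c} + (1 - h a) + h c" if S: "finite S" for S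
  proof -
    \<comment> \<open>The least interval that contains \<open>S\<close> and extends
      \<open>{a..<c}\<close>; its two outer parts telescope.\<close>
    define x where "x = Min (insert a S)"
    define y where "y = Max (insert c ((\<lambda>k. k + 1) ` S))"
    have x: "x \<le> a" "\<And>k. k \<in> S \<Longrightarrow> x \<le> k" using S by (auto simp: x_def)
    have y: "c \<le> y" using S by (auto simp: y_def)
    have y': "k < y" if "k \<in> S" for k
    proof -
      have "k + 1 \<le> y" unfolding y_def using S that by (intro Max_ge) auto
      then show ?thesis by simp
    qed
    have "sum f S \<le> sum f {x..<y}"
      by (rule sum_mono2) (use x y' f in auto)
    also have "{x..<y} = {x..<a} \<union> ({a..<c} \<union> {c..<y})" using x y ac by auto
    also have "sum f \<dots> = sum f {x..<a} + (sum f {a..<c} + sum f {c..<y})"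
      using ac by (subst sum.union_disjoint) (auto intro!: sum.union_disjoint)
    also have "\<dots> \<le> (h x - h a) + (sum f {a..<c} + (h c - h y))"
      using tel x y by (intro add_mono) auto
    finally show ?thesis using h(2)[of x] h(1)[of y] by linarith
  qed
  have sm: "f summable_on UNIV"
    by (rule nonneg_bdd_above_summable_on) (use f bd in \<open>auto intro!: bdd_aboveI2\<close>)
  show "sum f {a..<c} \<le> infsum f UNIV"
    by (rule finite_sum_le_infsum[OF sm]) (use f in auto)
  show "infsum f UNIV \<le> sum f {a..<c} + (1 - h a) + h c"
    by (rule infsum_le_finite_sums[OF sm]) (use bd in auto)
qed

subsection \<open>The scale of the typical distance\<close>

text \<open>\<open>nat\<close> cuts off negative values, which for a fixed \<open>t\<close> occur
  only at small \<open>n\<close>.\<close>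

definition radius :: "nat \<Rightarrow> int \<Rightarrow> nat \<Rightarrow> nat" where
  "radius d t n = nat (2 * \<lfloor>1/2 * log (real d - 1) (real n)\<rfloor> + t)"

text \<open>The Poisson mean \<open>d * b ^ r / n\<close> at \<open>r = radius d t n\<close>.
  Written with \<open>\<gamma>\<close>, it makes sense for every integer \<open>t\<close>, also
  where \<open>radius\<close> is cut off, as the bi-infinite series requires.\<close>

definition mean_paths :: "nat \<Rightarrow> int \<Rightarrow> nat \<Rightarrow> real" where
  "mean_paths d t n = real d * (real d - 1) powr (of_int t - 2 * \<gamma> n d)"

lemma gamma_bounds: "0 \<le> \<gamma> n d" "\<gamma> n d < 1"
  unfolding \<gamma>_def by linarith+

lemma eventually_radius_nonneg:
  assumes d: "d \<ge> 3"
  shows "eventually (\<lambda>n. 0 \<le> 2 * \<lfloor>1/2 * log (real d - 1) (real n)\<rfloor> + t) at_top"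
proof -
  let ?b = "real d - 1"
  have b: "?b > 1" using d by simp
  have "eventually (\<lambda>n. ?b powr (2 + real_of_int \<bar>t\<bar>) \<le> real n) at_top"
    using filterlim_real_sequentially unfolding filterlim_at_top by blast
  then show ?thesis
  proof eventually_elim
    case (elim n)
    have "log ?b (?b powr (2 + real_of_int \<bar>t\<bar>)) \<le> log ?b (real n)"
      using b elim by (intro log_mono) auto
    then have "2 + real_of_int \<bar>t\<bar> \<le> log ?b (real n)" using b by simp
    then show ?case by linarith
  qed
qed

text \<open>By definition of \<open>\<gamma>\<close>, twice the floor is
  \<open>log b n - 2 * \<gamma>\<close>, so
  \<open>b ^ r = n * b powr (t - 2 * \<gamma>)\<close>.\<close>

lemma power_radius:
  assumes d: "d \<ge> 3" and n: "n > 0" and r: "0 \<le> 2 * \<lfloor>1/2 * log (real d - 1) (real n)\<rfloor> + t"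
  shows "real d * real (d - 1) ^ radius d t n = real n * mean_paths d t n"
proof -
  let ?b = "real d - 1"
  have b: "?b > 1" using d by simp
  have "real (d - 1) ^ radius d t n = ?b powr real (radius d t n)"
    using b d by (simp add: powr_realpow of_nat_diff)
  also have "real (radius d t n) = log ?b (real n) + (of_int t - 2 * \<gamma> n d)"
    using r by (simp add: radius_def \<gamma>_def)
  also have "?b powr \<dots> = real n * ?b powr (of_int t - 2 * \<gamma> n d)"
    unfolding powr_add using b n by simp
  finally show ?thesis by (simp add: mean_paths_def)
qed

lemma mean_paths_pos: "d \<ge> 3 \<Longrightarrow> mean_paths d t n > 0"
  by (simp add: mean_paths_def)

lemma mean_paths_le: "d \<ge> 3 \<Longrightarrow> mean_paths d t n \<le> real d * (real d - 1) powr of_int t"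
  unfolding mean_paths_def using gamma_bounds[of n d] by (intro mult_left_mono powr_mono) auto

lemma mean_paths_ge: "d \<ge> 3 \<Longrightarrow> real d * (real d - 1) powr (of_int t - 2) \<le> mean_paths d t n"
  unfolding mean_paths_def using gamma_bounds[of n d] by (intro mult_left_mono powr_mono) auto

lemma mean_paths_Suc:
  assumes "d \<ge> 3" shows "mean_paths d (t + 1) n = (real d - 1) * mean_paths d t n"
proof -
  have "(real d - 1) powr (of_int (t + 1) - 2 * \<gamma> n d) = (real d - 1) powr (1 + (of_int t - 2 * \<gamma> n d))"
    by (simp add: algebra_simps)
  also have "\<dots> = (real d - 1) * (real d - 1) powr (of_int t - 2 * \<gamma> n d)"
    unfolding powr_add using assms by simp
  finally show ?thesis by (simp add: mean_paths_def)
qed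

lemma powr_int_small:
  fixes b e :: real assumes "b > 1" "e > 0"
  obtains t0 :: int where "\<And>t. t \<le> t0 \<Longrightarrow> b powr of_int t < e"
proof
  fix t :: int assume "t \<le> \<lfloor>log b e\<rfloor> - 1"
  then have "real_of_int t < log b e" by linarith
  then show "b powr of_int t < e" using assms by (simp add: less_log_iff)
qed

lemma powr_int_large:
  fixes b e :: real assumes "b > 1" "e > 0"
  obtains t0 :: int where "\<And>t. t \<ge> t0 \<Longrightarrow> b powr of_int t > e"
proof
  fix t :: int assume "t \<ge> \<lceil>log b e\<rceil> + 1"
  then have "log b e < real_of_int t" by linarith
  then show "b powr of_int t > e" using assms by (simp add: log_less_iff)
qed

lemma eventually_linear_sqrt_le:
  fixes A B :: real assumes "A \<ge> 0" "B \<ge> 0"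
  shows "eventually (\<lambda>n. A * sqrt (real n) + B \<le> real n) at_top"
proof -
  have "eventually (\<lambda>n. (A + B + 1)\<^sup>2 \<le> real n) at_top"
    using filterlim_real_sequentially unfolding filterlim_at_top by blast
  then show ?thesis
  proof eventually_elim
    case (elim n)
    then have s: "A + B + 1 \<le> sqrt (real n)" using assms by (intro real_le_rsqrt) auto
    then have s1: "1 \<le> sqrt (real n)" using assms by linarith
    have "A * sqrt n + B * 1 \<le> A * sqrt n + B * sqrt n"
      using s1 assms by (intro add_left_mono mult_left_mono)
    also have "\<dots> \<le> sqrt n * sqrt n"
      using s assms unfolding distrib_right[symmetric] by (intro mult_right_mono) auto
    finally show ?case by simp
  qed
qed

subsection \<open>Limits along the admissible filter\<close>

lemma admissible_le: "admissible_at_top d \<le> at_top"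
  by (simp add: admissible_at_top_def)

lemma eventually_admissible: "eventually P at_top \<Longrightarrow> eventually P (admissible_at_top d)"
  using admissible_le filter_leD by blast

lemma eventually_triples_pos:
  assumes "d \<ge> 3" shows "eventually (\<lambda>n. card (triples n d) > 0) (admissible_at_top d)"
proof -
  have "eventually (\<lambda>n. d < n) at_top" by (rule eventually_gt_at_top)
  then have "eventually (\<lambda>n. (odd d \<longrightarrow> even n) \<longrightarrow> card (triples n d) > 0) at_top"
  proof eventually_elim
    case (elim n)
    show ?case
    proof
      assume "odd d \<longrightarrow> even n"
      then have "regular_graphs n d \<noteq> {}" using regular_graphs_nonempty[OF elim] by blast
      then show "card (triples n d) > 0"
        using elim by (simp add: card_triples card_gt_0_iff finite_regular_graphs)
    qed
  qed
  then show ?thesis by (simp add: admissible_at_top_def eventually_inf_principal)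
qed

definition near_radius :: "nat \<Rightarrow> int \<Rightarrow> nat \<Rightarrow> nat" where
  "near_radius d t n = radius d t n div 2"

definition far_radius :: "nat \<Rightarrow> int \<Rightarrow> nat \<Rightarrow> nat" where
  "far_radius d t n = radius d t n - radius d t n div 2"

lemma near_far_radius: "near_radius d t n + far_radius d t n = radius d t n"
  by (simp add: near_radius_def far_radius_def)

definition link_prob :: "nat \<Rightarrow> int \<Rightarrow> nat \<Rightarrow> nat \<Rightarrow> real" where
  "link_prob d t l n =
     card (link_triples n d (near_radius d t n) (far_radius d t n) l) / card (triples n d)"

definition far_prob :: "nat \<Rightarrow> int \<Rightarrow> nat \<Rightarrow> real" where
  "far_prob d t n = card (far_triples n d (radius d t n)) / card (triples n d)"

definition geo_prob :: "nat \<Rightarrow> int \<Rightarrow> nat \<Rightarrow> nat \<Rightarrow> real" where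
  "geo_prob d t l n = card (geo_triples n d l (radius d t n)) / card (triples n d)"

text \<open>Each part \<open>k\<close> of the even split satisfies \<open>2 * k <= r + 1\<close>,
  hence \<open>b ^ (2 * k) <= b * b ^ r\<close>, which is linear in \<open>n\<close>.\<close>

lemma eventually_radius_bounds:
  assumes d: "d \<ge> 3"
  obtains c :: real where "c > 0"
    "eventually (\<lambda>n. n > 0 \<and> real (d - 1) ^ near_radius d t n \<le> c * sqrt n \<and> real (d - 1) ^ far_radius d t n \<le> c * sqrt n
       \<and> 8 * d * (d - 1) ^ near_radius d t n + 4 * d \<le> n \<and> 8 * d * (d - 1) ^ far_radius d t n + 4 * d \<le> n
       \<and> 0 \<le> 2 * \<lfloor>1/2 * log (real d - 1) (real n)\<rfloor> + t) at_top"
proof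
  let ?b = "real (d - 1)"
  \<comment> \<open>The factor \<open>d - 1\<close> pays for the odd \<open>r\<close> in the split;
    the power bounds the mean divided by \<open>d\<close>.\<close>
  define c where "c = sqrt (?b * (real d - 1) powr of_int t)"
  have b: "?b > 1" using d by simp
  show c: "c > 0" using d by (simp add: c_def)
  have "eventually (\<lambda>n. 8 * d * c * sqrt (real n) + 4 * d \<le> n) at_top"
    using c by (intro eventually_linear_sqrt_le) auto
  with eventually_radius_nonneg[OF d, of t] eventually_gt_at_top[of 0]
  show "eventually (\<lambda>n. n > 0 \<and> ?b ^ near_radius d t n \<le> c * sqrt n \<and> ?b ^ far_radius d t n \<le> c * sqrt n
       \<and> 8 * d * (d - 1) ^ near_radius d t n + 4 * d \<le> n \<and> 8 * d * (d - 1) ^ far_radius d t n + 4 * d \<le> n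
       \<and> 0 \<le> 2 * \<lfloor>1/2 * log (real d - 1) (real n)\<rfloor> + t) at_top"
  proof eventually_elim
    case (elim n)
    have le: "?b ^ k \<le> c * sqrt n" if k: "2 * k \<le> Suc (radius d t n)" for k
    proof -
      have "(?b ^ k)\<^sup>2 = ?b ^ (2 * k)" by (simp add: power_even_eq)
      also have "\<dots> \<le> ?b ^ Suc (radius d t n)" using b k by (intro power_increasing) auto
      also have "\<dots> = ?b * (real n * (mean_paths d t n / d))"
        using power_radius[OF d, of n t] elim d by (simp add: field_simps)
      also have "\<dots> \<le> ?b * (real n * (real d - 1) powr of_int t)"
        using mean_paths_le[OF d, of t n] d
        by (intro mult_left_mono) (simp_all add: divide_le_eq mult.commute)
      also have "\<dots> = (c * sqrt n)\<^sup>2"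
        unfolding power_mult_distrib c_def using b by simp
      finally show ?thesis by (rule power2_le_imp_le) (use c in simp)
    qed
    have near: "?b ^ near_radius d t n \<le> c * sqrt n" by (rule le) (simp add: near_radius_def)
    have far: "?b ^ far_radius d t n \<le> c * sqrt n" by (rule le) (simp add: far_radius_def)
    have large: "8 * d * (d - 1) ^ k + 4 * d \<le> n" if "?b ^ k \<le> c * sqrt n" for k
    proof -
      have "8 * real d * ?b ^ k \<le> 8 * real d * (c * sqrt n)" using that by (rule mult_left_mono) simp
      then have "8 * real d * ?b ^ k + 4 * d \<le> n" using elim by (simp add: mult.assoc)
      then have "real (8 * d * (d - 1) ^ k + 4 * d) \<le> real n" by simp
      then show ?thesis by (simp only: of_nat_le_iff)
    qed
    show ?case using elim near far large[OF near] large[OF far] by blast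
  qed
qed

lemma const_over_sqrt_tendsto: "((\<lambda>n. C / sqrt (real n)) \<longlongrightarrow> 0) (admissible_at_top d)"
proof (rule tendsto_mono[OF admissible_le])
  show "(\<lambda>n. C / sqrt (real n)) \<longlonglongrightarrow> 0"
    by (rule tendsto_divide_0[OF tendsto_const])
      (intro filterlim_at_top_imp_at_infinity filterlim_compose[OF sqrt_at_top filterlim_real_sequentially])
qed

lemma scale_ratio:
  assumes "n > 0"
  shows "c * sqrt (real n) / n + (c * sqrt (real n)) ^ 3 / real n ^ 2 = (c + c ^ 3) / sqrt n"
proof -
  have n: "real n = sqrt n * sqrt n" "sqrt n > 0" using assms by auto
  define s where "s = sqrt (real n)"
  have "real n = s * s" "s > 0" using n by (simp_all add: s_def)
  then show ?thesis unfolding s_def[symmetric]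
    by (simp add: field_simps power2_eq_square power3_eq_cube)
qed

lemma link_prob_recursion:
  assumes d: "d \<ge> 3"
  shows "((\<lambda>n. real (Suc l) * link_prob d t (Suc l) n - mean_paths d t n * link_prob d t l n) \<longlongrightarrow> 0) (admissible_at_top d)"
proof -
  obtain c :: real where c: "c > 0" and ev:
    "eventually (\<lambda>n. n > 0 \<and> real (d - 1) ^ near_radius d t n \<le> c * sqrt n \<and> real (d - 1) ^ far_radius d t n \<le> c * sqrt n
       \<and> 8 * d * (d - 1) ^ near_radius d t n + 4 * d \<le> n \<and> 8 * d * (d - 1) ^ far_radius d t n + 4 * d \<le> n
       \<and> 0 \<le> 2 * \<lfloor>1/2 * log (real d - 1) (real n)\<rfloor> + t) at_top"
    using eventually_radius_bounds[OF d] .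
  define K where "K = 32 * real d ^ 4 + 10 * real d * (l + 1) + 2 * real l + real l * d + real d * (d + 1)"
  show ?thesis
  proof (rule Lim_null_comparison[OF _ const_over_sqrt_tendsto[of "K * (c + c ^ 3)"]])
    show "eventually (\<lambda>n. norm (real (Suc l) * link_prob d t (Suc l) n - mean_paths d t n * link_prob d t l n)
        \<le> K * (c + c ^ 3) / sqrt n) (admissible_at_top d)"
      using eventually_admissible[OF ev] eventually_triples_pos[OF d]
    proof eventually_elim
      case (elim n)
      let ?i = "near_radius d t n" and ?j = "far_radius d t n" and ?N = "real (card (triples n d))"
      let ?c = "\<lambda>l. real (card (link_triples n d ?i ?j l))"
      have m: "real d * real (d - 1) ^ (?i + ?j) / n = mean_paths d t n"
        using power_radius[OF d, of n t] elim by (simp add: near_far_radius)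
      have "\<bar>real (l + 1) * ?c (Suc l) - (real d * real (d - 1) ^ (?i + ?j) / n) * ?c l\<bar>
        \<le> K * (c * sqrt n / n + (c * sqrt n) ^ 3 / real n ^ 2) * ?N"
        using link_recursion[OF d, of ?i n ?j "c * sqrt n" l] elim by (simp add: K_def add.commute)
      also have "c * sqrt n / n + (c * sqrt n) ^ 3 / real n ^ 2 = (c + c ^ 3) / sqrt n"
        by (rule scale_ratio) (use elim in simp)
      finally have *: "\<bar>real (Suc l) * ?c (Suc l) - mean_paths d t n * ?c l\<bar> \<le> K * ((c + c ^ 3) / sqrt n) * ?N"
        unfolding m by simp
      have "real (Suc l) * link_prob d t (Suc l) n - mean_paths d t n * link_prob d t l n
        = (real (Suc l) * ?c (Suc l) - mean_paths d t n * ?c l) / ?N"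
        by (simp add: link_prob_def diff_divide_distrib)
      then show ?case using * elim by (simp add: divide_le_eq)
    qed
  qed
qed

lemma prob_le_one: "A \<subseteq> triples n d \<Longrightarrow> real (card A) / card (triples n d) \<le> 1"
  by (metis card_mono divide_le_eq_1 finite_triples of_nat_0_le_iff of_nat_le_iff order_le_less)

lemma far_prob_le_one: "far_prob d t n \<le> 1"
  unfolding far_prob_def by (rule prob_le_one) (auto simp: far_triples_def)

lemma link_prob_limit:
  assumes d: "d \<ge> 3"
  shows "((\<lambda>n. link_prob d t l n - exp (- mean_paths d t n) * mean_paths d t n ^ l / fact l * far_prob d t n)
    \<longlongrightarrow> 0) (admissible_at_top d)"
\<comment> \<open>\<open>K\<close> bounds the mean uniformly in \<open>n\<close>; Markov's
  inequality leaves \<open>2 * d * mean / L\<close>, hence \<open>C = 2 * d * K\<close>.\<close>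
proof (rule poisson_limit[where K = "real d * (real d - 1) powr of_int t" and C = "2 * real d * (real d * (real d - 1) powr of_int t)"])
  show "((\<lambda>n. real (Suc l) * link_prob d t (Suc l) n - mean_paths d t n * link_prob d t l n) \<longlongrightarrow> 0) (admissible_at_top d)" for l
    by (rule link_prob_recursion[OF d])
  show "eventually (\<lambda>n. 0 \<le> mean_paths d t n \<and> mean_paths d t n \<le> real d * (real d - 1) powr of_int t) (admissible_at_top d)"
    using mean_paths_pos[OF d] mean_paths_le[OF d] by (intro always_eventually) (auto intro: less_imp_le)
  show "0 \<le> link_prob d t l n" for l n by (simp add: link_prob_def)
  show "eventually (\<lambda>n. far_prob d t n \<le> 1) (admissible_at_top d)" by (simp add: far_prob_le_one)
  show "eventually (\<lambda>n. (\<Sum>l<L. link_prob d t l n) \<le> far_prob d t n) (admissible_at_top d)" for L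
  proof (intro always_eventually allI)
    fix n
    have "real (\<Sum>l<L. card (link_triples n d (near_radius d t n) (far_radius d t n) l)) \<le> real (card (far_triples n d (radius d t n)))"
      using far_triples_link_sum_le[where i = "near_radius d t n" and j = "far_radius d t n"]
      unfolding near_far_radius by (simp only: of_nat_le_iff)
    then show "(\<Sum>l<L. link_prob d t l n) \<le> far_prob d t n"
      unfolding link_prob_def far_prob_def sum_divide_distrib[symmetric]
      by (intro divide_right_mono) simp_all
  qed
  show "eventually (\<lambda>n. far_prob d t n \<le> (\<Sum>l<L. link_prob d t l n) + 2 * real d * (real d * (real d - 1) powr of_int t) / L)
    (admissible_at_top d)" if L: "L > 0" for L
    using eventually_triples_pos[OF d] eventually_admissible[OF eventually_gt_at_top[of 0]]
      eventually_admissible[OF eventually_radius_nonneg[OF d, of t]]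
  proof eventually_elim
    case (elim n)
    let ?i = "near_radius d t n" and ?j = "far_radius d t n" and ?N = "real (card (triples n d))"
    have N: "?N > 0" using elim by simp
    have "real (card (far_triples n d (radius d t n))) \<le> (\<Sum>l<L. real (card (link_triples n d ?i ?j l)))
      + 2 * real d ^ 2 * real (d - 1) ^ radius d t n / (real n * L) * ?N"
      using far_triples_le_link_sum[OF d elim(2) L, of ?i ?j] unfolding near_far_radius .
    then have "far_prob d t n \<le> ((\<Sum>l<L. real (card (link_triples n d ?i ?j l)))
      + 2 * real d ^ 2 * real (d - 1) ^ radius d t n / (real n * L) * ?N) / ?N"
      unfolding far_prob_def using N by (intro divide_right_mono) auto
    also have "\<dots> = (\<Sum>l<L. link_prob d t l n) + 2 * real d ^ 2 * real (d - 1) ^ radius d t n / (real n * L)"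
      using N by (simp add: add_divide_distrib link_prob_def sum_divide_distrib)
    also have "2 * real d ^ 2 * real (d - 1) ^ radius d t n / (real n * L) = 2 * real d * (real d * real (d - 1) ^ radius d t n / n) / L"
      by (simp add: power2_eq_square)
    also have "real d * real (d - 1) ^ radius d t n / n = mean_paths d t n"
      using power_radius[OF d elim(2,3)] elim(2) by simp
    also have "2 * real d * mean_paths d t n / L \<le> 2 * real d * (real d * (real d - 1) powr of_int t) / L"
      using mean_paths_le[OF d] by (intro divide_right_mono mult_left_mono) auto
    finally show ?case by simp
  qed
qed

lemma far_prob_step:
  assumes d: "d \<ge> 3"
  shows "((\<lambda>n. far_prob d (t + 1) n - exp (- mean_paths d t n) * far_prob d t n) \<longlongrightarrow> 0) (admissible_at_top d)"
proof (rule Lim_transform_eventually)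
  show "((\<lambda>n. link_prob d t 0 n - exp (- mean_paths d t n) * far_prob d t n) \<longlongrightarrow> 0) (admissible_at_top d)"
    using link_prob_limit[OF d, of t 0] by simp
  show "eventually (\<lambda>n. link_prob d t 0 n - exp (- mean_paths d t n) * far_prob d t n
      = far_prob d (t + 1) n - exp (- mean_paths d t n) * far_prob d t n) (admissible_at_top d)"
    using eventually_admissible[OF eventually_radius_nonneg[OF d, of t]]
  proof eventually_elim
    case (elim n)
    have "radius d (t + 1) n = Suc (near_radius d t n + far_radius d t n)"
      unfolding near_far_radius radius_def using elim by (simp add: nat_add_distrib flip: add.assoc)
    then show ?case by (simp add: link_prob_def far_prob_def far_triples_Suc)
  qed
qed

lemma far_prob_ge:
  assumes d: "d \<ge> 3"
  shows "eventually (\<lambda>n. 1 - 2 * (real d * (real d - 1) powr of_int t) \<le> far_prob d t n) (admissible_at_top d)"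
  using eventually_triples_pos[OF d] eventually_admissible[OF eventually_gt_at_top[of 0]]
      eventually_admissible[OF eventually_radius_nonneg[OF d, of t]]
proof eventually_elim
  case (elim n)
  let ?N = "real (card (triples n d))"
  have "?N - 2 * real d * real (d - 1) ^ radius d t n / n * ?N \<le> card (far_triples n d (radius d t n))"
    by (rule far_triples_ge[OF d elim(2)])
  also have "2 * real d * real (d - 1) ^ radius d t n / n = 2 * mean_paths d t n"
    using power_radius[OF d elim(2,3)] elim(2) by (simp add: mult.assoc)
  finally have "(1 - 2 * mean_paths d t n) * ?N \<le> card (far_triples n d (radius d t n))"
    by (simp add: left_diff_distrib)
  then have "1 - 2 * mean_paths d t n \<le> far_prob d t n"
    using elim by (simp add: far_prob_def le_divide_eq)
  then show ?case using mean_paths_le[OF d, of t n] by linarith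
qed

text \<open>The expected number of paths of all shorter lengths, a geometric series.\<close>

definition total_paths :: "nat \<Rightarrow> int \<Rightarrow> nat \<Rightarrow> real" where
  "total_paths d t n = mean_paths d t n / (real d - 2)"

lemma total_paths_Suc:
  assumes "d \<ge> 3" shows "total_paths d (t + 1) n = total_paths d t n + mean_paths d t n"
  unfolding total_paths_def mean_paths_Suc[OF assms] using assms by (simp add: field_simps)

lemma total_paths_nonneg: "d \<ge> 3 \<Longrightarrow> 0 \<le> total_paths d t n"
  using mean_paths_pos[of d t n] by (simp add: total_paths_def)

lemma total_paths_le: "d \<ge> 3 \<Longrightarrow> total_paths d t n \<le> real d * (real d - 1) powr of_int t"
proof -
  assume d: "d \<ge> 3"
  have "total_paths d t n \<le> mean_paths d t n / 1"
    unfolding total_paths_def using d mean_paths_pos[OF d, of t n] by (intro divide_left_mono) auto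
  then show ?thesis using mean_paths_le[OF d, of t n] by simp
qed

lemma one_minus_exp_total_le:
  assumes "d \<ge> 3"
  shows "1 - exp (- total_paths d t n) \<le> real d * (real d - 1) powr of_int t"
  using exp_ge_add_one_self[of "- total_paths d t n"] total_paths_le[OF assms, of t n] by linarith

text \<open>At a very negative \<open>t0\<close> both quantities are close to 1 for all large
  \<open>n\<close>. Finitely many steps lead from \<open>t0\<close> to \<open>t\<close>; each
  multiplies the error by a factor of at most 1 and adds o(1), while the exponents accumulate as in
  \<open>total_paths_Suc\<close>.\<close>

lemma far_prob_limit:
  assumes d: "d \<ge> 3"
  shows "((\<lambda>n. far_prob d t n - exp (- total_paths d t n)) \<longlongrightarrow> 0) (admissible_at_top d)"
proof (rule tendstoI)
  fix \<epsilon> :: real assume \<epsilon>: "\<epsilon> > 0"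
  have "real d - 1 > 1" "\<epsilon> / (6 * real d) > 0" using d \<epsilon> by auto
  then obtain t1 :: int where t1: "\<And>t. t \<le> t1 \<Longrightarrow> (real d - 1) powr of_int t < \<epsilon> / (6 * real d)"
    using powr_int_small[of "real d - 1" "\<epsilon> / (6 * real d)"] by blast
  define t0 where "t0 = min t1 t"
  \<comment> \<open>The initial error: twice \<open>d * b powr t0\<close> from
    \<open>far_prob_ge\<close> and once from the exponential.\<close>
  define D where "D = 3 * (real d * (real d - 1) powr of_int t0)"
  have "(real d - 1) powr of_int t0 < \<epsilon> / (6 * real d)" by (rule t1) (simp add: t0_def)
  then have D: "D < \<epsilon> / 2" using d by (simp add: D_def field_simps)
  \<comment> \<open>With \<open>\<delta>\<close> arbitrary, each step spends half of it on its own
    o(1) and passes the other half to the induction hypothesis.\<close>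
  have "eventually (\<lambda>n. \<bar>far_prob d (t0 + int m) n - exp (- total_paths d (t0 + int m) n)\<bar> \<le> D + \<delta>) (admissible_at_top d)"
    if "\<delta> > 0" for m \<delta>
    using that
  proof (induction m arbitrary: \<delta>)
    case 0
    show ?case
      using far_prob_ge[OF d, of t0]
    proof eventually_elim
      case (elim n)
      have "1 - exp (- total_paths d t0 n) \<le> real d * (real d - 1) powr of_int t0" "exp (- total_paths d t0 n) \<le> 1"
        using one_minus_exp_total_le[OF d] total_paths_nonneg[OF d] by auto
      moreover have "0 \<le> real d * (real d - 1) powr of_int t0" by simp
      ultimately have "\<bar>far_prob d t0 n - exp (- total_paths d t0 n)\<bar> \<le> D + \<delta>"
        using elim far_prob_le_one[of d t0 n] 0 unfolding D_def by linarith
      then show ?case by simp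
    qed
  next
    case (Suc m)
    let ?t = "t0 + int m"
    have "\<delta> / 2 > 0" using Suc.prems by simp
    from tendstoD[OF far_prob_step[OF d, of ?t] this] Suc.IH[OF this]
    show ?case
    proof eventually_elim
      case (elim n)
      let ?e = "exp (- mean_paths d ?t n)"
      have e: "0 \<le> ?e" "?e \<le> 1" using mean_paths_pos[OF d, of ?t n] by auto
      have tri: "\<bar>x\<bar> \<le> D + \<delta>" if "x = y + z" "\<bar>y\<bar> < \<delta> / 2" "\<bar>z\<bar> \<le> 1 * (D + \<delta> / 2)" for x y z :: real
        using that by (smt (verit) field_sum_of_halves mult_1)
      have "\<bar>far_prob d (?t + 1) n - exp (- total_paths d (?t + 1) n)\<bar> \<le> D + \<delta>"
      proof (rule tri)
        show "far_prob d (?t + 1) n - exp (- total_paths d (?t + 1) n) =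
          (far_prob d (?t + 1) n - ?e * far_prob d ?t n) + ?e * (far_prob d ?t n - exp (- total_paths d ?t n))"
          by (simp add: total_paths_Suc[OF d] right_diff_distrib flip: exp_add)
        show "\<bar>far_prob d (?t + 1) n - ?e * far_prob d ?t n\<bar> < \<delta> / 2" using elim(1) by simp
        show "\<bar>?e * (far_prob d ?t n - exp (- total_paths d ?t n))\<bar> \<le> 1 * (D + \<delta> / 2)"
          unfolding abs_mult using elim(2) e by (intro mult_mono) auto
      qed
      then show ?case by (simp add: add.assoc add.commute[of "int m" 1] add_ac)
    qed
  qed
  from this[of "\<epsilon> / 2" "nat (t - t0)"] \<epsilon>
  have "eventually (\<lambda>n. \<bar>far_prob d t n - exp (- total_paths d t n)\<bar> \<le> D + \<epsilon> / 2) (admissible_at_top d)"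
    by (simp add: t0_def)
  then show "eventually (\<lambda>n. dist (far_prob d t n - exp (- total_paths d t n)) 0 < \<epsilon>) (admissible_at_top d)"
    by eventually_elim (use D in simp)
qed

text \<open>The exponent at \<open>t + 1\<close> combines \<open>exp (- total_paths d t n)\<close>
  for the far event with the Poisson factor \<open>exp (- mean_paths d t n)\<close>.\<close>

definition geo_limit :: "nat \<Rightarrow> int \<Rightarrow> nat \<Rightarrow> nat \<Rightarrow> real" where
  "geo_limit d t l n = mean_paths d t n ^ l / fact l * exp (- total_paths d (t + 1) n)"

lemma geo_prob_limit:
  assumes d: "d \<ge> 3" and l: "l \<ge> 1"
  shows "((\<lambda>n. geo_prob d t l n - geo_limit d t l n) \<longlongrightarrow> 0) (admissible_at_top d)"
proof -
  obtain c :: real where c: "c > 0" and ev: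
    "eventually (\<lambda>n. n > 0 \<and> real (d - 1) ^ near_radius d t n \<le> c * sqrt n \<and> real (d - 1) ^ far_radius d t n \<le> c * sqrt n
       \<and> 8 * d * (d - 1) ^ near_radius d t n + 4 * d \<le> n \<and> 8 * d * (d - 1) ^ far_radius d t n + 4 * d \<le> n
       \<and> 0 \<le> 2 * \<lfloor>1/2 * log (real d - 1) (real n)\<rfloor> + t) at_top"
    using eventually_radius_bounds[OF d] .
  have 1: "((\<lambda>n. geo_prob d t l n - link_prob d t l n) \<longlongrightarrow> 0) (admissible_at_top d)"
  proof (rule Lim_null_comparison[OF _ const_over_sqrt_tendsto[of "64 * real d ^ 6 * (c + c ^ 3)"]])
    show "eventually (\<lambda>n. norm (geo_prob d t l n - link_prob d t l n) \<le> 64 * real d ^ 6 * (c + c ^ 3) / sqrt n) (admissible_at_top d)"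
      using eventually_admissible[OF ev] eventually_triples_pos[OF d]
    proof eventually_elim
      case (elim n)
      let ?i = "near_radius d t n" and ?j = "far_radius d t n" and ?N = "real (card (triples n d))"
      have "\<bar>real (card (geo_triples n d l (radius d t n))) - card (link_triples n d ?i ?j l)\<bar>
        \<le> 64 * real d ^ 6 * ((c * sqrt n) ^ 3 / real n ^ 2) * ?N"
        using geo_link_triples_diff[OF d l, of ?i n ?j "c * sqrt n"] elim by (simp add: near_far_radius)
      also have "\<dots> \<le> 64 * real d ^ 6 * (c * sqrt n / n + (c * sqrt n) ^ 3 / real n ^ 2) * ?N"
        using c by (intro mult_right_mono mult_left_mono) auto
      also have "c * sqrt n / n + (c * sqrt n) ^ 3 / real n ^ 2 = (c + c ^ 3) / sqrt n"
        by (rule scale_ratio) (use elim in simp)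
      finally have *: "\<bar>real (card (geo_triples n d l (radius d t n))) - card (link_triples n d ?i ?j l)\<bar>
        \<le> 64 * real d ^ 6 * ((c + c ^ 3) / sqrt n) * ?N" .
      have "geo_prob d t l n - link_prob d t l n
        = (real (card (geo_triples n d l (radius d t n))) - card (link_triples n d ?i ?j l)) / ?N"
        by (simp add: geo_prob_def link_prob_def diff_divide_distrib)
      then show ?case using * elim by (simp add: divide_le_eq)
    qed
  qed
  let ?w = "\<lambda>n. exp (- mean_paths d t n) * mean_paths d t n ^ l / fact l"
  have 2: "((\<lambda>n. ?w n * (far_prob d t n - exp (- total_paths d t n))) \<longlongrightarrow> 0) (admissible_at_top d)"
  proof (rule tendsto_bounded_mult_zero[OF _ far_prob_limit[OF d], of _ 1])
    show "eventually (\<lambda>n. \<bar>?w n\<bar> \<le> 1) (admissible_at_top d)"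
    proof (intro always_eventually allI)
      fix n
      have "0 \<le> mean_paths d t n" using mean_paths_pos[OF d, of t n] by simp
      from poisson_term_le[OF this l] this show "\<bar>?w n\<bar> \<le> 1"
        by (simp add: mult.commute order_trans[of _ "1 - exp (- mean_paths d t n)"])
    qed
  qed
  from tendsto_add[OF tendsto_add[OF 1 link_prob_limit[OF d, of t l]] 2]
  have "((\<lambda>n. geo_prob d t l n - link_prob d t l n + (link_prob d t l n - ?w n * far_prob d t n)
    + ?w n * (far_prob d t n - exp (- total_paths d t n))) \<longlongrightarrow> 0) (admissible_at_top d)" by simp
  also have "(\<lambda>n. geo_prob d t l n - link_prob d t l n + (link_prob d t l n - ?w n * far_prob d t n)
    + ?w n * (far_prob d t n - exp (- total_paths d t n))) = (\<lambda>n. geo_prob d t l n - geo_limit d t l n)"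
  proof
    fix n
    have "exp (- total_paths d (t + 1) n) = exp (- mean_paths d t n) * exp (- total_paths d t n)"
      by (simp add: total_paths_Suc[OF d] flip: exp_add)
    then show "geo_prob d t l n - link_prob d t l n + (link_prob d t l n - ?w n * far_prob d t n)
      + ?w n * (far_prob d t n - exp (- total_paths d t n)) = geo_prob d t l n - geo_limit d t l n"
      by (simp add: geo_limit_def right_diff_distrib diff_divide_distrib mult_ac)
  qed
  finally show ?thesis .
qed

text \<open>\<open>poisson_term_le\<close> times the limit of the far probability. The right side is
  the limiting probability of the distance itself, and it telescopes in \<open>t\<close>.\<close>

lemma geo_limit_le:
  assumes d: "d \<ge> 3" and l: "l \<ge> 1"
  shows "geo_limit d t l n \<le> exp (- total_paths d t n) - exp (- total_paths d (t + 1) n)"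
proof -
  let ?m = "mean_paths d t n"
  have "?m ^ l / fact l * exp (- ?m) \<le> 1 - exp (- ?m)"
    using mean_paths_pos[OF d, of t n] by (intro poisson_term_le l) simp
  then have "?m ^ l / fact l * exp (- ?m) * exp (- total_paths d t n) \<le> (1 - exp (- ?m)) * exp (- total_paths d t n)"
    by (rule mult_right_mono) simp
  moreover have "exp (- total_paths d (t + 1) n) = exp (- ?m) * exp (- total_paths d t n)"
    by (simp add: total_paths_Suc[OF d] flip: exp_add)
  ultimately show ?thesis by (simp add: geo_limit_def left_diff_distrib mult.assoc)
qed

lemma geo_limit_nonneg: "d \<ge> 3 \<Longrightarrow> 0 \<le> geo_limit d t l n"
  using mean_paths_pos[of d t n] by (simp add: geo_limit_def)

subsection \<open>Summation over the distance\<close>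

definition geodesic_triples :: "nat \<Rightarrow> nat \<Rightarrow> nat \<Rightarrow> (nat set set \<times> nat \<times> nat) set" where
  "geodesic_triples n d l = {(E, u, v) \<in> triples n d. card (geodesics E u v) = l}"

lemma finite_geo_triples: "finite (geo_triples n d l r)"
  by (rule finite_subset[OF _ finite_far_triples]) (auto simp: geo_triples_def)

lemma card_UN_geo_triples:
  "card (\<Union>r\<in>{R0..<R1}. geo_triples n d l r) = (\<Sum>r\<in>{R0..<R1}. card (geo_triples n d l r))"
proof (rule card_UN_disjoint)
  have "geo_triples n d l r \<inter> geo_triples n d l s = {}" if "r < s" for r s
    using nbhd_mono[of "Suc r" s] that by (fastforce simp: geo_triples_def far_triples_def)
  then show "\<forall>r\<in>{R0..<R1}. \<forall>s\<in>{R0..<R1}. r \<noteq> s \<longrightarrow> geo_triples n d l r \<inter> geo_triples n d l s = {}"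
    by (metis inf_commute linorder_neqE_nat)
qed (auto simp: finite_geo_triples)

text \<open>The distance of a triple with \<open>l\<close> geodesics is at most \<open>R0\<close>,
  within the window, or beyond \<open>R1\<close> (possibly infinite). The upper bound is written
  additively to avoid subtraction in \<open>nat\<close>.\<close>

lemma card_geodesic_triples_bounds:
  assumes R: "R0 \<le> R1"
  shows "(\<Sum>r\<in>{R0..<R1}. card (geo_triples n d l r)) \<le> card (geodesic_triples n d l)"
    "card (geodesic_triples n d l) + card (far_triples n d R0)
      \<le> (\<Sum>r\<in>{R0..<R1}. card (geo_triples n d l r)) + card (triples n d) + card (far_triples n d R1)"
proof -
  let ?U = "\<Union>r\<in>{R0..<R1}. geo_triples n d l r"
  have fin: "finite (geodesic_triples n d l)"
    by (rule finite_subset[OF _ finite_triples]) (auto simp: geodesic_triples_def)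
  show "(\<Sum>r\<in>{R0..<R1}. card (geo_triples n d l r)) \<le> card (geodesic_triples n d l)"
    unfolding card_UN_geo_triples[symmetric]
    by (rule card_mono[OF fin]) (auto simp: geo_triples_def far_triples_def geodesic_triples_def)
  have sub: "far_triples n d R0 \<subseteq> triples n d" by (auto simp: far_triples_def)
  have "geodesic_triples n d l \<subseteq> (triples n d - far_triples n d R0) \<union> (?U \<union> far_triples n d R1)"
  proof
    fix p assume p: "p \<in> geodesic_triples n d l"
    obtain E u v where pe: "p = (E, u, v)" by (metis surj_pair)
    have T: "(E, u, v) \<in> triples n d" and c: "card (geodesics E u v) = l"
      using p pe by (auto simp: geodesic_triples_def)
    show "p \<in> (triples n d - far_triples n d R0) \<union> (?U \<union> far_triples n d R1)"
    proof (cases "v \<in> nbhd E u R0 \<or> v \<notin> nbhd E u R1")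
      case True
      then show ?thesis using T pe by (auto simp: far_triples_def)
    next
      case False
      then obtain r where r: "r \<le> R1" "v \<in> sphere_at E u r" using nbhd_sphere by metis
      have "\<not> r \<le> R0"
        using False r nbhd_mono[of r R0 E u] sphere_subset_nbhd[of E u r] by blast
      then obtain s where s: "r = Suc s" "R0 \<le> s" by (cases r) auto
      then have "p \<in> geo_triples n d l s"
        using r T c pe by (auto simp: geo_triples_def far_triples_def sphere_at_Suc)
      then show ?thesis using s r by auto
    qed
  qed
  then have "card (geodesic_triples n d l) \<le> card ((triples n d - far_triples n d R0) \<union> (?U \<union> far_triples n d R1))"
    by (rule card_mono[rotated]) (auto simp: finite_triples finite_geo_triples finite_far_triples)
  also have "\<dots> \<le> card (triples n d - far_triples n d R0) + (card ?U + card (far_triples n d R1))"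
    by (intro order_trans[OF card_Un_le] add_left_mono card_Un_le)
  also have "card (triples n d - far_triples n d R0) = card (triples n d) - card (far_triples n d R0)"
    by (rule card_Diff_subset[OF finite_far_triples sub])
  finally show "card (geodesic_triples n d l) + card (far_triples n d R0)
      \<le> (\<Sum>r\<in>{R0..<R1}. card (geo_triples n d l r)) + card (triples n d) + card (far_triples n d R1)"
    unfolding card_UN_geo_triples using card_mono[OF finite_triples sub] by linarith
qed

lemma geodesic_prob_bounds:
  assumes N: "card (triples n d) > 0" and t: "t0 \<le> t1"
    and r: "0 \<le> 2 * \<lfloor>1/2 * log (real d - 1) (real n)\<rfloor> + t0"
  shows "\<bar>card (geodesic_triples n d l) / card (triples n d) - (\<Sum>t\<in>{t0..<t1}. geo_prob d t l n)\<bar>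
    \<le> (1 - far_prob d t0 n) + far_prob d t1 n"
proof -
  let ?N = "real (card (triples n d))" and ?F = "2 * \<lfloor>1/2 * log (real d - 1) (real n)\<rfloor>"
  let ?S = "\<Sum>r\<in>{radius d t0 n..<radius d t1 n}. card (geo_triples n d l r)"
  \<comment> \<open>Shifts by \<open>t\<close> match radii one to one, since by \<open>r\<close> no
    radius in the window is cut off at 0.\<close>
  have "bij_betw (\<lambda>t. radius d t n) {t0..<t1} {radius d t0 n..<radius d t1 n}"
    by (rule bij_betw_byWitness[where f' = "\<lambda>k. int k - ?F"]) (use r t in \<open>auto simp: radius_def\<close>)
  then have S: "(\<Sum>t\<in>{t0..<t1}. card (geo_triples n d l (radius d t n))) = ?S"
    by (rule sum.reindex_bij_betw)
  have "(\<Sum>t\<in>{t0..<t1}. geo_prob d t l n) = real (\<Sum>t\<in>{t0..<t1}. card (geo_triples n d l (radius d t n))) / ?N"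
    by (simp add: geo_prob_def sum_divide_distrib)
  then have G: "(\<Sum>t\<in>{t0..<t1}. geo_prob d t l n) = real ?S / ?N" unfolding S .
  have "radius d t0 n \<le> radius d t1 n" unfolding radius_def using t by (intro nat_mono) simp
  note b = card_geodesic_triples_bounds[OF this, of n d l]
  have 1: "real ?S \<le> real (card (geodesic_triples n d l))" using b(1) by (simp only: of_nat_le_iff)
  have 2: "real (card (geodesic_triples n d l)) + card (far_triples n d (radius d t0 n))
    \<le> real ?S + ?N + card (far_triples n d (radius d t1 n))"
    using b(2) by (simp only: of_nat_le_iff flip: of_nat_add)
  have eq: "(1 - far_prob d t0 n) + far_prob d t1 n
    = (?N - card (far_triples n d (radius d t0 n)) + card (far_triples n d (radius d t1 n))) / ?N"
    using N by (simp add: far_prob_def diff_divide_distrib add_divide_distrib)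
  have "\<bar>real (card (geodesic_triples n d l)) - real ?S\<bar>
    \<le> ?N - card (far_triples n d (radius d t0 n)) + card (far_triples n d (radius d t1 n))"
    using 1 2 by linarith
  then have "\<bar>real (card (geodesic_triples n d l)) - real ?S\<bar> / ?N
    \<le> (?N - card (far_triples n d (radius d t0 n)) + card (far_triples n d (radius d t1 n))) / ?N"
    by (rule divide_right_mono) simp
  moreover have "\<bar>card (geodesic_triples n d l) / ?N - real ?S / ?N\<bar> = \<bar>real (card (geodesic_triples n d l)) - real ?S\<bar> / ?N"
    by (simp flip: diff_divide_distrib)
  ultimately show ?thesis unfolding G eq by simp
qed

text \<open>Two consecutive distances form one term of the series.\<close>

definition geo_limit_pair :: "nat \<Rightarrow> nat \<Rightarrow> nat \<Rightarrow> int \<Rightarrow> real" where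
  "geo_limit_pair d l n k = geo_limit d (2 * k - 2) l n + geo_limit d (2 * k - 1) l n"

lemma sum_geo_limit_pair:
  assumes "a \<le> c"
  shows "sum (geo_limit_pair d l n) {a..<c} = (\<Sum>t\<in>{2 * a - 2..<2 * c - 2}. geo_limit d t l n)"
  using assms
proof (induction c rule: int_ge_induct)
  case (step c)
  have "{a..<c + 1} = insert c {a..<c}"
    "{2 * a - 2..<2 * (c + 1) - 2} = insert (2 * c - 1) (insert (2 * c - 2) {2 * a - 2..<2 * c - 2})"
    using step by auto
  with step show ?case by (simp add: geo_limit_pair_def)
qed simp

lemma infsum_geo_limit_pair:
  assumes d: "d \<ge> 3" and l: "l \<ge> 1" and ac: "a \<le> c"
  shows "(\<Sum>t\<in>{2 * a - 2..<2 * c - 2}. geo_limit d t l n) \<le> infsum (geo_limit_pair d l n) UNIV"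
    "infsum (geo_limit_pair d l n) UNIV \<le> (\<Sum>t\<in>{2 * a - 2..<2 * c - 2}. geo_limit d t l n)
      + (1 - exp (- total_paths d (2 * a - 2) n)) + exp (- total_paths d (2 * c - 2) n)"
proof -
  let ?h = "\<lambda>k. exp (- total_paths d (2 * k - 2) n)"
  have f: "0 \<le> geo_limit_pair d l n k" for k
    using geo_limit_nonneg[OF d] by (simp add: geo_limit_pair_def)
  have fh: "geo_limit_pair d l n k \<le> ?h k - ?h (k + 1)" for k
    using geo_limit_le[OF d l, of "2 * k - 2" n] geo_limit_le[OF d l, of "2 * k - 1" n]
    by (simp add: geo_limit_pair_def)
  have h: "0 \<le> ?h k" "?h k \<le> 1" for k using total_paths_nonneg[OF d] by auto
  show "(\<Sum>t\<in>{2 * a - 2..<2 * c - 2}. geo_limit d t l n) \<le> infsum (geo_limit_pair d l n) UNIV"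
    using infsum_telescoping(1)[where f = "geo_limit_pair d l n" and h = ?h, OF f fh h ac] by (simp add: sum_geo_limit_pair[OF ac])
  show "infsum (geo_limit_pair d l n) UNIV \<le> (\<Sum>t\<in>{2 * a - 2..<2 * c - 2}. geo_limit d t l n)
      + (1 - exp (- total_paths d (2 * a - 2) n)) + exp (- total_paths d (2 * c - 2) n)"
    using infsum_telescoping(2)[where f = "geo_limit_pair d l n" and h = ?h, OF f fh h ac] by (simp add: sum_geo_limit_pair[OF ac])
qed

text \<open>A window of shifts chosen independently of \<open>n\<close> carries nearly all of both
  the probability and the series; inside it finitely many termwise limits suffice.\<close>

lemma geodesic_prob_limit:
  assumes d: "d \<ge> 3" and l: "l \<ge> 1"
  shows "((\<lambda>n. card (geodesic_triples n d l) / card (triples n d) - infsum (geo_limit_pair d l n) UNIV) \<longlongrightarrow> 0)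
    (admissible_at_top d)"
proof (rule tendstoI)
  fix \<epsilon> :: real assume \<epsilon>: "\<epsilon> > 0"
  let ?b = "real d - 1"
  have b: "?b > 1" using d by simp
  obtain ta :: int where ta: "\<And>t. t \<le> ta \<Longrightarrow> ?b powr of_int t < \<epsilon> / (12 * real d)"
    using powr_int_small[OF b, of "\<epsilon> / (12 * real d)"] \<epsilon> d by auto
  define y where "y = max 1 (ln (12 / \<epsilon>))"
  have y: "y > 0" "exp (- y) \<le> \<epsilon> / 12"
  proof -
    show "y > 0" by (simp add: y_def)
    have "exp (- y) \<le> exp (- ln (12 / \<epsilon>))" by (simp add: y_def)
    also have "\<dots> = \<epsilon> / 12" using \<epsilon> by (simp add: exp_minus)
    finally show "exp (- y) \<le> \<epsilon> / 12" .
  qed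
  obtain tc :: int where tc: "\<And>t. t \<ge> tc \<Longrightarrow> ?b powr of_int t > y * (real d - 2)"
    using powr_int_large[OF b, of "y * (real d - 2)"] y d by auto
  define a where "a = ta div 2"
  \<comment> \<open>Ensures \<open>tc <= 2 * c - 4\<close>: \<open>mean_paths_ge\<close> lowers the
    exponent \<open>2 * c - 2\<close> by another 2 to allow for \<open>\<gamma>\<close>.\<close>
  define c where "c = max a (\<bar>tc\<bar> + 4)"
  have ac: "a \<le> c" by (simp add: c_def)
  have a: "real d * ?b powr of_int (2 * a - 2) < \<epsilon> / 12"
  proof -
    have "?b powr of_int (2 * a - 2) < \<epsilon> / (12 * real d)" by (rule ta) (simp add: a_def)
    then have "real d * ?b powr of_int (2 * a - 2) < real d * (\<epsilon> / (12 * real d))"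
      using d by (intro mult_strict_left_mono) auto
    then show ?thesis using d by simp
  qed
  have c: "exp (- total_paths d (2 * c - 2) n) \<le> \<epsilon> / 12" for n
  proof -
    have "\<bar>tc\<bar> + 4 \<le> c" by (simp add: c_def)
    then have "tc \<le> 2 * c - 4" by linarith
    from tc[OF this] have "y * (real d - 2) \<le> 1 * ?b powr of_int (2 * c - 4)" by simp
    also have "\<dots> \<le> real d * ?b powr of_int (2 * c - 4)" using d by (intro mult_right_mono) auto
    also have "\<dots> \<le> mean_paths d (2 * c - 2) n"
      using mean_paths_ge[OF d, of "2 * c - 2" n] by simp
    finally have "y \<le> total_paths d (2 * c - 2) n"
      using d by (simp add: total_paths_def le_divide_eq)
    then have "exp (- total_paths d (2 * c - 2) n) \<le> exp (- y)" by simp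
    then show ?thesis using y(2) by linarith
  qed
  let ?I = "{2 * a - 2..<2 * c - 2}"
  have "((\<lambda>n. \<Sum>t\<in>?I. geo_prob d t l n - geo_limit d t l n) \<longlongrightarrow> (\<Sum>t\<in>?I. 0)) (admissible_at_top d)"
    by (intro tendsto_sum geo_prob_limit[OF d l])
  then have lim: "((\<lambda>n. \<Sum>t\<in>?I. geo_prob d t l n - geo_limit d t l n) \<longlongrightarrow> 0) (admissible_at_top d)"
    by simp
  have "\<epsilon> / 12 > 0" using \<epsilon> by simp
  from tendstoD[OF lim this] tendstoD[OF far_prob_limit[OF d, of "2 * c - 2"] this]
    far_prob_ge[OF d, of "2 * a - 2"] eventually_triples_pos[OF d]
    eventually_admissible[OF eventually_radius_nonneg[OF d, of "2 * a - 2"]]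
  show "eventually (\<lambda>n. dist (card (geodesic_triples n d l) / card (triples n d) - infsum (geo_limit_pair d l n) UNIV) 0 < \<epsilon>)
    (admissible_at_top d)"
  proof eventually_elim
    case (elim n)
    define p where "p = real (card (geodesic_triples n d l)) / card (triples n d)"
    define G where "G = (\<Sum>t\<in>?I. geo_prob d t l n)"
    define T where "T = (\<Sum>t\<in>?I. geo_limit d t l n)"
    define S where "S = infsum (geo_limit_pair d l n) UNIV"
    define q0 where "q0 = far_prob d (2 * a - 2) n"
    define q1 where "q1 = far_prob d (2 * c - 2) n"
    define e0 where "e0 = exp (- total_paths d (2 * a - 2) n)"
    define e1 where "e1 = exp (- total_paths d (2 * c - 2) n)"
    define \<delta> where "\<delta> = \<epsilon> / 12"
    have "\<bar>G - T\<bar> < \<delta>" using elim(1) by (simp add: G_def T_def \<delta>_def sum_subtractf)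
    moreover have "\<bar>q1 - e1\<bar> < \<delta>" using elim(2) by (simp add: q1_def e1_def \<delta>_def)
    moreover have "1 - 2 * \<delta> \<le> q0" using elim(3) a unfolding q0_def \<delta>_def by linarith
    moreover have "\<bar>p - G\<bar> \<le> (1 - q0) + q1"
      unfolding p_def G_def q0_def q1_def
      by (rule geodesic_prob_bounds[OF elim(4) _ elim(5)]) (use ac in simp)
    moreover have "e1 \<le> \<delta>" using c[of n] by (simp add: e1_def \<delta>_def)
    moreover have "1 - e0 \<le> \<delta>"
      using one_minus_exp_total_le[OF d, of "2 * a - 2" n] a unfolding e0_def \<delta>_def by linarith
    moreover have "T \<le> S" "S \<le> T + (1 - e0) + e1"
      using infsum_geo_limit_pair[OF d l ac, of n] by (simp_all add: T_def S_def e0_def e1_def)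
    \<comment> \<open>The gaps from \<open>p\<close> to \<open>G\<close>, from \<open>G\<close> to
      \<open>T\<close> and from \<open>T\<close> to \<open>S\<close> cost at most 4, 1 and 2 times
      \<open>\<delta>\<close>.\<close>
    ultimately have "\<bar>p - S\<bar> \<le> 8 * \<delta>" by linarith
    then have "\<bar>p - S\<bar> < \<epsilon>" using \<epsilon> unfolding \<delta>_def by linarith
    then show ?case by (simp add: p_def S_def)
  qed
qed

section \<open>From differences to the ratio\<close>

text \<open>Since \<open>0 <= \<gamma> < 1\<close>, the single term at \<open>t = -2\<close> stays
  above a positive constant for all \<open>n\<close>. This is what turns a vanishing difference into
  asymptotic equivalence.\<close>

lemma infsum_geo_limit_pair_ge:
  assumes d: "d \<ge> 3" and l: "l \<ge> 1"
  obtains c0 :: real where "c0 > 0" "\<And>n. c0 \<le> infsum (geo_limit_pair d l n) UNIV"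
proof
  define m where "m = real d * (real d - 1) powr (- 4)"
  define M where "M = real d * (real d - 1) powr (- 1)"
  show "m ^ l / fact l * exp (- M) > 0" using d by (simp add: m_def)
  fix n
  have m: "0 \<le> m" "m \<le> mean_paths d (- 2) n"
    using mean_paths_ge[OF d, of "- 2" n] by (simp_all add: m_def)
  have M: "total_paths d (- 1) n \<le> M" using total_paths_le[OF d, of "- 1" n] by (simp add: M_def)
  have "m ^ l / fact l * exp (- M) \<le> geo_limit d (- 2) l n"
    unfolding geo_limit_def using m M
    by (intro mult_mono divide_right_mono power_mono) auto
  also have "\<dots> \<le> (\<Sum>t\<in>{2 * 0 - 2..<2 * 1 - 2}. geo_limit d t l n)"
    by (rule member_le_sum) (auto simp: geo_limit_nonneg[OF d])
  also have "\<dots> \<le> infsum (geo_limit_pair d l n) UNIV"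
    by (rule infsum_geo_limit_pair(1)[OF d l]) simp
  finally show "m ^ l / fact l * exp (- M) \<le> infsum (geo_limit_pair d l n) UNIV" .
qed

text \<open>The second mean of a pair is \<open>d - 1\<close> times the first, and the two exponents
  differ by exactly that second mean, so the first term can be factored out.\<close>

lemma geo_limit_pair_eq:
  assumes d: "d \<ge> 3"
  shows "geo_limit_pair d l n k =
    (real d * (real d - 1) powr (2 * of_int k - 2 * \<gamma> n d - 2)) ^ l / fact l
       * exp (- (real d * (real d - 1) powr (2 * of_int k - 2 * \<gamma> n d - 1) / (real d - 2)))
       * (1 + (real d - 1) ^ l
              * exp (- (real d * (real d - 1) powr (2 * of_int k - 2 * \<gamma> n d - 1))))"
proof -
  let ?m = "mean_paths d (2 * k - 2) n" and ?m' = "mean_paths d (2 * k - 1) n"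
  have m: "?m = real d * (real d - 1) powr (2 * of_int k - 2 * \<gamma> n d - 2)"
    "?m' = real d * (real d - 1) powr (2 * of_int k - 2 * \<gamma> n d - 1)"
    by (simp_all add: mean_paths_def algebra_simps)
  have mm: "?m' = (real d - 1) * ?m" using mean_paths_Suc[OF d, of "2 * k - 2" n] by simp
  have T: "total_paths d (2 * k - 2 + 1) n = ?m' / (real d - 2)" by (simp add: total_paths_def)
  have T': "exp (- total_paths d (2 * k - 1 + 1) n) = exp (- (?m' / (real d - 2))) * exp (- ?m')"
    using total_paths_Suc[OF d, of "2 * k - 1" n]
    by (simp add: total_paths_def[of d "2 * k - 1"] flip: exp_add)
  have "geo_limit_pair d l n k = ?m ^ l / fact l * exp (- (?m' / (real d - 2)))
      + ?m' ^ l / fact l * (exp (- (?m' / (real d - 2))) * exp (- ?m'))"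
    unfolding geo_limit_pair_def geo_limit_def T T' ..
  also have "?m' ^ l = (real d - 1) ^ l * ?m ^ l" unfolding mm power_mult_distrib ..
  also have "?m ^ l / fact l * exp (- (?m' / (real d - 2)))
      + (real d - 1) ^ l * ?m ^ l / fact l * (exp (- (?m' / (real d - 2))) * exp (- ?m'))
    = ?m ^ l / fact l * exp (- (?m' / (real d - 2))) * (1 + (real d - 1) ^ l * exp (- ?m'))"
    by (simp add: distrib_left add_divide_distrib mult_ac)
  finally show ?thesis unfolding m .
qed

lemma pair_pmf_of_set:
  fixes A :: "'a set" and B :: "'b set"
  assumes "finite A" "A \<noteq> {}" "finite B" "B \<noteq> {}"
  shows "pair_pmf (pmf_of_set A) (pmf_of_set B) = pmf_of_set (A \<times> B)"
proof (rule pmf_eqI)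
  fix p :: "'a \<times> 'b"
  obtain a b where p: "p = (a, b)" by (cases p)
  have "finite (A \<times> B)" "A \<times> B \<noteq> {}" using assms by auto
  then show "pmf (pair_pmf (pmf_of_set A) (pmf_of_set B)) p = pmf (pmf_of_set (A \<times> B)) p"
    using assms by (simp add: p pmf_pair indicator_def card_cartesian_product del: Times_empty)
qed

lemma prob_geodesics:
  assumes "card (triples n d) > 0"
  shows "measure_pmf.prob (random_graph_and_vertices n d) {(E, u, v). card (geodesics E u v) = l}
    = card (geodesic_triples n d l) / card (triples n d)"
proof -
  let ?G = "regular_graphs n d"
  have ne: "?G \<noteq> {}" "{..<n} \<noteq> {}" and fin: "finite ?G"
    using assms by (auto simp: triples_def card_gt_0_iff finite_regular_graphs)
  have "random_graph_and_vertices n d = pmf_of_set (triples n d)"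
    using ne fin unfolding random_graph_and_vertices_def random_regular_graph_def triples_def
    by (simp add: pair_pmf_of_set)
  moreover have "triples n d \<inter> {(E, u, v). card (geodesics E u v) = l} = geodesic_triples n d l"
    by (auto simp: geodesic_triples_def)
  moreover have "triples n d \<noteq> {}" using assms by auto
  ultimately show ?thesis by (simp add: measure_pmf_of_set finite_triples)
qed

theorem theorem2p6:
  fixes d l :: nat
  assumes "d \<ge> 3" and "l \<ge> 1"
  shows "(\<lambda>n. measure_pmf.prob (random_graph_and_vertices n d)
              {(E, u, v). card (geodesics E u v) = l})
    \<sim>[admissible_at_top d]
    (\<lambda>n. \<Sum>\<^sub>\<infinity>k\<in>(UNIV :: int set).
       (real d * (real d - 1) powr (2 * of_int k - 2 * \<gamma> n d - 2)) ^ l / fact l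
       * exp (- (real d * (real d - 1) powr (2 * of_int k - 2 * \<gamma> n d - 1) / (real d - 2)))
       * (1 + (real d - 1) ^ l
              * exp (- (real d * (real d - 1) powr (2 * of_int k - 2 * \<gamma> n d - 1)))))"
proof -
  let ?S = "\<lambda>n. infsum (geo_limit_pair d l n) UNIV"
  let ?p = "\<lambda>n. measure_pmf.prob (random_graph_and_vertices n d) {(E, u, v). card (geodesics E u v) = l}"
  obtain c0 :: real where c0: "c0 > 0" "\<And>n. c0 \<le> ?S n"
    using infsum_geo_limit_pair_ge[OF assms] by blast
  have diff: "((\<lambda>n. ?p n - ?S n) \<longlongrightarrow> 0) (admissible_at_top d)"
    by (rule Lim_transform_eventually[OF geodesic_prob_limit[OF assms]])
      (use eventually_triples_pos[OF assms(1)] in eventually_elim, simp add: prob_geodesics)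
  \<comment> \<open>The ratio is 1 plus the difference divided by the series, whose reciprocal is
    bounded by \<open>1 / c0\<close>.\<close>
  have "((\<lambda>n. 1 / ?S n * (?p n - ?S n)) \<longlongrightarrow> 0) (admissible_at_top d)"
  proof (rule tendsto_bounded_mult_zero[OF _ diff, of _ "1 / c0"])
    show "eventually (\<lambda>n. \<bar>1 / ?S n\<bar> \<le> 1 / c0) (admissible_at_top d)"
    proof (intro always_eventually allI)
      fix n
      have "0 < ?S n" using c0 by (meson less_le_trans)
      then show "\<bar>1 / ?S n\<bar> \<le> 1 / c0" using c0 by (simp add: frac_le)
    qed
  qed
  from tendsto_add[OF tendsto_const[of 1] this]
  have "((\<lambda>n. 1 + 1 / ?S n * (?p n - ?S n)) \<longlongrightarrow> 1) (admissible_at_top d)" by simp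
  also have "(\<lambda>n. 1 + 1 / ?S n * (?p n - ?S n)) = (\<lambda>n. ?p n / ?S n)"
  proof
    fix n
    have "?S n \<noteq> 0" using c0(1) c0(2)[of n] by linarith
    then show "1 + 1 / ?S n * (?p n - ?S n) = ?p n / ?S n" by (simp add: diff_divide_distrib)
  qed
  finally have "?p \<sim>[admissible_at_top d] ?S" by (rule asymp_equivI')
  then show ?thesis unfolding geo_limit_pair_eq[OF assms(1), abs_def] .
qed

end
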